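(* Let $\lambda$ be a partition of $N$ and $H_T$ a connected component of $H_\lambda$. (1) For each vertex $(\tau,v)$ of $H_T$, $J_{v,\tau}\mathcal{A}$ is a scalar multiple of $J_{\lambda_T,\mathrm{std}(T)}\mathcal{A}$. (2) $J_{\lambda_T,\mathrm{std}(T)}\mathcal{A}\ne0$ if and only if $H_T$ is $(-1)$-compatible. (3) If $H_T$ is $(-1)$-compatible, then $J'_T=\sum_{(\tau,v)\text{ vertex of }H_T}\mathcal{F}_{v,\tau}J_{v,\tau}$ is antisymmetric, i.e. $J'_T(s_i\otimes s_i)=-J'_T$ for all $1\le i<N$.
   Context: Partitions in French convention (rows numbered bottom to top). An RST of shape $\lambda\vdash N$ is a bijective filling with $1,\dots,N$ strictly decreasing along rows (left to right) and columns (bottom to top); $\mathrm{CT}_\tau[i]=c-r$ if $i$ is in column $c$, row $r$; $\tau_\lambda$ fills the columns left to right, each bottom to top, with $N,\dots,1$. For $v\in\mathbb{N}^N$: $v^+$ decreasing rearrangement; $\sigma_v$ labels positions by $1,\dots,N$ in order of decreasing entries, ties left to right; $vs_i$ swaps entries $i,i+1$; $v\Psi=[v[2],\dots,v[N],v[1]+1]$. $\alpha$ indeterminate; $\zeta_{v,\tau}[i]=\alpha v[i]+\mathrm{CT}_\tau[\sigma_v[i]]$. Graph $G_\lambda$: vertices are pairs $(\tau,v)$ reachable from $(\tau_\lambda,0^N)$ plus $\varnothing$; from $(\tau,v)$: edge $\Psi$ to $(\tau,v\Psi)$; edge $s_i$ to $(\tau,vs_i)$ if $v[i]<v[i+1]$;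 if $v[i]=v[i+1]$ and $\mathrm{CT}_\tau[\sigma_v[i]]-\mathrm{CT}_\tau[\sigma_v[i]+1]\ge2$, edge $s_i$ to $(\tau',v)$, $\tau'$ obtained by interchanging $\sigma_v[i],\sigma_v[i]+1$; if $v[i]=v[i+1]$ and this interchange is not an RST, edge $s_i$ to $\varnothing$. $H_\lambda$: remove from $G_\lambda$ the $\Psi$-edges, $\varnothing$ and edges into it. $T(\tau,v)$: replace each entry $i$ of $\tau$ by $v^+[i]$; vertices with $T(\tau,v)=T$ form a connected component $H_T$. $H_T$ is $(-1)$-compatible if $T$ is strictly increasing along each row. $\lambda_T\in\mathbb{N}^N$: decreasing arrangement of the entries of $T$. $\mathrm{std}(T)$: for each value $k$, with $n_j$ the number of entries equal to $j$, the entries equal to $k$, read row by row from bottom to top and left to right, are replaced by $N-\sum_{j<k}n_j,\dots,N-\sum_{j\le k}n_j+1$ successively. Coefficients $\mathcal{F}_{v,\tau}$: $\mathcal{F}=1$ at the vertex of $H_T$ without incoming edge; for an edge $s_i$ of $H_T$ from $(\tau',v')$ to $(\tau,v)$, $\mathcal{F}_{v,\tau}=-\frac{\zeta[i]-\zeta[i+1]}{\zeta[i]-\zeta[i+1]+1}\mathcal{F}_{v',\tau'}$ with $\zeta=\zeta_{v,\tau}$ (consistently defined). $V_\lambda$: $\mathbb{Q}(\alpha)$-space with basis the RSTs of shape $\lambda$, right action: with $b=1/(\mathrm{CT}_\tau[i]-\mathrm{CT}_\tau[i+1])$, $\tau s_i=b\tau$ if $b=\pm1$; $b\tau+\tau^{(i,i+1)}$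 if $0<b\le\frac12$; $b\tau+(1-b^2)\tau^{(i,i+1)}$ otherwise. $M_\lambda=\mathbb{Q}(\alpha)[x_1,\dots,x_N]\otimes V_\lambda$, operators on the right, $(f\otimes t)(\omega\otimes\omega)=(f\omega)\otimes(t\omega)$; $P\Psi=x_N\cdot(P(\theta\otimes\theta))$, $\theta=s_1\cdots s_{N-1}$. $\mathcal{A}=\sum_{\omega\in\mathfrak{S}_N}(-1)^{\ell(\omega)}\omega\otimes\omega$. $J_{v,\tau}$: $J_{0^N,\tau_\lambda}=1\otimes\tau_\lambda$ and along each edge from $(\tau,v)$: $s_i$-edge to $w$: $J_w=J_{v,\tau}\big(s_i\otimes s_i+\frac1{\zeta_{v,\tau}[i+1]-\zeta_{v,\tau}[i]}\big)$; $\Psi$-edge: $J_{v\Psi,\tau}=J_{v,\tau}\Psi$ (path-independent). *)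

theory Defs
  imports
    "HOL-Library.Poly_Mapping"
    "HOL-Library.Multiset"
    "HOL-Computational_Algebra.Polynomial"
    "HOL-Computational_Algebra.Fraction_Field"
    "HOL-Combinatorics.Permutations"
begin

definition partition_of :: "nat list \<Rightarrow> nat \<Rightarrow> bool" where
  "partition_of lam N \<longleftrightarrow> sorted_wrt (\<ge>) lam \<and> 0 \<notin> set lam \<and> sum_list lam = N"

text \<open>Cells are pairs (row, column), both counted from 1; row 1 is the bottom row. A filling is a
  function on cells that vanishes outside the diagram, so that fillings of a given shape are equal
  as functions iff they agree on the diagram.\<close>

type_synonym cell = "nat \<times> nat"
type_synonym tableau = "cell \<Rightarrow> nat"

definition diagram :: "nat list \<Rightarrow> cell set" where
  "diagram lam = {(r, c). 1 \<le> r \<and> r \<le> length lam \<and> 1 \<le> c \<and> c \<le> lam ! (r - 1)}"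

definition RST :: "nat list \<Rightarrow> tableau \<Rightarrow> bool" where
  "RST lam \<tau> \<longleftrightarrow>
     bij_betw \<tau> (diagram lam) {1..sum_list lam} \<and>
     (\<forall>x. x \<notin> diagram lam \<longrightarrow> \<tau> x = 0) \<and>
     (\<forall>r c c'. (r, c) \<in> diagram lam \<and> (r, c') \<in> diagram lam \<and> c < c' \<longrightarrow> \<tau> (r, c) > \<tau> (r, c')) \<and>
     (\<forall>r r' c. (r, c) \<in> diagram lam \<and> (r', c) \<in> diagram lam \<and> r < r' \<longrightarrow> \<tau> (r, c) > \<tau> (r', c))"

definition CT :: "nat list \<Rightarrow> tableau \<Rightarrow> nat \<Rightarrow> int" where
  "CT lam \<tau> i = (case inv_into (diagram lam) \<tau> i of (r, c) \<Rightarrow> int c - int r)"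

definition root_tableau :: "nat list \<Rightarrow> tableau" where
  "root_tableau lam = (\<lambda>(r, c). if (r, c) \<in> diagram lam
     then sum_list lam - card {(r', c'). (r', c') \<in> diagram lam \<and> (c' < c \<or> c' = c \<and> r' < r)}
     else 0)"

definition interchange :: "nat \<Rightarrow> tableau \<Rightarrow> tableau" where
  "interchange i \<tau> = transpose i (Suc i) \<circ> \<tau>"

text \<open>A vector of length N is a list; the mathematical indices run from 1 to N.\<close>

abbreviation entry :: "nat list \<Rightarrow> nat \<Rightarrow> nat" where
  "entry v i \<equiv> v ! (i - 1)"

definition decreasing :: "nat list \<Rightarrow> nat list" where
  "decreasing v = rev (sort v)"

definition rank :: "nat list \<Rightarrow> nat \<Rightarrow> nat" where
  "rank v i = card {j \<in> {1..length v}. entry v j > entry v i}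
            + card {j \<in> {1..i}. entry v j = entry v i}"

definition swap_entries :: "nat \<Rightarrow> nat list \<Rightarrow> nat list" where
  "swap_entries i v = v[i - 1 := entry v (i + 1), i := entry v i]"

definition affine_shift :: "nat list \<Rightarrow> nat list" where
  "affine_shift v = tl v @ [hd v + 1]"

type_synonym ratfun = "rat poly fract"

definition \<alpha> :: ratfun where
  "\<alpha> = Fract [:0, 1:] 1"

definition const :: "rat \<Rightarrow> ratfun" where
  "const q = Fract [:q:] 1"

definition zeta :: "nat list \<Rightarrow> tableau \<times> nat list \<Rightarrow> nat \<Rightarrow> ratfun" where
  "zeta lam = (\<lambda>(\<tau>, v) i. \<alpha> * of_nat (entry v i) + of_int (CT lam \<tau> (rank v i)))"

type_synonym vertex = "tableau \<times> nat list"

datatype label = Affine | Simple nat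

text \<open>The sink \<open>\<emptyset>\<close> is represented by \<^term>\<open>None\<close>.\<close>

inductive G_edge :: "nat list \<Rightarrow> vertex \<Rightarrow> label \<Rightarrow> vertex option \<Rightarrow> bool" for lam where
  affine: "G_edge lam (\<tau>, v) Affine (Some (\<tau>, affine_shift v))"
| step: "1 \<le> i \<Longrightarrow> i < sum_list lam \<Longrightarrow> entry v i < entry v (i + 1) \<Longrightarrow>
    G_edge lam (\<tau>, v) (Simple i) (Some (\<tau>, swap_entries i v))"
| tableau_step: "1 \<le> i \<Longrightarrow> i < sum_list lam \<Longrightarrow> entry v i = entry v (i + 1) \<Longrightarrow>
    CT lam \<tau> (rank v i) - CT lam \<tau> (rank v i + 1) \<ge> 2 \<Longrightarrow>
    G_edge lam (\<tau>, v) (Simple i) (Some (interchange (rank v i) \<tau>, v))"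
| fall: "1 \<le> i \<Longrightarrow> i < sum_list lam \<Longrightarrow> entry v i = entry v (i + 1) \<Longrightarrow>
    \<not> RST lam (interchange (rank v i) \<tau>) \<Longrightarrow>
    G_edge lam (\<tau>, v) (Simple i) None"

definition G_root :: "nat list \<Rightarrow> vertex" where
  "G_root lam = (root_tableau lam, replicate (sum_list lam) 0)"

inductive_set G_vertices :: "nat list \<Rightarrow> vertex option set" for lam where
  sink: "None \<in> G_vertices lam"
| root: "Some (G_root lam) \<in> G_vertices lam"
| edge: "Some x \<in> G_vertices lam \<Longrightarrow> G_edge lam x l y \<Longrightarrow> y \<in> G_vertices lam"

definition H_vertices :: "nat list \<Rightarrow> vertex set" where
  "H_vertices lam = {x. Some x \<in> G_vertices lam}"

definition H_edge :: "nat list \<Rightarrow> vertex \<Rightarrow> nat \<Rightarrow> vertex \<Rightarrow> bool" where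
  "H_edge lam x i y \<longleftrightarrow> x \<in> H_vertices lam \<and> G_edge lam x (Simple i) (Some y)"

definition H_components :: "nat list \<Rightarrow> vertex set set" where
  "H_components lam = H_vertices lam //
     {(x, y). x \<in> H_vertices lam \<and> y \<in> H_vertices lam \<and> equivclp (\<lambda>x y. \<exists>i. H_edge lam x i y) x y}"

definition filling :: "nat list \<Rightarrow> vertex \<Rightarrow> tableau" where
  "filling lam = (\<lambda>(\<tau>, v) x. if x \<in> diagram lam then entry (decreasing v) (\<tau> x) else 0)"

definition H_comp :: "nat list \<Rightarrow> tableau \<Rightarrow> vertex set" where
  "H_comp lam T = {x \<in> H_vertices lam. filling lam x = T}"

definition minus_one_compatible :: "nat list \<Rightarrow> tableau \<Rightarrow> bool" where
  "minus_one_compatible lam T \<longleftrightarrow>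
     (\<forall>r c c'. (r, c) \<in> diagram lam \<and> (r, c') \<in> diagram lam \<and> c < c' \<longrightarrow> T (r, c) < T (r, c'))"

definition lambda_T :: "nat list \<Rightarrow> tableau \<Rightarrow> nat list" where
  "lambda_T lam T = rev (sorted_list_of_multiset (image_mset T (mset_set (diagram lam))))"

definition std :: "nat list \<Rightarrow> tableau \<Rightarrow> tableau" where
  "std lam T = (\<lambda>(r, c). if (r, c) \<in> diagram lam
     then sum_list lam - (\<Sum>j < T (r, c). card {x \<in> diagram lam. T x = j})
        - card {(r', c'). (r', c') \<in> diagram lam \<and> T (r', c') = T (r, c) \<and>
                          (r' < r \<or> r' = r \<and> c' < c)}
     else 0)"

inductive F_rel :: "nat list \<Rightarrow> tableau \<Rightarrow> vertex \<Rightarrow> ratfun \<Rightarrow> bool" for lam T where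
  root: "x \<in> H_comp lam T \<Longrightarrow> \<not> (\<exists>y \<in> H_comp lam T. \<exists>i. H_edge lam y i x) \<Longrightarrow> F_rel lam T x 1"
| edge: "y \<in> H_comp lam T \<Longrightarrow> x \<in> H_comp lam T \<Longrightarrow> H_edge lam y i x \<Longrightarrow> F_rel lam T y a \<Longrightarrow>
    d = zeta lam x i - zeta lam x (i + 1) \<Longrightarrow>
    F_rel lam T x (- (d / (d + 1)) * a)"

definition F_coeff :: "nat list \<Rightarrow> tableau \<Rightarrow> vertex \<Rightarrow> ratfun" where
  "F_coeff lam T x = (THE a. F_rel lam T x a)"

text \<open>Polynomials are finitely supported functions from exponent vectors to coefficients, vectors
  are finitely supported functions from tableaux to scalars, and the tensor product of the
  polynomial ring with the space of vectors is the space of finitely supported functions from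
  tableaux to polynomials, where \<open>f \<otimes> \<tau>\<close> is \<^term>\<open>Poly_Mapping.single \<tau> f\<close>.\<close>

type_synonym mpoly = "(nat \<Rightarrow>\<^sub>0 nat) \<Rightarrow>\<^sub>0 ratfun"
type_synonym vec = "tableau \<Rightarrow>\<^sub>0 ratfun"
type_synonym vpoly = "tableau \<Rightarrow>\<^sub>0 mpoly"

definition Cst :: "ratfun \<Rightarrow> mpoly" where
  "Cst a = Poly_Mapping.single 0 a"

definition X :: "nat \<Rightarrow> mpoly" where
  "X i = Poly_Mapping.single (Poly_Mapping.single i 1) 1"

definition pmult :: "mpoly \<Rightarrow> vpoly \<Rightarrow> vpoly" where
  "pmult f = Poly_Mapping.map ((*) f)"

definition scale :: "ratfun \<Rightarrow> vpoly \<Rightarrow> vpoly" where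
  "scale a = pmult (Cst a)"

definition tensor :: "mpoly \<Rightarrow> vec \<Rightarrow> vpoly" where
  "tensor f t = (\<Sum>\<tau>\<in>Poly_Mapping.keys t. Poly_Mapping.single \<tau> (f * Cst (Poly_Mapping.lookup t \<tau>)))"

text \<open>\<open>A \<otimes> B\<close>; meaningful only for linear \<open>A\<close> and \<open>B\<close>.\<close>

definition tensor_op :: "(mpoly \<Rightarrow> mpoly) \<Rightarrow> (vec \<Rightarrow> vec) \<Rightarrow> vpoly \<Rightarrow> vpoly" where
  "tensor_op A B P =
     (\<Sum>\<tau>\<in>Poly_Mapping.keys P. tensor (A (Poly_Mapping.lookup P \<tau>)) (B (Poly_Mapping.single \<tau> 1)))"

definition poly_s :: "nat \<Rightarrow> mpoly \<Rightarrow> mpoly" where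
  "poly_s i = Poly_Mapping.map_key (Poly_Mapping.map_key (transpose i (Suc i)))"

definition tableau_s :: "nat list \<Rightarrow> nat \<Rightarrow> tableau \<Rightarrow> vec" where
  "tableau_s lam i \<tau> =
     (let b = 1 / of_int (CT lam \<tau> i - CT lam \<tau> (i + 1)) :: rat; \<tau>' = interchange i \<tau> in
      if b = 1 \<or> b = - 1 then Poly_Mapping.single \<tau> (const b)
      else if 0 < b \<and> b \<le> 1 / 2 then Poly_Mapping.single \<tau> (const b) + Poly_Mapping.single \<tau>' 1
      else Poly_Mapping.single \<tau> (const b) + Poly_Mapping.single \<tau>' (const (1 - b\<^sup>2)))"

definition vec_s :: "nat list \<Rightarrow> nat \<Rightarrow> vec \<Rightarrow> vec" where
  "vec_s lam i t =
     (\<Sum>\<tau>\<in>Poly_Mapping.keys t.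
        Poly_Mapping.map ((*) (Poly_Mapping.lookup t \<tau>)) (tableau_s lam i \<tau>))"

text \<open>A permutation acts through an expression as a word in the simple transpositions. All actions
  are on the right, so the letters of a word are applied from left to right. \<open>diag_op\<close> is
  \<open>\<omega> \<otimes> \<omega>\<close> for the permutation \<open>\<omega>\<close> given by the word.\<close>

definition diag_op :: "nat list \<Rightarrow> nat list \<Rightarrow> vpoly \<Rightarrow> vpoly" where
  "diag_op lam w = tensor_op (fold poly_s w) (fold (vec_s lam) w)"

definition word_perm :: "nat list \<Rightarrow> nat \<Rightarrow> nat" where
  "word_perm w = fold (\<lambda>i p. transpose i (Suc i) \<circ> p) w id"

definition reduced_word :: "nat \<Rightarrow> (nat \<Rightarrow> nat) \<Rightarrow> nat list" where
  "reduced_word N \<omega> = (ARG_MIN length w. set w \<subseteq> {1..<N} \<and> word_perm w = \<omega>)"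

definition coxeter_length :: "nat \<Rightarrow> (nat \<Rightarrow> nat) \<Rightarrow> nat" where
  "coxeter_length N \<omega> = length (reduced_word N \<omega>)"

definition antisymmetrizer :: "nat list \<Rightarrow> vpoly \<Rightarrow> vpoly" where
  "antisymmetrizer lam P =
     (\<Sum>\<omega> | \<omega> permutes {1..sum_list lam}.
        scale ((- 1) ^ coxeter_length (sum_list lam) \<omega>)
          (diag_op lam (reduced_word (sum_list lam) \<omega>) P))"

definition affine_op :: "nat list \<Rightarrow> vpoly \<Rightarrow> vpoly" where
  "affine_op lam P = pmult (X (sum_list lam)) (diag_op lam [1..<sum_list lam] P)"

text \<open>\<open>jack_rel\<close> relates a vertex to the value obtained along any path from the root. As the value
  does not depend on the path, \<open>jack\<close> is well defined on all vertices; \<open>F_rel\<close> and \<open>F_coeff\<close> above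
  follow the same pattern inside one component.\<close>

inductive jack_rel :: "nat list \<Rightarrow> vertex \<Rightarrow> vpoly \<Rightarrow> bool" for lam where
  root: "jack_rel lam (G_root lam) (Poly_Mapping.single (root_tableau lam) 1)"
| simple: "jack_rel lam x P \<Longrightarrow> G_edge lam x (Simple i) (Some y) \<Longrightarrow>
    jack_rel lam y (diag_op lam [i] P + scale (1 / (zeta lam x (i + 1) - zeta lam x i)) P)"
| affine: "jack_rel lam x P \<Longrightarrow> G_edge lam x Affine (Some y) \<Longrightarrow> jack_rel lam y (affine_op lam P)"

definition jack :: "nat list \<Rightarrow> vertex \<Rightarrow> vpoly" where
  "jack lam x = (THE P. jack_rel lam x P)"

definition J_antisym :: "nat list \<Rightarrow> tableau \<Rightarrow> vpoly" where
  "J_antisym lam T = (\<Sum>x\<in>H_comp lam T. scale (F_coeff lam T x) (jack lam x))"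

end

theory Submission
  imports Defs
begin

text \<open>
  A vertex \<open>(\<tau>, v)\<close> is determined by its spectral vector, the sequence of the pairs of \<open>v[i]\<close> and
  the content of the \<open>i\<close>-th position, and an edge \<open>s\<^sub>i\<close> of \<open>H\<^sub>\<lambda>\<close> exchanges two neighbouring entries
  of it. Two incoming edges of a vertex therefore complete to a square or a hexagon, or to a square
  with affine edges, and the Yang-Baxter relation makes \<open>J\<close> and \<open>F\<close> independent of the path.

  Since \<open>s\<^sub>i \<A> = - \<A>\<close>, the polynomial \<open>J \<A>\<close> is multiplied by a nonzero scalar along every edge of
  a component. If two entries of a row of \<open>T\<close> agree, they are neighbours in \<open>std T\<close> and the
  corresponding \<open>s\<^sub>i\<close> fixes \<open>J\<close>, so \<open>J \<A> = 0\<close>. If the rows of \<open>T\<close> are strict, then \<open>s\<^sub>i\<close> matches the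
  vertices of \<open>H\<^sub>T\<close> in pairs whose contribution to \<open>J'\<^sub>T\<close> is antisymmetric, and it negates \<open>J\<close> at the
  unmatched vertices; hence \<open>J'\<^sub>T\<close> is antisymmetric. A length function on exponents isolates leading
  terms and shows \<open>J'\<^sub>T \<noteq> 0\<close>, and \<open>N! J'\<^sub>T = J'\<^sub>T \<A>\<close> is a multiple of \<open>J \<A>\<close>.
\<close>

section \<open>Words in the simple transpositions\<close>

text \<open>\<open>jack\<close> and \<open>F_coeff\<close> are picked by definite description and
  \<open>reduced_word\<close> by a minimal choice, so nothing can be computed before independence of
  the path and of the word is known. The braid relation can fail for fillings in which nearby labels
  have equal contents, so the group relations are stated on the span of the reverse standard
  tableaux, which \<open>rst_poly\<close> tracks. In (2), the antisymmetrizer might kill J although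
  the rows of T are strict, and leading exponents alone do not show J'_T \<noteq> 0, as vertices
  with the same v share them. But for fixed v the leading coefficients are the images of the basis
  vectors \<tau> under one group element depending on v alone; it is invertible, so distinct
  tableaux stay independent, and no F is zero. Since \<alpha> is transcendental, a difference of
  spectral values can be 0, 1 or -1 only for equal entries of v; edges exclude these values, which
  keeps denominators and factors nonzero.\<close>

locale coxeter_action =
  fixes f :: "nat \<Rightarrow> 'a \<Rightarrow> 'a" and N :: nat
  assumes f_f: "1 \<le> i \<Longrightarrow> i < N \<Longrightarrow> f i (f i x) = x"
    and braid: "1 \<le> i \<Longrightarrow> Suc i < N \<Longrightarrow>
      f i (f (Suc i) (f i x)) = f (Suc i) (f i (f (Suc i) x))"
    and comm: "1 \<le> i \<Longrightarrow> Suc i < j \<Longrightarrow> j < N \<Longrightarrow> f i (f j x) = f j (f i x)"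
begin

lemma fold_comm:
  assumes "set w \<subseteq> {1..<N}" "1 \<le> i" "i < N" "\<And>j. j \<in> set w \<Longrightarrow> Suc i < j \<or> Suc j < i"
  shows "fold f w (f i x) = f i (fold f w x)"
  using assms
proof (induction w arbitrary: x)
  case (Cons j w)
  have "f j (f i x) = f i (f j x)"
    using comm[of i j x] comm[of j i x] Cons.prems(1-3) Cons.prems(4)[of j]
    by (metis atLeastLessThan_iff list.set_intros(1) subsetD)
  then show ?case using Cons by simp
qed simp

text \<open>The letters above j+1 commute with s_j, the braid relation turns s_j into s_{j+1} inside
  the run, and s_{j+1} commutes with the letters below j. The affine operator inherits its relations
  from this.\<close>

lemma ascending_shift:
  assumes "1 \<le> a" "a \<le> j" "Suc j < b" "b \<le> N"
  shows "f j (fold f [a..<b] x) = fold f [a..<b] (f (Suc j) x)"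
proof -
  have "[a..<b] = [a..<j] @ [j..<b]"
    using assms upt_add_eq_append[of a j "b - j"] by simp
  also have "[j..<b] = j # Suc j # [Suc (Suc j)..<b]"
    using assms by (simp add: upt_conv_Cons)
  finally have w: "[a..<b] = [a..<j] @ j # Suc j # [Suc (Suc j)..<b]" .
  have "f j (fold f [a..<b] x)
      = fold f [Suc (Suc j)..<b] (f j (f (Suc j) (f j (fold f [a..<j] x))))"
    unfolding w using fold_comm[of "[Suc (Suc j)..<b]" j] assms by auto
  also have "\<dots> = fold f [Suc (Suc j)..<b] (f (Suc j) (f j (f (Suc j) (fold f [a..<j] x))))"
    using braid[of j] assms by simp
  also have "f (Suc j) (fold f [a..<j] x) = fold f [a..<j] (f (Suc j) x)"
    using fold_comm[of "[a..<j]" "Suc j"] assms by auto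
  finally show ?thesis unfolding w by simp
qed

text \<open>Coset decomposition: an ascending run from a represents a coset of the subgroup
  generated by the later letters. A further letter j lengthens the run, cancels its last letter,
  commutes with it, or passes through it as j+1. The same w' and k serve all x.\<close>

lemma normal_form:
  assumes "set w \<subseteq> {a..<N}" "1 \<le> a" "a \<le> N"
  shows "\<exists>w' k. set w' \<subseteq> {Suc a..<N} \<and> a \<le> k \<and> k \<le> N \<and> (\<forall>x. fold f w x = fold f (w' @ [a..<k]) x)"
  using assms
proof (induction w rule: rev_induct)
  case Nil
  then show ?case by (intro exI[of _ "[]"] exI[of _ a]) auto
next
  case (snoc j w)
  then obtain w' k where w': "set w' \<subseteq> {Suc a..<N}" "a \<le> k" "k \<le> N"
      "\<And>x. fold f w x = fold f [a..<k] (fold f w' x)" and j: "a \<le> j" "j < N"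
    by auto
  have step: "fold f (w @ [j]) x = f j (fold f [a..<k] (fold f w' x))" for x
    using w' by simp
  consider "j = k" | "Suc j = k" | "k < j" | "Suc j < k" by linarith
  then show ?case
  proof cases
    case 1
    then show ?thesis using w' j step
      by (intro exI[of _ w'] exI[of _ "Suc k"]) auto
  next
    case 2
    then have "fold f (w @ [j]) x = fold f [a..<j] (fold f w' x)" for x
      using step j f_f[of j] snoc.prems by auto
    then show ?thesis using w' j 2
      by (intro exI[of _ w'] exI[of _ j]) auto
  next
    case 3
    then have "fold f (w @ [j]) x = fold f [a..<k] (f j (fold f w' x))" for x
      using step j fold_comm[of "[a..<k]" j] snoc.prems w' by auto
    then show ?thesis using w' j 3
      by (intro exI[of _ "w' @ [j]"] exI[of _ k]) auto
  next
    case 4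
    then have "fold f (w @ [j]) x = fold f [a..<k] (f (Suc j) (fold f w' x))" for x
      using step j ascending_shift[of a j k] snoc.prems w' by auto
    then show ?thesis using w' j 4
      by (intro exI[of _ "w' @ [Suc j]"] exI[of _ k]) auto
  qed
qed

end

section \<open>Permutations represented by words\<close>

lemma transpose_braid:
  "transpose i (Suc i) \<circ> (transpose (Suc i) (Suc (Suc i)) \<circ> (transpose i (Suc i) \<circ> p))
    = transpose (Suc i) (Suc (Suc i)) \<circ> (transpose i (Suc i) \<circ> (transpose (Suc i) (Suc (Suc i)) \<circ> p))"
  by (rule ext) (simp add: transpose_def)

lemma transpose_comm:
  "Suc i < j \<Longrightarrow> transpose i (Suc i) \<circ> (transpose j (Suc j) \<circ> p)
    = transpose j (Suc j) \<circ> (transpose i (Suc i) \<circ> p)"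
  by (rule ext) (simp add: transpose_def)

lemma fold_word_perm:
  "fold (\<lambda>i p. transpose i (Suc i) \<circ> p) w p = word_perm w \<circ> p"
proof -
  have "fold (\<lambda>i p. transpose i (Suc i) \<circ> p) w (q \<circ> p)
    = fold (\<lambda>i p. transpose i (Suc i) \<circ> p) w q \<circ> p" for q
    by (induction w arbitrary: q) (simp_all flip: comp_assoc)
  from this[of id] show ?thesis by (simp add: word_perm_def)
qed

lemma word_perm_Nil [simp]: "word_perm [] = id"
  by (simp add: word_perm_def)

lemma word_perm_append: "word_perm (w @ w') = word_perm w' \<circ> word_perm w"
proof -
  have "word_perm (w @ w') = fold (\<lambda>i p. transpose i (Suc i) \<circ> p) w' (word_perm w)"
    by (simp add: word_perm_def)
  then show ?thesis by (simp add: fold_word_perm)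
qed

lemma word_perm_Cons: "word_perm (i # w) = word_perm w \<circ> transpose i (Suc i)"
  using word_perm_append[of "[i]" w] by (simp add: word_perm_def)

lemma word_perm_permutes: "set w \<subseteq> {a..<N} \<Longrightarrow> word_perm w permutes {a..N}"
proof (induction w)
  case (Cons i w)
  then show ?case unfolding word_perm_Cons
    by (intro permutes_compose permutes_swap_id) auto
qed (simp add: permutes_id)

lemma sign_word_perm: "sign (word_perm w) = (-1) ^ length w"
proof (induction w)
  case (Cons i w)
  have "permutation (word_perm w)"
    by (rule permutes_imp_permutation[OF _ word_perm_permutes[of _ 0 "Suc (Max (set w))"]])
       (auto simp: less_Suc_eq_le)
  then show ?case using Cons unfolding word_perm_Cons
    by (subst sign_compose) (simp_all add: permutation_swap_id sign_swap_id)
qed simp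

lemma word_perm_ascending: "a \<le> k \<Longrightarrow> word_perm [a..<k] a = k"
  by (induction k rule: dec_induct) (auto simp: word_perm_append word_perm_Cons)

lemma word_perm_fixes: "set w \<subseteq> {Suc a..<N} \<Longrightarrow> word_perm w a = a"
  using word_perm_permutes[of w "Suc a" N] by (auto simp: permutes_def)

text \<open>The value k of \<omega> at a determines the run \<open>[a..<k]\<close>, which also sends
  a to k; what remains after dividing by it fixes a and is handled by induction on N - a.\<close>

lemma exists_word:
  assumes "\<omega> permutes {a..N}"
  shows "\<exists>w. set w \<subseteq> {a..<N} \<and> word_perm w = \<omega>"
  using assms
proof (induction "N - a" arbitrary: a \<omega>)
  case 0
  then have "{a..N} \<subseteq> {a}" by auto
  then have "\<omega> = id" using permutes_subset[OF 0(2)] by (metis permutes_sing)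
  then show ?case by (intro exI[of _ "[]"]) auto
next
  case (Suc n)
  define k where "k = \<omega> a"
  have k: "a \<le> k" "k \<le> N"
    using Suc.prems Suc.hyps(2) permutes_in_image[of \<omega> "{a..N}" a] by (auto simp: k_def)
  define c where "c = word_perm [a..<k]"
  have c: "c permutes {a..N}" "c a = k"
    using k word_perm_permutes[of "[a..<k]" a N] by (auto simp: c_def word_perm_ascending)
  have p: "inv c \<circ> \<omega> permutes {a..N}"
    using c Suc.prems by (simp add: permutes_compose permutes_inv)
  have "(inv c \<circ> \<omega>) a = a"
    using c by (simp add: k_def[symmetric]) (metis permutes_inverses(2))
  then have "inv c \<circ> \<omega> permutes {Suc a..N}"
    using p by (intro permutes_superset[OF p]) (auto simp: not_less_eq_eq)
  with Suc obtain w where w: "set w \<subseteq> {Suc a..<N}" "word_perm w = inv c \<circ> \<omega>"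
    by (metis Suc_diff_Suc Suc_inject zero_less_Suc zero_less_diff)
  have "word_perm (w @ [a..<k]) = c \<circ> (inv c \<circ> \<omega>)"
    using w by (simp add: word_perm_append c_def)
  also have "\<dots> = \<omega>" using c by (simp add: fun_eq_iff permutes_inverses)
  finally show ?case using w k by (intro exI[of _ "w @ [a..<k]"]) auto
qed

text \<open>The Coxeter relations present the symmetric group, so words with the same permutation
  act alike. This makes the action one of permutations, whichever word \<open>reduced_word\<close>
  selects.\<close>

lemma (in coxeter_action) fold_cong_word_perm:
  assumes "set w \<subseteq> {a..<N}" "set v \<subseteq> {a..<N}" "1 \<le> a" "word_perm w = word_perm v"
  shows "fold f w x = fold f v x"
  using assms
proof (induction "N - a" arbitrary: a w v x)
  case 0
  then show ?case by simp
next
  case (Suc n)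
  \<comment> \<open>Acting on pairs makes one normal form, with the same w' and k, valid for f and
    for the permutation; k can then be read off as the image of a.\<close>
  define g where "g = (\<lambda>i (x, p). (f i x, transpose i (Suc i) \<circ> (p :: nat \<Rightarrow> nat)))"
  interpret g: coxeter_action g N
    by standard (auto simp: g_def split_beta f_f braid transpose_def fun_eq_iff intro: comm)
  have fold_g: "fold g w (x, p) = (fold f w x, word_perm w \<circ> p)" for w x p
    unfolding fold_word_perm[symmetric]
    by (induction w arbitrary: x p) (auto simp: g_def)
  have a: "a \<le> N" using Suc.hyps(2) by simp
  have nf: "\<exists>w' k. set w' \<subseteq> {Suc a..<N} \<and> a \<le> k \<and> k \<le> N \<and>
      (\<forall>x. fold f w x = fold f [a..<k] (fold f w' x)) \<and> word_perm w = word_perm [a..<k] \<circ> word_perm w'"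
    if w: "set w \<subseteq> {a..<N}" for w
  proof -
    obtain w' k where *: "set w' \<subseteq> {Suc a..<N}" "a \<le> k" "k \<le> N"
        "\<And>x. fold g w x = fold g (w' @ [a..<k]) x"
      using g.normal_form[OF w Suc.prems(3) a] by blast
    have "fold f w x = fold f (w' @ [a..<k]) x \<and> word_perm w = word_perm (w' @ [a..<k])" for x
      using *(4)[of "(x, id)"] unfolding fold_g by simp
    with * show ?thesis by (auto simp: word_perm_append)
  qed
  obtain w' k where w': "set w' \<subseteq> {Suc a..<N}" "a \<le> k" "k \<le> N"
      "\<And>x. fold f w x = fold f [a..<k] (fold f w' x)" "word_perm w = word_perm [a..<k] \<circ> word_perm w'"
    using nf[OF Suc.prems(1)] by blast
  obtain v' l where v': "set v' \<subseteq> {Suc a..<N}" "a \<le> l" "l \<le> N"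
      "\<And>x. fold f v x = fold f [a..<l] (fold f v' x)" "word_perm v = word_perm [a..<l] \<circ> word_perm v'"
    using nf[OF Suc.prems(2)] by blast
  have "word_perm w a = k" "word_perm v a = l"
    using w' v' by (auto simp: word_perm_ascending word_perm_fixes)
  then have kl: "k = l" using Suc.prems(4) by simp
  have "inj (word_perm [a..<k])"
    using word_perm_permutes[of "[a..<k]" a k] permutes_inj by auto
  moreover have "word_perm [a..<k] \<circ> word_perm w' = word_perm [a..<k] \<circ> word_perm v'"
    using w'(5) v'(5) kl Suc.prems(4) by simp
  ultimately have "word_perm w' = word_perm v'"
    by (auto simp: fun_eq_iff inj_def)
  then have "fold f w' x = fold f v' x"
    using Suc.hyps(1)[of "Suc a" w' v'] Suc.hyps(2) w'(1) v'(1) by auto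
  then show ?case using w'(4) v'(4) kl by simp
qed

section \<open>Scalars\<close>

definition spectral_value :: "nat \<times> int \<Rightarrow> ratfun" where
  "spectral_value p = \<alpha> * of_nat (fst p) + of_int (snd p)"

abbreviation spec_diff :: "nat \<times> int \<Rightarrow> nat \<times> int \<Rightarrow> ratfun" where
  "spec_diff p q \<equiv> spectral_value p - spectral_value q"

lemma of_int_fract: "(of_int k :: 'a :: idom fract) = Fract (of_int k) 1"
  by (cases k) (simp_all add: of_nat_fract One_fract_def)

lemma linear_in_alpha_eq_0_iff: "\<alpha> * of_int a + of_int c = 0 \<longleftrightarrow> a = 0 \<and> c = 0"
proof -
  have of_int_poly: "(of_int k :: rat poly) = [:of_int k:]" for k
    by (rule Polynomial.of_int_poly)
  have "\<alpha> * of_int a + of_int c = Fract [:of_int c, of_int a:] 1"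
    by (simp add: \<alpha>_def of_int_fract of_int_poly)
  then show ?thesis by (auto simp: Zero_fract_def eq_fract)
qed

lemma spectral_value_diff:
  "spec_diff p q
    = \<alpha> * of_int (int (fst p) - int (fst q)) + of_int (snd p - snd q)"
  by (simp add: spectral_value_def algebra_simps)

text \<open>Transcendence of \<alpha>: a spectral difference is an integer only if the coefficient
  of \<alpha> cancels. The claims that denominators and factors are nonzero come down to
  this.\<close>

lemma spectral_value_diff_eq_iff:
  "spec_diff p q = of_int k \<longleftrightarrow> fst p = fst q \<and> snd p - snd q = k"
proof -
  have "spec_diff p q = of_int k
    \<longleftrightarrow> \<alpha> * of_int (int (fst p) - int (fst q)) + of_int (snd p - snd q - k) = 0"
    unfolding spectral_value_diff by (auto simp: algebra_simps)
  then show ?thesis unfolding linear_in_alpha_eq_0_iff by auto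
qed

lemma const_mult: "const (a * b) = const a * const b"
  by (simp add: const_def mult.commute)

lemma const_diff: "const (a - b) = const a - const b"
  by (simp add: const_def)

lemma const_1: "const 1 = 1"
  by (simp add: const_def One_fract_def one_pCons)

lemma const_of_int: "const (of_int k) = of_int k"
  by (simp add: const_def of_int_fract of_int_poly)

lemma const_inverse_of_int:
  assumes "k \<noteq> 0"
  shows "const (1 / of_int k) = 1 / of_int k"
proof -
  have "const (1 / of_int k) * of_int k = const (1 / of_int k * of_int k)"
    unfolding const_mult const_of_int ..
  also have "\<dots> = 1" using assms by (simp add: const_1)
  finally show ?thesis using assms by (simp add: eq_divide_eq)
qed

section \<open>Vectors and their coefficients\<close>

abbreviation "lookup \<equiv> Poly_Mapping.lookup"
abbreviation "keys \<equiv> Poly_Mapping.keys"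
abbreviation "single \<equiv> Poly_Mapping.single"

definition smul :: "ratfun \<Rightarrow> vec \<Rightarrow> vec" where
  "smul c t = Poly_Mapping.map ((*) c) t"

abbreviation basis_vec :: "tableau \<Rightarrow> vec" where
  "basis_vec \<tau> \<equiv> single \<tau> 1"

lemma lookup_smul [simp]: "lookup (smul c t) \<tau> = c * lookup t \<tau>"
  by (simp add: smul_def Poly_Mapping.map.rep_eq when_def)

lemma lookup_pmult [simp]: "lookup (pmult f P) \<tau> = f * lookup P \<tau>"
  by (simp add: pmult_def Poly_Mapping.map.rep_eq when_def)

lemma lookup_scale [simp]: "lookup (scale c P) \<tau> = Cst c * lookup P \<tau>"
  by (simp add: scale_def)

lemma Cst_add: "Cst (a + b) = Cst a + Cst b"
  by (simp add: Cst_def single_add)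

lemma Cst_mult: "Cst (a * b) = Cst a * Cst b"
  by (simp add: Cst_def mult_single)

lemma Cst_1: "Cst 1 = 1"
  by (simp add: Cst_def)

lemma lookup_Cst_mult: "lookup (Cst c * f) u = c * lookup f u"
  by (simp add: Cst_def mult_map_scale_conv_mult[symmetric] Poly_Mapping.map.rep_eq when_def)

lemma lookup_mult_Cst: "lookup (f * Cst c) u = lookup f u * c"
  by (metis lookup_Cst_mult mult.commute)

interpretation vec: module smul
  by standard (auto intro!: poly_mapping_eqI simp: lookup_add algebra_simps)

interpretation vpoly: module scale
  by standard (auto intro!: poly_mapping_eqI simp: lookup_add algebra_simps Cst_add Cst_mult Cst_1)

abbreviation vec_linear :: "(vec \<Rightarrow> vec) \<Rightarrow> bool" where
  "vec_linear \<equiv> module_hom smul smul"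

lemma vec_linearI:
  "(\<And>s t. B (s + t) = B s + B t) \<Longrightarrow> (\<And>c t. B (smul c t) = smul c (B t)) \<Longrightarrow> vec_linear B"
  by unfold_locales auto

lemma vec_expand:
  "t = (\<Sum>\<tau>\<in>keys t. smul (lookup t \<tau>) (basis_vec \<tau>))"
  by (rule poly_mapping_eqI)
     (auto simp: lookup_sum lookup_single when_def in_keys_iff if_distrib cong: if_cong)

lemma vec_linear_expand:
  assumes "vec_linear B"
  shows "B t = (\<Sum>\<tau>\<in>keys t. smul (lookup t \<tau>) (B (basis_vec \<tau>)))"
proof -
  have "B t = B (\<Sum>\<tau>\<in>keys t. smul (lookup t \<tau>) (basis_vec \<tau>))"
    by (rule arg_cong) (rule vec_expand)
  then show ?thesis by (simp only: module_hom.sum[OF assms] module_hom.scale[OF assms])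
qed

lemma vec_linear_cong:
  assumes "vec_linear B" "vec_linear B'"
    and "\<And>\<tau>. \<tau> \<in> keys t \<Longrightarrow> B (basis_vec \<tau>) = B' (basis_vec \<tau>)"
  shows "B t = B' t"
  unfolding vec_linear_expand[OF assms(1), of t] vec_linear_expand[OF assms(2), of t]
  using assms(3) by (intro sum.cong) auto

lemma vec_linear_compose: "vec_linear A \<Longrightarrow> vec_linear B \<Longrightarrow> vec_linear (\<lambda>t. A (B t))"
  by (rule vec_linearI) (simp_all add: module_hom.add module_hom.scale)

lemma vec_linear_vec_s: "vec_linear (vec_s lam i)"
proof -
  \<comment> \<open>The index set in \<open>vec_s\<close> varies with t; a common finite set K
    containing the keys makes linearity visible.\<close>
  have *: "vec_s lam i t
      = (\<Sum>\<tau>\<in>K. smul (lookup t \<tau>) (tableau_s lam i \<tau>))"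
    if "finite K" "keys t \<subseteq> K" for K t
    unfolding vec_s_def smul_def[symmetric] using that
    by (intro sum.mono_neutral_left) (auto simp: in_keys_iff)
  show ?thesis
  proof (rule vec_linearI)
    fix s t :: vec
    let ?K = "keys s \<union> keys t"
    have "keys (s + t) \<subseteq> ?K" by (rule keys_add)
    then show "vec_s lam i (s + t) = vec_s lam i s + vec_s lam i t"
      by (simp add: *[of ?K] lookup_add vec.scale_left_distrib sum.distrib)
  next
    fix c and t :: vec
    have "keys (smul c t) \<subseteq> keys t"
      by (auto simp: in_keys_iff)
    then show "vec_s lam i (smul c t) = smul c (vec_s lam i t)"
      by (simp add: *[of "keys t"] vec.scale_sum_right)
  qed
qed

lemma vec_s_basis_vec: "vec_s lam i (basis_vec \<tau>) = tableau_s lam i \<tau>"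
  by (simp add: vec_s_def smul_def[symmetric])

lemma vec_linear_fold_vec_s: "vec_linear (fold (vec_s lam) w)"
proof (induction w)
  case Nil
  then show ?case by (auto intro!: vec_linearI)
next
  case (Cons i w)
  then show ?case using vec_linear_compose[OF _ vec_linear_vec_s] by (simp add: o_def)
qed

text \<open>Identities between operators on \<open>vpoly\<close> are checked on the coefficients of the monomials, where
  they become identities between operators on \<open>vec\<close>.\<close>

definition cf :: "(nat \<Rightarrow>\<^sub>0 nat) \<Rightarrow> vpoly \<Rightarrow> vec" where
  "cf u P = Poly_Mapping.map (\<lambda>f. lookup f u) P"

lemma lookup_cf [simp]:
  "lookup (cf u P) \<tau> = lookup (lookup P \<tau>) u"
  by (simp add: cf_def Poly_Mapping.map.rep_eq when_def)

lemma vpoly_eqI: "(\<And>u. cf u P = cf u Q) \<Longrightarrow> P = Q"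
  by (metis lookup_cf poly_mapping_eqI)

lemma cf_add: "cf u (P + Q) = cf u P + cf u Q"
  by (rule poly_mapping_eqI) (simp add: lookup_add)

lemma cf_0: "cf u 0 = 0"
  by (rule poly_mapping_eqI) simp

lemma cf_sum: "cf u (sum f A) = (\<Sum>x\<in>A. cf u (f x))"
  by (induction A rule: infinite_finite_induct) (auto simp: cf_add cf_0)

lemma cf_scale: "cf u (scale c P) = smul c (cf u P)"
  by (rule poly_mapping_eqI) (simp add: lookup_Cst_mult)

lemma lookup_tensor: "lookup (tensor f t) \<tau> = f * Cst (lookup t \<tau>)"
  by (auto simp: tensor_def lookup_sum lookup_single when_def in_keys_iff if_distrib Cst_def cong: if_cong)

lemma cf_tensor: "cf u (tensor f t) = smul (lookup f u) t"
  by (rule poly_mapping_eqI) (simp add: lookup_tensor lookup_mult_Cst)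

text \<open>A merely relocates coefficients, the one at u coming from u', so on the level of
  coefficients only B is left.\<close>

lemma cf_tensor_op:
  assumes "\<And>f. lookup (A f) u = lookup f u'" "vec_linear B"
  shows "cf u (tensor_op A B P) = B (cf u' P)"
proof -
  have "cf u (tensor_op A B P)
      = (\<Sum>\<tau>\<in>keys P. smul (lookup (cf u' P) \<tau>) (B (basis_vec \<tau>)))"
    by (simp add: tensor_op_def cf_sum cf_tensor assms(1))
  also have "\<dots> = (\<Sum>\<tau>\<in>keys (cf u' P). smul (lookup (cf u' P) \<tau>) (B (basis_vec \<tau>)))"
    by (rule sum.mono_neutral_right) (auto simp: in_keys_iff)
  also have "\<dots> = B (cf u' P)"
    by (rule vec_linear_expand[OF assms(2), symmetric])
  finally show ?thesis .
qed

definition exp_s :: "nat \<Rightarrow> (nat \<Rightarrow>\<^sub>0 nat) \<Rightarrow> (nat \<Rightarrow>\<^sub>0 nat)" where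
  "exp_s i = Poly_Mapping.map_key (transpose i (Suc i))"

lemma lookup_exp_s [simp]:
  "lookup (exp_s i u) j = lookup u (transpose i (Suc i) j)"
  by (simp add: exp_s_def map_key.rep_eq)

lemma exp_s_exp_s [simp]: "exp_s i (exp_s i u) = u"
  by (rule poly_mapping_eqI) simp

lemma lookup_poly_s: "lookup (poly_s i f) u = lookup f (exp_s i u)"
proof -
  have "inj (exp_s i)" by (rule inj_on_inverseI[of _ "exp_s i"]) simp
  then show ?thesis by (simp add: poly_s_def exp_s_def[symmetric] map_key.rep_eq)
qed

text \<open>A substitution of variables becomes a pullback on exponents, which reverses the order of
  the letters; each letter is an involution, so no inverses appear.\<close>

lemma lookup_fold_poly_s:
  "lookup (fold poly_s w f) u = lookup f (fold exp_s (rev w) u)"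
  by (induction w arbitrary: f) (simp_all add: lookup_poly_s)

lemma cf_diag_op:
  "cf u (diag_op lam w P) = fold (vec_s lam) w (cf (fold exp_s (rev w) u) P)"
  unfolding diag_op_def by (intro cf_tensor_op lookup_fold_poly_s vec_linear_fold_vec_s)

definition act :: "nat list \<Rightarrow> nat \<Rightarrow> vpoly \<Rightarrow> vpoly" where
  "act lam i = diag_op lam [i]"

lemma cf_act: "cf u (act lam i P) = vec_s lam i (cf (exp_s i u) P)"
  by (simp add: act_def cf_diag_op)

text \<open>\<open>diag_op\<close> runs the whole word through each tensor factor before tensoring.
  Comparing coefficients shows that the letters may instead act one after another on the
  tensor.\<close>

lemma diag_op_eq_fold_act: "diag_op lam w P = fold (act lam) w P"
proof (rule vpoly_eqI)
  fix u
  have "cf u (fold (act lam) w P) = fold (vec_s lam) w (cf (fold exp_s (rev w) u) P)"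
    by (induction w arbitrary: P) (simp_all add: cf_act)
  then show "cf u (diag_op lam w P) = cf u (fold (act lam) w P)"
    by (simp add: cf_diag_op)
qed

lemma act_add: "act lam i (P + Q) = act lam i P + act lam i Q"
  by (rule vpoly_eqI) (simp add: cf_act cf_add module_hom.add[OF vec_linear_vec_s])

lemma act_scale: "act lam i (scale c P) = scale c (act lam i P)"
  by (rule vpoly_eqI) (simp add: cf_act cf_scale module_hom.scale[OF vec_linear_vec_s])

interpretation act: module_hom scale scale "act lam i" for lam i
  by unfold_locales (rule act_add act_scale)+

text \<open>Subtraction of exponents is truncated, so exponent 0 in position j is split off. The
  product is a convolution; it is computed on single terms and extended additively.\<close>

lemma cf_X_mult:
  "cf u (pmult (X j) P)
    = (if lookup u j = 0 then 0 else cf (u - single j 1) P)"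
proof -
  have single: "lookup (X j * single m c) u
      = (if lookup u j = 0 then 0
         else lookup (single m c) (u - single j 1))" for m c
  proof (cases "lookup u j = 0")
    case True
    then have "single j 1 + m \<noteq> u"
      by (auto simp: lookup_add)
    then show ?thesis using True by (simp add: X_def mult_single lookup_single)
  next
    case False
    then have "single j 1 + m = u \<longleftrightarrow> m = u - single j 1"
      by (auto simp: poly_mapping_eq_iff lookup_add lookup_minus lookup_single when_def fun_eq_iff)
    then show ?thesis using False by (simp add: X_def mult_single lookup_single)
  qed
  have "lookup (X j * f) u
      = (if lookup u j = 0 then 0 else lookup f (u - single j 1))" for f
  proof (induction f rule: Poly_Mapping.update_induct)
    case (update f a b)
    have "Poly_Mapping.update a b f = single a b + f"
      using update(1) by (intro poly_mapping_eqI)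
        (auto simp: lookup_update lookup_add lookup_single when_def in_keys_iff)
    then show ?case using update(3) single[of a b] by (simp add: algebra_simps lookup_add)
  qed simp
  then show ?thesis by (intro poly_mapping_eqI) auto
qed

lemma act_X_mult: "act lam i (pmult (X j) P) = pmult (X (transpose i (Suc i) j)) (act lam i P)"
proof (rule vpoly_eqI)
  fix u
  have "exp_s i u - single j 1 = exp_s i (u - single (transpose i (Suc i) j) 1)"
    by (intro poly_mapping_eqI) (auto simp: lookup_minus lookup_single when_def transpose_def)
  then show "cf u (act lam i (pmult (X j) P)) = cf u (pmult (X (transpose i (Suc i) j)) (act lam i P))"
    by (simp add: cf_act cf_X_mult module_hom.zero[OF vec_linear_vec_s])
qed

section \<open>Reverse standard tableaux\<close>

lemma count_below_less:
  assumes "finite A" "transp lt" "irreflp lt" "x \<in> A" "lt x y"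
  shows "card {z \<in> A. lt z x} < card {z \<in> A. lt z y}"
proof (rule psubset_card_mono)
  have "{z \<in> A. lt z x} \<subseteq> {z \<in> A. lt z y}"
    using assms(2,5) by (auto dest: transpD)
  moreover have "x \<in> {z \<in> A. lt z y} - {z \<in> A. lt z x}"
    using assms(3-5) by (auto dest: irreflpD)
  ultimately show "{z \<in> A. lt z x} \<subset> {z \<in> A. lt z y}" by blast
qed (simp add: assms(1))

text \<open>In a strict total order the number of predecessors is the position. This count yields
  the labels of the root tableau and of \<open>std\<close> as well as the ranks of the positions of
  a vector.\<close>

lemma count_below_bij:
  assumes "finite A" "transp lt" "irreflp lt"
    and "\<And>x y. x \<in> A \<Longrightarrow> y \<in> A \<Longrightarrow> x \<noteq> y \<Longrightarrow> lt x y \<or> lt y x"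
  shows "bij_betw (\<lambda>x. card {z \<in> A. lt z x}) A {0..<card A}"
proof -
  let ?g = "\<lambda>x. card {z \<in> A. lt z x}"
  have "inj_on ?g A"
  proof (rule inj_onI, rule ccontr)
    fix x y assume *: "x \<in> A" "y \<in> A" "?g x = ?g y" "x \<noteq> y"
    then show False
      using assms(4)[of x y] count_below_less[OF assms(1-3), of x y]
        count_below_less[OF assms(1-3), of y x] by auto
  qed
  moreover have "?g x < card A" if "x \<in> A" for x
    using assms(1) irreflpD[OF assms(3), of x] that by (intro psubset_card_mono) auto
  ultimately have "?g ` A = {0..<card A}"
    by (intro card_subset_eq) (auto simp: card_image)
  with \<open>inj_on ?g A\<close> show ?thesis by (simp add: bij_betw_def)
qed

lemma decreasing_labelling_eq:
  assumes "bij_betw \<tau> A {1..N}" "\<And>x y. x \<in> A \<Longrightarrow> y \<in> A \<Longrightarrow> lt y x \<longleftrightarrow> \<tau> x < \<tau> y" "x \<in> A"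
  shows "\<tau> x = N - card {y \<in> A. lt y x}"
proof -
  have surj: "\<tau> ` A = {1..N}" using assms(1) by (simp add: bij_betw_def)
  have "\<tau> ` {y \<in> A. lt y x} = {k \<in> \<tau> ` A. \<tau> x < k}"
    using assms(2,3) by auto
  also have "\<dots> = {\<tau> x<..N}" unfolding surj by auto
  finally have "\<tau> ` {y \<in> A. lt y x} = {\<tau> x<..N}" .
  moreover have "inj_on \<tau> {y \<in> A. lt y x}"
    using bij_betw_imp_inj_on[OF assms(1)] by (rule inj_on_subset) auto
  ultimately have "card {y \<in> A. lt y x} = N - \<tau> x"
    by (metis card_image card_greaterThanAtMost)
  moreover have "\<tau> x \<le> N" using assms by (auto simp: bij_betw_def)
  ultimately show ?thesis by simp
qed

locale shape =
  fixes lam :: "nat list"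
  assumes lam_sorted: "sorted_wrt (\<ge>) lam" and N_pos: "0 < sum_list lam"
begin

abbreviation N :: nat where "N \<equiv> sum_list lam"
abbreviation D :: "cell set" where "D \<equiv> diagram lam"

lemma diagram_eq: "D = Sigma {1..length lam} (\<lambda>r. {1..lam ! (r - 1)})"
  by (auto simp: diagram_def)

lemma finite_diagram: "finite D"
  by (simp add: diagram_eq)

lemma card_diagram: "card D = N"
proof -
  have "card D = (\<Sum>r=1..length lam. lam ! (r - 1))"
    unfolding diagram_eq by (subst card_SigmaI) auto
  also have "\<dots> = (\<Sum>i<length lam. lam ! i)"
    by (rule sum.reindex_bij_witness[of _ Suc "\<lambda>r. r - 1"]) auto
  finally show ?thesis by (simp add: sum_list_sum_nth atLeast0LessThan)
qed

lemma diagram_down: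
  assumes "(r', c') \<in> D" "1 \<le> r" "r \<le> r'" "1 \<le> c" "c \<le> c'"
  shows "(r, c) \<in> D"
proof -
  have "lam ! (r' - 1) \<le> lam ! (r - 1)"
  proof (cases "r = r'")
    case False
    then show ?thesis
      using assms sorted_wrt_nth_less[OF lam_sorted, of "r - 1" "r' - 1"] by (auto simp: diagram_def)
  qed simp
  then show ?thesis using assms by (auto simp: diagram_def)
qed

lemma diagram_pos: "(r, c) \<in> D \<Longrightarrow> 1 \<le> r \<and> 1 \<le> c"
  by (auto simp: diagram_def)

text \<open>Only the bijection is kept: interchanging labels may destroy monotonicity, while
  contents and their behaviour under interchange make sense for every bijective filling.\<close>

definition labelling :: "tableau \<Rightarrow> bool" where
  "labelling \<tau> \<longleftrightarrow> bij_betw \<tau> D {1..N}"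

lemma RST_labelling: "RST lam \<tau> \<Longrightarrow> labelling \<tau>"
  by (simp add: RST_def labelling_def)

lemma RST_outside: "RST lam \<tau> \<Longrightarrow> x \<notin> D \<Longrightarrow> \<tau> x = 0"
  by (cases x) (simp add: RST_def)

lemma labelling_cell:
  assumes "labelling \<tau>" "1 \<le> k" "k \<le> N"
  obtains r c where "(r, c) \<in> D" "\<tau> (r, c) = k"
  using assms unfolding labelling_def bij_betw_def by (metis atLeastAtMost_iff imageE surj_pair)

lemma labelling_range: "labelling \<tau> \<Longrightarrow> x \<in> D \<Longrightarrow> 1 \<le> \<tau> x \<and> \<tau> x \<le> N"
  unfolding labelling_def bij_betw_def by auto

lemma labelling_inj: "labelling \<tau> \<Longrightarrow> x \<in> D \<Longrightarrow> y \<in> D \<Longrightarrow> \<tau> x = \<tau> y \<Longrightarrow> x = y"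
  unfolding labelling_def bij_betw_def by (auto dest: inj_onD)

lemma CT_label: "labelling \<tau> \<Longrightarrow> (r, c) \<in> D \<Longrightarrow> CT lam \<tau> (\<tau> (r, c)) = int c - int r"
  by (simp add: CT_def labelling_def bij_betw_def)

lemma labelling_interchange:
  assumes "labelling \<tau>" "1 \<le> i" "i < N"
  shows "labelling (interchange i \<tau>)"
  unfolding interchange_def labelling_def
  by (rule bij_betw_trans[OF assms(1)[unfolded labelling_def]])
     (use assms in \<open>auto intro!: permutes_imp_bij permutes_swap_id\<close>)

lemma CT_interchange:
  assumes "labelling \<tau>" "1 \<le> i" "i < N" "1 \<le> k" "k \<le> N"
  shows "CT lam (interchange i \<tau>) k = CT lam \<tau> (transpose i (Suc i) k)"
proof -
  let ?s = "transpose i (Suc i)"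
  have "1 \<le> ?s k" "?s k \<le> N" using assms by (auto simp: transpose_def)
  then obtain r c where rc: "(r, c) \<in> D" "\<tau> (r, c) = ?s k"
    using labelling_cell[OF assms(1)] by blast
  then have "interchange i \<tau> (r, c) = k" by (simp add: interchange_def)
  then show ?thesis
    using CT_label[OF labelling_interchange[OF assms(1-3)] rc(1)] CT_label[OF assms(1) rc(1)] rc(2)
    by simp
qed

lemma interchange_interchange [simp]: "interchange i (interchange i \<tau>) = \<tau>"
  by (simp add: interchange_def flip: comp_assoc)

lemma RST_less:
  assumes "RST lam \<tau>" "(r, c) \<in> D" "(r', c') \<in> D" "r \<le> r'" "c \<le> c'" "(r, c) \<noteq> (r', c')"
  shows "\<tau> (r', c') < \<tau> (r, c)"
proof -
  have row: "\<tau> (a, b) > \<tau> (a, b')" if "(a, b) \<in> D" "(a, b') \<in> D" "b < b'" for a b b'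
    using assms(1) that unfolding RST_def by blast
  have col: "\<tau> (a, b) > \<tau> (a', b)" if "(a, b) \<in> D" "(a', b) \<in> D" "a < a'" for a a' b
    using assms(1) that unfolding RST_def by blast
  have "(r, c') \<in> D"
    using diagram_down[OF assms(3)] assms diagram_pos by blast
  then show ?thesis
    using row[of r c c'] col[of r c' r'] assms by (cases "c = c'"; cases "r = r'") auto
qed

text \<open>The cells right of and above the lower of two cells on a diagonal carry two distinct
  labels strictly in between; hence the gap 3. Consequently the contents of three consecutive labels
  are pairwise distinct, as the braid relation requires.\<close>

lemma RST_same_content:
  assumes "RST lam \<tau>" "1 \<le> i" "i < j" "j \<le> N" "CT lam \<tau> i = CT lam \<tau> j"
  shows "i + 3 \<le> j"
proof -
  note l = RST_labelling[OF assms(1)]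
  obtain r c where x: "(r, c) \<in> D" "\<tau> (r, c) = j"
    using labelling_cell[OF l, of j] assms by auto
  obtain r' c' where y: "(r', c') \<in> D" "\<tau> (r', c') = i"
    using labelling_cell[OF l, of i] assms by auto
  have d: "int c - int r = int c' - int r'"
    using CT_label[OF l x(1)] CT_label[OF l y(1)] x y assms(5) by simp
  have "(r, c) \<noteq> (r', c')" using x y assms(3) by auto
  then have "r < r'" using RST_less[OF assms(1) y(1) x(1)] d x y assms(3) by (cases "r' \<le> r") auto
  then have le: "r < r'" "c < c'" using d by auto
  have z: "(r, Suc c) \<in> D" "(Suc r, c) \<in> D"
    using diagram_down[OF y(1), of r "Suc c"] diagram_down[OF y(1), of "Suc r" c] le diagram_pos[OF x(1)]
    by auto
  have "\<tau> (r, Suc c) < j" "i < \<tau> (r, Suc c)" "\<tau> (Suc r, c) < j" "i < \<tau> (Suc r, c)"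
    using RST_less[OF assms(1) x(1) z(1)] RST_less[OF assms(1) z(1) y(1)]
      RST_less[OF assms(1) x(1) z(2)] RST_less[OF assms(1) z(2) y(1)] le x y by auto
  moreover have "\<tau> (r, Suc c) \<noteq> \<tau> (Suc r, c)" using labelling_inj[OF l z] by auto
  ultimately show ?thesis by linarith
qed

lemma RST_consecutive_content:
  "RST lam \<tau> \<Longrightarrow> 1 \<le> i \<Longrightarrow> i < N \<Longrightarrow> CT lam \<tau> i \<noteq> CT lam \<tau> (Suc i)"
  using RST_same_content[of \<tau> i "Suc i"] by auto

lemma RST_consecutive_content2:
  "RST lam \<tau> \<Longrightarrow> 1 \<le> i \<Longrightarrow> Suc i < N \<Longrightarrow> CT lam \<tau> i \<noteq> CT lam \<tau> (Suc (Suc i))"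
  using RST_same_content[of \<tau> i "Suc (Suc i)"] by auto

text \<open>Otherwise a cell strictly between the two would carry a label strictly between i and
  i+1.\<close>

lemma RST_consecutive_adjacent:
  assumes "RST lam \<tau>" "(r, c) \<in> D" "(r', c') \<in> D" "r \<le> r'" "c \<le> c'"
    "\<tau> (r, c) = Suc i" "\<tau> (r', c') = i"
  shows "r' + c' = Suc (r + c)"
proof (rule ccontr)
  assume ne: "r' + c' \<noteq> Suc (r + c)"
  have "(r, c) \<noteq> (r', c')" using assms(6,7) by auto
  then have s: "Suc (r + c) < r' + c'" using ne assms(4,5) by auto
  define z where "z = (if c < c' then (r, Suc c) else (Suc r, c))"
  have z: "z \<in> D"
    using diagram_down[OF assms(3)] diagram_pos[OF assms(2)] assms(4,5) s by (auto simp: z_def)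
  have "\<tau> z < Suc i" "i < \<tau> z"
    using RST_less[OF assms(1,2), of "fst z" "snd z"] RST_less[OF assms(1) _ assms(3), of "fst z" "snd z"]
      z assms(4-7) s by (auto simp: z_def split: if_splits)
  then show False by simp
qed

text \<open>Cells on neighbouring diagonals are always comparable, so consecutive labels there sit
  on adjacent cells; the sign of the difference selects a row.\<close>

lemma RST_content_diff_one:
  assumes "RST lam \<tau>" "1 \<le> i" "i < N" "CT lam \<tau> i - CT lam \<tau> (Suc i) = 1"
  obtains r c where "(r, c) \<in> D" "(r, Suc c) \<in> D" "\<tau> (r, c) = Suc i" "\<tau> (r, Suc c) = i"
proof -
  note l = RST_labelling[OF assms(1)]
  obtain r c where x: "(r, c) \<in> D" "\<tau> (r, c) = Suc i"
    using labelling_cell[OF l, of "Suc i"] assms by auto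
  obtain r' c' where y: "(r', c') \<in> D" "\<tau> (r', c') = i"
    using labelling_cell[OF l, of i] assms by auto
  have d: "int c' - int r' = int c - int r + 1"
    using CT_label[OF l x(1)] CT_label[OF l y(1)] x y assms(4) by simp
  have "\<not> r' < r"
  proof
    assume "r' < r"
    then have "\<tau> (r, c) < \<tau> (r', c')"
      using d by (intro RST_less[OF assms(1) y(1) x(1)]) auto
    then show False using x y by simp
  qed
  then have "r \<le> r'" "c \<le> c'" using d by auto
  then have "r' + c' = Suc (r + c)"
    using RST_consecutive_adjacent[OF assms(1) x(1) y(1)] x y by blast
  then have "r' = r" "c' = Suc c" using d \<open>r \<le> r'\<close> by auto
  then show thesis using that x y by blast
qed

text \<open>Only the comparison of the cells of i and i+1 is reversed. It matters only if they share
  a row or column; then they are adjacent and their contents differ by 1.\<close>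

lemma RST_interchange:
  assumes "RST lam \<tau>" "1 \<le> i" "i < N" "\<bar>CT lam \<tau> i - CT lam \<tau> (Suc i)\<bar> \<ge> 2"
  shows "RST lam (interchange i \<tau>)"
proof -
  note l = RST_labelling[OF assms(1)]
  let ?s = "transpose i (Suc i)"
  have "?s (\<tau> (r', c')) < ?s (\<tau> (r, c))"
    if xy: "(r, c) \<in> D" "(r', c') \<in> D" "r \<le> r'" "c \<le> c'" "(r, c) \<noteq> (r', c')" "r = r' \<or> c = c'" for r c r' c'
  proof -
    have "\<not> (\<tau> (r, c) = Suc i \<and> \<tau> (r', c') = i)"
    proof
      assume e: "\<tau> (r, c) = Suc i \<and> \<tau> (r', c') = i"
      then have "r' + c' = Suc (r + c)" using RST_consecutive_adjacent[OF assms(1) xy(1-4)] by blast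
      then show False
        using CT_label[OF l xy(1)] CT_label[OF l xy(2)] e assms(4) xy(6) by auto
    qed
    then show ?thesis using RST_less[OF assms(1) xy(1-5)] by (auto simp: transpose_def)
  qed
  moreover have "interchange i \<tau> x = 0" if "x \<notin> D" for x
    using assms(1,2) that by (simp add: RST_outside interchange_def transpose_def)
  ultimately show ?thesis
    using labelling_interchange[OF l assms(2,3)]
    unfolding RST_def labelling_def by (auto simp: interchange_def)
qed

text \<open>Labels are placed from N downwards. The cells of k lie on one diagonal; if they
  differed, the lower one would carry a larger label in the other tableau, but the larger labels
  already agree.\<close>

lemma RST_eq_if_content_eq:
  assumes "RST lam \<tau>" "RST lam \<tau>'" "\<And>k. 1 \<le> k \<Longrightarrow> k \<le> N \<Longrightarrow> CT lam \<tau> k = CT lam \<tau>' k"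
  shows "\<tau> = \<tau>'"
proof -
  note l = RST_labelling[OF assms(1)] and l' = RST_labelling[OF assms(2)]
  have *: "\<forall>x\<in>D. \<tau> x = k \<longleftrightarrow> \<tau>' x = k" if "1 \<le> k" "k \<le> N" for k
    using that
  proof (induction "N - k" arbitrary: k rule: less_induct)
    case less
    have IH: "\<tau> x = j \<longleftrightarrow> \<tau>' x = j" if "x \<in> D" "k < j" "j \<le> N" for x j
      using less(1)[of j] less(2,3) that by auto
    obtain r c where x: "(r, c) \<in> D" "\<tau> (r, c) = k"
      using labelling_cell[OF l less(2,3)] by blast
    obtain r' c' where x': "(r', c') \<in> D" "\<tau>' (r', c') = k"
      using labelling_cell[OF l' less(2,3)] by blast
    have d: "int c - int r = int c' - int r'"
      using CT_label[OF l x(1)] CT_label[OF l' x'(1)] x x' assms(3)[OF less(2,3)] by simp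
    have "(r, c) = (r', c')"
    proof (rule ccontr)
      assume ne: "(r, c) \<noteq> (r', c')"
      show False
      proof (cases "r \<le> r'")
        case True
        then have "k < \<tau>' (r, c)"
          using RST_less[OF assms(2) x(1) x'(1)] d ne x'(2) by auto
        then show False
          using IH[OF x(1), of "\<tau>' (r, c)"] labelling_range[OF l' x(1)] x(2) by simp
      next
        case False
        then have "k < \<tau> (r', c')"
          using RST_less[OF assms(1) x'(1) x(1)] d ne x(2) by auto
        then show False
          using IH[OF x'(1), of "\<tau> (r', c')"] labelling_range[OF l x'(1)] x'(2) by simp
      qed
    qed
    then show ?case
      using x x' labelling_inj[OF l] labelling_inj[OF l'] by metis
  qed
  show ?thesis
  proof
    fix x
    show "\<tau> x = \<tau>' x"
    proof (cases "x \<in> D")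
      case True
      then show ?thesis using *[of "\<tau> x"] labelling_range[OF l True] by auto
    next
      case False
      then show ?thesis using assms(1,2) by (simp add: RST_outside)
    qed
  qed
qed

lemma finite_RST: "finite {\<tau>. RST lam \<tau>}"
proof (rule finite_subset)
  show "{\<tau>. RST lam \<tau>} \<subseteq> {\<tau>. (\<forall>x\<in>D. \<tau> x \<in> {1..N}) \<and> (\<forall>x. x \<notin> D \<longrightarrow> \<tau> x = 0)}"
    using labelling_range[OF RST_labelling] by (auto simp: RST_outside)
  show "finite {\<tau>. (\<forall>x\<in>D. \<tau> x \<in> {1..N}) \<and> (\<forall>x. x \<notin> D \<longrightarrow> \<tau> x = 0)}"
    using finite_set_of_finite_funs[OF finite_diagram, of "{1..N}" 0]
    by (rule rev_finite_subset) auto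
qed

text \<open>The root tableau and \<open>std\<close> are both of this form, for the column order and
  for the reading order by entries of T.\<close>

lemma RST_count_below:
  assumes "transp lt" "irreflp lt"
    and "\<And>x y. x \<in> D \<Longrightarrow> y \<in> D \<Longrightarrow> x \<noteq> y \<Longrightarrow> lt x y \<or> lt y x"
    and "\<And>r c r' c'. (r, c) \<in> D \<Longrightarrow> (r', c') \<in> D \<Longrightarrow> r \<le> r' \<Longrightarrow> c \<le> c' \<Longrightarrow> (r, c) \<noteq> (r', c')
      \<Longrightarrow> lt (r, c) (r', c')"
  shows "RST lam (\<lambda>x. if x \<in> D then N - card {y \<in> D. lt y x} else 0)"
proof -
  let ?\<tau> = "\<lambda>x. if x \<in> D then N - card {y \<in> D. lt y x} else 0"
  have bij: "bij_betw (\<lambda>x. card {y \<in> D. lt y x}) D {0..<N}"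
    using count_below_bij[OF finite_diagram assms(1-3)] card_diagram by simp
  have "bij_betw (\<lambda>k. N - k) {0..<N} {1..N}"
    by (rule bij_betwI[of _ _ _ "\<lambda>k. N - k"]) auto
  from bij_betw_trans[OF bij this] have "labelling ?\<tau>" unfolding labelling_def
    by (rule bij_betw_cong[THEN iffD1, rotated]) simp
  moreover have "?\<tau> y < ?\<tau> x" if "x \<in> D" "y \<in> D" "lt x y" for x y
  proof -
    have "card {z \<in> D. lt z x} < card {z \<in> D. lt z y}"
      using count_below_less[OF finite_diagram assms(1,2)] that by blast
    moreover have "card {z \<in> D. lt z y} < N"
      using bij_betwE[OF bij] that by auto
    ultimately show ?thesis using that by simp
  qed
  ultimately show ?thesis unfolding RST_def labelling_def using assms(4) by auto
qed

section \<open>The root tableau\<close>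

definition col_less :: "cell \<Rightarrow> cell \<Rightarrow> bool" where
  "col_less x y \<longleftrightarrow> snd x < snd y \<or> snd x = snd y \<and> fst x < fst y"

lemma col_less_transp: "transp col_less"
  by (auto simp: col_less_def intro!: transpI)

lemma col_less_irreflp: "irreflp col_less"
  by (auto simp: col_less_def intro!: irreflpI)

lemma root_tableau_eq:
  "root_tableau lam = (\<lambda>x. if x \<in> D then N - card {y \<in> D. col_less y x} else 0)"
proof
  fix x :: cell
  obtain r c where x: "x = (r, c)" by (cases x)
  have "{(r', c'). (r', c') \<in> D \<and> (c' < c \<or> c' = c \<and> r' < r)} = {y \<in> D. col_less y x}"
    by (auto simp: col_less_def x)
  then show "root_tableau lam x = (if x \<in> D then N - card {y \<in> D. col_less y x} else 0)"
    by (simp add: root_tableau_def x)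
qed

lemma RST_root_tableau: "RST lam (root_tableau lam)"
  unfolding root_tableau_eq
  by (rule RST_count_below[OF col_less_transp col_less_irreflp]) (auto simp: col_less_def)

text \<open>The column weakly decreases as the label grows: a step to a later column would go to a
  strictly lower row and make the content difference at most -2. Hence the labels follow the column
  order. In the graph this leaves the root as the only vertex with v = 0 that no s_i edge
  enters.\<close>

lemma RST_no_descent_eq_root:
  assumes "RST lam \<tau>" "\<And>i. 1 \<le> i \<Longrightarrow> i < N \<Longrightarrow> \<not> CT lam \<tau> i - CT lam \<tau> (Suc i) \<le> - 2"
  shows "\<tau> = root_tableau lam"
proof -
  note l = RST_labelling[OF assms(1)]
  have step: "c' \<le> c" if xy: "(r, c) \<in> D" "(r', c') \<in> D" and e: "Suc (\<tau> (r, c)) = \<tau> (r', c')"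
    for r c r' c'
  proof (rule ccontr)
    assume "\<not> c' \<le> c"
    then have c: "c < c'" by simp
    have "r' < r" using RST_less[OF assms(1) xy] e c by (cases "r \<le> r'") auto
    moreover have "\<not> (int c - int r) - (int c' - int r') \<le> - 2"
      using assms(2)[of "\<tau> (r, c)"] CT_label[OF l xy(1)] CT_label[OF l xy(2)] e
        labelling_range[OF l xy(1)] labelling_range[OF l xy(2)] by auto
    ultimately show False using c by linarith
  qed
  have mono: "snd y \<le> snd x" if "x \<in> D" "y \<in> D" "\<tau> y = k" "\<tau> x \<le> k" for x y k
    using that(4,2,3)
  proof (induction k arbitrary: y rule: dec_induct)
    case base
    then show ?case using labelling_inj[OF l that(1), of y] by simp
  next
    case (step k)
    have "1 \<le> k" "k \<le> N" using step.prems step.hyps labelling_range[OF l] that(1)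
      by (metis Suc_leD le_trans, metis Suc_leD)
    then obtain r c where z: "(r, c) \<in> D" "\<tau> (r, c) = k" using labelling_cell[OF l] by blast
    then show ?case using step.IH[OF z] \<open>\<And>r c r' c'. _ \<Longrightarrow> _ \<Longrightarrow> Suc (\<tau> (r, c)) = \<tau> (r', c') \<Longrightarrow> c' \<le> c\<close>[of r c "fst y" "snd y"]
        step.prems by auto
  qed
  have lt: "col_less y x" if "x \<in> D" "y \<in> D" "\<tau> x < \<tau> y" for x y
  proof -
    have "snd y \<le> snd x" using mono[OF that(1,2) refl] that(3) by simp
    moreover have "fst y < fst x" if "snd y = snd x"
      using RST_less[OF assms(1), of "fst x" "snd x" "fst y" "snd y"] that \<open>x \<in> D\<close> \<open>y \<in> D\<close> \<open>\<tau> x < \<tau> y\<close>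
      by (cases x; cases y; cases "fst x \<le> fst y") auto
    ultimately show ?thesis by (auto simp: col_less_def)
  qed
  have "col_less y x \<longleftrightarrow> \<tau> x < \<tau> y" if "x \<in> D" "y \<in> D" for x y
  proof (cases "x = y")
    case False
    then have "\<tau> x \<noteq> \<tau> y" using labelling_inj[OF l that] by auto
    moreover have "\<not> (col_less x y \<and> col_less y x)" by (auto simp: col_less_def)
    ultimately show ?thesis using lt[OF that] lt[OF that(2,1)] by (metis linorder_neqE_nat)
  qed (simp add: col_less_def)
  then have "\<tau> x = N - card {y \<in> D. col_less y x}" if "x \<in> D" for x
    using decreasing_labelling_eq[OF l[unfolded labelling_def]] that by blast
  moreover have "\<tau> x = 0" if "x \<notin> D" for x using assms(1) that by (rule RST_outside)
  ultimately show ?thesis unfolding root_tableau_eq by auto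
qed

lemma root_tableau_less:
  assumes "x \<in> D" "y \<in> D" "col_less x y"
  shows "root_tableau lam y < root_tableau lam x"
proof -
  have "card {z \<in> D. col_less z x} < card {z \<in> D. col_less z y}"
    using count_below_less[OF finite_diagram col_less_transp col_less_irreflp] assms by blast
  moreover have "card {z \<in> D. col_less z y} < card D"
    using assms(2) irreflpD[OF col_less_irreflp, of y]
    by (intro psubset_card_mono finite_diagram) auto
  ultimately show ?thesis using assms by (simp add: root_tableau_eq card_diagram)
qed

lemma root_tableau_no_descent:
  assumes "1 \<le> i" "i < N"
  shows "\<not> CT lam (root_tableau lam) i - CT lam (root_tableau lam) (Suc i) \<le> - 2"
proof
  let ?\<tau> = "root_tableau lam"
  assume le: "CT lam ?\<tau> i - CT lam ?\<tau> (Suc i) \<le> - 2"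
  note l = RST_labelling[OF RST_root_tableau]
  obtain r c where x: "(r, c) \<in> D" "?\<tau> (r, c) = i"
    using labelling_cell[OF l, of i] assms by auto
  obtain r' c' where y: "(r', c') \<in> D" "?\<tau> (r', c') = Suc i"
    using labelling_cell[OF l, of "Suc i"] assms by auto
  have d: "(int c - int r) - (int c' - int r') \<le> - 2"
    using CT_label[OF l x(1)] CT_label[OF l y(1)] x y le by simp
  have cc: "c' \<le> c"
    using root_tableau_less[OF x(1) y(1)] x y by (auto simp: col_less_def intro: leI)
  have r: "Suc r' \<le> r" "c' = c \<Longrightarrow> Suc r' < r" using d cc by auto
  \<comment> \<open>The cell directly above that of i+1 comes between the two cells in the column
    order, so its label would have to lie between i and i+1.\<close>
  have z: "(Suc r', c') \<in> D"
    using diagram_down[OF x(1), of "Suc r'" c'] cc r diagram_pos[OF y(1)] by auto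
  have "?\<tau> (Suc r', c') < Suc i" "i < ?\<tau> (Suc r', c')"
    using root_tableau_less[OF y(1) z] root_tableau_less[OF z x(1)] x y cc r
    by (auto simp: col_less_def le_less)
  then show False by simp
qed

end

section \<open>The action of the symmetric group\<close>

text \<open>The off-diagonal coefficient of \<open>s\<^sub>i\<close> in terms of the content difference \<open>d\<close>. It vanishes for
  \<open>d = \<plusminus>1\<close>, exactly when the interchange is not a reverse standard tableau, so that the relations
  below need no case distinction.\<close>

definition off_diag :: "int \<Rightarrow> ratfun" where
  "off_diag d = (if d \<ge> 2 then 1 else 1 - (1 / of_int d)\<^sup>2)"

definition on_diag :: "int \<Rightarrow> ratfun" where
  "on_diag d = 1 / of_int d"

lemma on_diag_minus: "on_diag (- d) = - on_diag d"
  by (simp add: on_diag_def)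

text \<open>Partial fractions; with a, b, c the contents of three consecutive labels this is the
  scalar core of the braid relation on tableaux.\<close>

lemma on_diag_mult:
  assumes "a \<noteq> b" "b \<noteq> c" "a \<noteq> c"
  shows "on_diag (a - b) * on_diag (b - c) = on_diag (a - c) * (on_diag (a - b) + on_diag (b - c))"
proof -
  have "of_int (a - b) \<noteq> (0 :: ratfun)" "of_int (b - c) \<noteq> (0 :: ratfun)" "of_int (a - c) \<noteq> (0 :: ratfun)"
    using assms by (simp_all del: of_int_diff)
  then show ?thesis by (simp add: on_diag_def field_simps)
qed

lemma off_diag_1 [simp]: "off_diag 1 = 0" "off_diag (- 1) = 0"
  by (simp_all add: off_diag_def)

text \<open>The two directions of an interchange are normalized differently, by 1 and by 1 - b^2;
  only their product enters the group relations.\<close>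

lemma off_diag_mult: "d \<noteq> 0 \<Longrightarrow> off_diag d * off_diag (- d) = 1 - (on_diag d)\<^sup>2"
proof -
  assume "d \<noteq> 0"
  then consider "d \<ge> 2" | "d = 1" | "d = -1" | "d \<le> -2" by linarith
  then show ?thesis by cases (auto simp: off_diag_def on_diag_def)
qed

context shape
begin

lemma vec_s_basis_vec_eq:
  assumes "CT lam \<tau> i = a" "CT lam \<tau> (Suc i) = b" "a \<noteq> b"
  shows "vec_s lam i (basis_vec \<tau>)
    = smul (on_diag (a - b)) (basis_vec \<tau>) + smul (off_diag (a - b)) (basis_vec (interchange i \<tau>))"
proof -
  define d where "d = a - b"
  have d: "d \<noteq> 0" "CT lam \<tau> i - CT lam \<tau> (i + 1) = d" using assms by (auto simp: d_def)
  have single: "smul c (basis_vec \<sigma>) = single \<sigma> c" for \<sigma> c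
    by (rule poly_mapping_eqI) (simp add: lookup_single when_def)
  have c: "const (1 / of_int d) = on_diag d"
    using const_inverse_of_int[OF d(1)] by (simp add: on_diag_def)
  have c2: "const (1 - (1 / of_int d)\<^sup>2) = 1 - (on_diag d)\<^sup>2"
    by (simp only: const_diff const_1 power2_eq_square const_mult c)
  consider "d \<ge> 2" | "d = 1" | "d = -1" | "d \<le> -2" using d(1) by linarith
  then have "tableau_s lam i \<tau>
      = smul (on_diag d) (basis_vec \<tau>) + smul (off_diag d) (basis_vec (interchange i \<tau>))"
  proof cases
    case 1
    then have "(1 :: rat) / of_int d \<noteq> 1" "(1 :: rat) / of_int d \<noteq> - 1" "0 < (1 :: rat) / of_int d"
        "(1 :: rat) / of_int d \<le> 1 / 2"
      by (auto simp: field_simps)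
    moreover have "off_diag d = 1" using 1 by (simp add: off_diag_def)
    ultimately show ?thesis unfolding tableau_s_def d(2) Let_def c[symmetric]
      by (simp only: single if_False if_True simp_thms)
  next
    case 4
    then have "(1 :: rat) / of_int d \<noteq> 1" "(1 :: rat) / of_int d \<noteq> - 1" "\<not> 0 < (1 :: rat) / of_int d"
      by (auto simp: field_simps)
    moreover have "off_diag d = const (1 - (1 / of_int d)\<^sup>2)"
      unfolding c2 using 4 by (simp add: off_diag_def on_diag_def)
    ultimately show ?thesis unfolding tableau_s_def d(2) Let_def c[symmetric]
      by (simp only: single if_False simp_thms)
  qed (use c d(2) in \<open>simp_all add: tableau_s_def Let_def single\<close>)
  then show ?thesis by (simp add: vec_s_basis_vec d_def)
qed

text \<open>On \<tau> and its interchange the matrix of s_i has diagonal 1/d, -1/d and off-diagonal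
  product 1 - 1/d^2, so its square is the identity.\<close>

lemma vec_s_involution_basis:
  assumes "labelling \<tau>" "1 \<le> i" "i < N" "CT lam \<tau> i \<noteq> CT lam \<tau> (Suc i)"
  shows "vec_s lam i (vec_s lam i (basis_vec \<tau>)) = basis_vec \<tau>"
proof -
  define a b where "a = CT lam \<tau> i" and "b = CT lam \<tau> (Suc i)"
  have ab: "a \<noteq> b" using assms by (simp add: a_def b_def)
  have 1: "vec_s lam i (basis_vec \<tau>) = smul (on_diag (a - b)) (basis_vec \<tau>)
      + smul (off_diag (a - b)) (basis_vec (interchange i \<tau>))"
    using ab by (intro vec_s_basis_vec_eq) (simp_all add: a_def b_def)
  have 2: "vec_s lam i (basis_vec (interchange i \<tau>))
      = smul (on_diag (b - a)) (basis_vec (interchange i \<tau>)) + smul (off_diag (b - a)) (basis_vec \<tau>)"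
    using ab assms vec_s_basis_vec_eq[of "interchange i \<tau>" i b a]
    by (simp add: a_def b_def CT_interchange)
  have k: "off_diag (a - b) * off_diag (b - a) = 1 - (on_diag (a - b))\<^sup>2"
    using off_diag_mult[of "a - b"] ab by simp
  have m: "on_diag (b - a) = - on_diag (a - b)"
    using on_diag_minus[of "a - b"] by simp
  define p where "p = on_diag (a - b)"
  have "vec_s lam i (vec_s lam i (basis_vec \<tau>))
      = smul (p\<^sup>2 + off_diag (a - b) * off_diag (b - a)) (basis_vec \<tau>)"
    by (intro poly_mapping_eqI)
       (simp add: module_hom.add[OF vec_linear_vec_s] module_hom.scale[OF vec_linear_vec_s] 1 2
          lookup_add m p_def[symmetric] power2_eq_square algebra_simps)
  then show ?thesis using k by (simp add: p_def)
qed

lemma vec_s_comm_basis: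
  assumes "labelling \<tau>" "1 \<le> i" "Suc i < j" "j < N" "CT lam \<tau> i \<noteq> CT lam \<tau> (Suc i)"
    "CT lam \<tau> j \<noteq> CT lam \<tau> (Suc j)"
  shows "vec_s lam i (vec_s lam j (basis_vec \<tau>)) = vec_s lam j (vec_s lam i (basis_vec \<tau>))"
proof -
  define a b where "a = CT lam \<tau> i" and "b = CT lam \<tau> (Suc i)"
  define c d where "c = CT lam \<tau> j" and "d = CT lam \<tau> (Suc j)"
  have ne: "a \<noteq> b" "c \<noteq> d" using assms by (simp_all add: a_def b_def c_def d_def)
  have i: "vec_s lam i (basis_vec \<sigma>) = smul (on_diag (a - b)) (basis_vec \<sigma>)
      + smul (off_diag (a - b)) (basis_vec (interchange i \<sigma>))" if "\<sigma> \<in> {\<tau>, interchange j \<tau>}" for \<sigma>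
    using ne that assms
    by (intro vec_s_basis_vec_eq) (auto simp: a_def b_def CT_interchange)
  have j: "vec_s lam j (basis_vec \<sigma>) = smul (on_diag (c - d)) (basis_vec \<sigma>)
      + smul (off_diag (c - d)) (basis_vec (interchange j \<sigma>))" if "\<sigma> \<in> {\<tau>, interchange i \<tau>}" for \<sigma>
    using ne that assms
    by (intro vec_s_basis_vec_eq) (auto simp: c_def d_def CT_interchange)
  have "interchange i (interchange j \<tau>) = interchange j (interchange i \<tau>)"
    using transpose_comm[OF assms(3), of \<tau>] by (simp only: interchange_def)
  then show ?thesis
    by (intro poly_mapping_eqI)
       (simp add: module_hom.add[OF vec_linear_vec_s] module_hom.scale[OF vec_linear_vec_s] i j
          lookup_add algebra_simps)
qed

text \<open>Both sides are expanded over the six fillings obtained by permuting the labels i, i+1,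
  i+2. With p, q, r the reciprocal content differences, the coefficients of the two singly
  interchanged fillings agree by p q = r (p + q), that of \<tau> needs in addition the off-diagonal
  products, and the other three agree term by term.\<close>

lemma vec_s_braid_basis:
  assumes "labelling \<tau>" "1 \<le> i" "Suc i < N" "CT lam \<tau> i \<noteq> CT lam \<tau> (Suc i)"
    "CT lam \<tau> (Suc i) \<noteq> CT lam \<tau> (Suc (Suc i))" "CT lam \<tau> i \<noteq> CT lam \<tau> (Suc (Suc i))"
  shows "vec_s lam i (vec_s lam (Suc i) (vec_s lam i (basis_vec \<tau>)))
    = vec_s lam (Suc i) (vec_s lam i (vec_s lam (Suc i) (basis_vec \<tau>)))"
proof -
  define a b c where "a = CT lam \<tau> i" and "b = CT lam \<tau> (Suc i)" and "c = CT lam \<tau> (Suc (Suc i))"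
  have ne: "a \<noteq> b" "b \<noteq> c" "a \<noteq> c" using assms by (simp_all add: a_def b_def c_def)
  define s t where "s = interchange i" and "t = interchange (Suc i)"
  define p q r :: ratfun where "p = on_diag (a - b)" and "q = on_diag (b - c)" and "r = on_diag (a - c)"
  define e :: "tableau \<Rightarrow> vec" where "e = basis_vec"
  have L: "labelling \<tau>" "labelling (s \<tau>)" "labelling (t \<tau>)" "labelling (t (s \<tau>))" "labelling (s (t \<tau>))"
    using assms by (simp_all add: s_def t_def labelling_interchange)
  have C: "CT lam \<tau> i = a" "CT lam \<tau> (Suc i) = b" "CT lam \<tau> (Suc (Suc i)) = c"
    by (simp_all add: a_def b_def c_def)
  have ts: "CT lam (s \<sigma>) i = CT lam \<sigma> (Suc i)" "CT lam (s \<sigma>) (Suc i) = CT lam \<sigma> i"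
      "CT lam (s \<sigma>) (Suc (Suc i)) = CT lam \<sigma> (Suc (Suc i))"
      "CT lam (t \<sigma>) i = CT lam \<sigma> i" "CT lam (t \<sigma>) (Suc i) = CT lam \<sigma> (Suc (Suc i))"
      "CT lam (t \<sigma>) (Suc (Suc i)) = CT lam \<sigma> (Suc i)" if "labelling \<sigma>" for \<sigma>
    using that assms by (simp_all add: s_def t_def CT_interchange)
  have neg: "on_diag (b - a) = - p" "on_diag (c - b) = - q"
    using on_diag_minus[of "a - b"] on_diag_minus[of "b - c"] by (simp_all add: p_def q_def)
  have S1: "vec_s lam i (e \<tau>) = smul p (e \<tau>) + smul (off_diag (a - b)) (e (s \<tau>))"
    unfolding e_def p_def s_def using ne by (intro vec_s_basis_vec_eq) (simp_all add: C)
  have S2: "vec_s lam i (e (s \<tau>)) = smul (- p) (e (s \<tau>)) + smul (off_diag (b - a)) (e \<tau>)"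
    using vec_s_basis_vec_eq[of "s \<tau>" i b a] ne L by (simp add: ts C neg e_def) (simp add: s_def)
  have S3: "vec_s lam i (e (t \<tau>)) = smul r (e (t \<tau>)) + smul (off_diag (a - c)) (e (s (t \<tau>)))"
    using vec_s_basis_vec_eq[of "t \<tau>" i a c] ne L by (simp add: ts C r_def e_def) (simp add: s_def)
  have S4: "vec_s lam i (e (t (s \<tau>))) = smul q (e (t (s \<tau>))) + smul (off_diag (b - c)) (e (s (t (s \<tau>))))"
    using vec_s_basis_vec_eq[of "t (s \<tau>)" i b c] ne L by (simp add: ts C q_def e_def) (simp add: s_def)
  have T1: "vec_s lam (Suc i) (e \<tau>) = smul q (e \<tau>) + smul (off_diag (b - c)) (e (t \<tau>))"
    unfolding e_def q_def t_def using ne by (intro vec_s_basis_vec_eq) (simp_all add: C)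
  have T2: "vec_s lam (Suc i) (e (t \<tau>)) = smul (- q) (e (t \<tau>)) + smul (off_diag (c - b)) (e \<tau>)"
    using vec_s_basis_vec_eq[of "t \<tau>" "Suc i" c b] ne L by (simp add: ts C neg e_def) (simp add: t_def)
  have T3: "vec_s lam (Suc i) (e (s \<tau>)) = smul r (e (s \<tau>)) + smul (off_diag (a - c)) (e (t (s \<tau>)))"
    using vec_s_basis_vec_eq[of "s \<tau>" "Suc i" a c] ne L by (simp add: ts C r_def e_def) (simp add: t_def)
  have T4: "vec_s lam (Suc i) (e (s (t \<tau>))) = smul p (e (s (t \<tau>))) + smul (off_diag (a - b)) (e (t (s (t \<tau>))))"
    using vec_s_basis_vec_eq[of "s (t \<tau>)" "Suc i" a b] ne L by (simp add: ts C p_def e_def) (simp add: t_def)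
  have br: "t (s (t \<tau>)) = s (t (s \<tau>))"
    by (simp add: s_def t_def interchange_def transpose_braid)
  have pqr: "p * q = r * (p + q)"
    using on_diag_mult[OF ne] by (simp add: p_def q_def r_def)
  have k: "off_diag (a - b) * off_diag (b - a) = 1 - p\<^sup>2" "off_diag (b - c) * off_diag (c - b) = 1 - q\<^sup>2"
    using off_diag_mult[of "a - b"] off_diag_mult[of "b - c"] ne by (simp_all add: p_def q_def)
  have id: "vec_s lam i (vec_s lam (Suc i) (vec_s lam i (e \<tau>)))
      = smul (p * (q * p) + r * (off_diag (a - b) * off_diag (b - a))) (e \<tau>)
      + smul (off_diag (a - b) * (p * q - r * p)) (e (s \<tau>)) + smul (off_diag (b - c) * (p * r)) (e (t \<tau>))
      + smul (off_diag (b - c) * off_diag (a - c) * p) (e (s (t \<tau>)))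
      + smul (off_diag (a - b) * off_diag (a - c) * q) (e (t (s \<tau>)))
      + smul (off_diag (a - b) * off_diag (a - c) * off_diag (b - c)) (e (s (t (s \<tau>))))"
    by (intro poly_mapping_eqI)
       (simp add: module_hom.add[OF vec_linear_vec_s] module_hom.scale[OF vec_linear_vec_s]
         S1 S2 S3 S4 T1 T2 T3 T4 lookup_add algebra_simps)
  have id': "vec_s lam (Suc i) (vec_s lam i (vec_s lam (Suc i) (e \<tau>)))
      = smul (q * (p * q) + r * (off_diag (b - c) * off_diag (c - b))) (e \<tau>)
      + smul (off_diag (a - b) * (q * r)) (e (s \<tau>)) + smul (off_diag (b - c) * (p * q - q * r)) (e (t \<tau>))
      + smul (off_diag (b - c) * off_diag (a - c) * p) (e (s (t \<tau>)))
      + smul (off_diag (a - b) * off_diag (a - c) * q) (e (t (s \<tau>)))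
      + smul (off_diag (a - b) * off_diag (a - c) * off_diag (b - c)) (e (s (t (s \<tau>))))"
    by (intro poly_mapping_eqI)
       (simp add: module_hom.add[OF vec_linear_vec_s] module_hom.scale[OF vec_linear_vec_s]
         S1 S2 S3 S4 T1 T2 T3 T4 br lookup_add algebra_simps)
  have c1: "p * (q * p) + r * (off_diag (a - b) * off_diag (b - a))
      = q * (p * q) + r * (off_diag (b - c) * off_diag (c - b))"
    unfolding k using pqr by algebra
  have c2: "p * q - r * p = q * r" "p * r = p * q - q * r" using pqr by algebra+
  show ?thesis unfolding id[unfolded e_def] id'[unfolded e_def] c1 c2(1) c2(2) by (simp add: c2)
qed

text \<open>The span on which the group relations hold: here the contents of i, i+1, i+2 are
  distinct, so their differences are invertible.\<close>

definition rst_span :: "vec set" where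
  "rst_span = {t. keys t \<subseteq> {\<tau>. RST lam \<tau>}}"

lemma rst_span_add: "s \<in> rst_span \<Longrightarrow> t \<in> rst_span \<Longrightarrow> s + t \<in> rst_span"
  using keys_add[of s t] by (auto simp: rst_span_def)

lemma rst_span_smul: "t \<in> rst_span \<Longrightarrow> smul c t \<in> rst_span"
  by (auto simp: rst_span_def in_keys_iff)

lemma rst_span_sum: "(\<And>x. x \<in> A \<Longrightarrow> f x \<in> rst_span) \<Longrightarrow> sum f A \<in> rst_span"
  by (induction A rule: infinite_finite_induct) (auto simp: rst_span_add, auto simp: rst_span_def)

lemma rst_span_basis_vec: "RST lam \<tau> \<Longrightarrow> basis_vec \<tau> \<in> rst_span"
  by (simp add: rst_span_def)

text \<open>The span could only be left through an interchange that is not reverse standard; then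
  the contents differ by \<plusminus>1 and \<open>off_diag\<close> cancels the term.\<close>

lemma rst_span_vec_s:
  assumes "t \<in> rst_span" "1 \<le> i" "i < N"
  shows "vec_s lam i t \<in> rst_span"
proof -
  have "vec_s lam i (basis_vec \<tau>) \<in> rst_span" if "RST lam \<tau>" for \<tau>
  proof -
    have ne: "CT lam \<tau> i \<noteq> CT lam \<tau> (Suc i)"
      using RST_consecutive_content[OF that assms(2,3)] .
    show ?thesis
    proof (cases "\<bar>CT lam \<tau> i - CT lam \<tau> (Suc i)\<bar> \<ge> 2")
      case True
      then show ?thesis
        using RST_interchange[OF that assms(2,3)] vec_s_basis_vec_eq[OF refl refl ne] that
        by (simp add: rst_span_add rst_span_smul rst_span_basis_vec)
    next
      case False
      then have "CT lam \<tau> i - CT lam \<tau> (Suc i) = 1 \<or> CT lam \<tau> i - CT lam \<tau> (Suc i) = - 1"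
        using ne by linarith
      then have "off_diag (CT lam \<tau> i - CT lam \<tau> (Suc i)) = 0" by auto
      then show ?thesis using vec_s_basis_vec_eq[OF refl refl ne] that
        by (simp add: rst_span_smul rst_span_basis_vec)
    qed
  qed
  then show ?thesis
    unfolding vec_linear_expand[OF vec_linear_vec_s, of lam i t]
    using assms(1) by (intro rst_span_sum rst_span_smul) (auto simp: rst_span_def)
qed

lemma rst_span_keys: "t \<in> rst_span \<Longrightarrow> \<tau> \<in> keys t \<Longrightarrow> RST lam \<tau>"
  by (auto simp: rst_span_def)

lemma vec_s_involution:
  assumes "t \<in> rst_span" "1 \<le> i" "i < N"
  shows "vec_s lam i (vec_s lam i t) = t"
proof (rule vec_linear_cong[where B' = "\<lambda>t. t"])
  show "vec_linear (\<lambda>t. vec_s lam i (vec_s lam i t))"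
    by (rule vec_linear_compose[OF vec_linear_vec_s vec_linear_vec_s])
  show "vec_linear (\<lambda>t. t)" by (rule vec_linearI) auto
  fix \<tau> assume "\<tau> \<in> keys t"
  then have "RST lam \<tau>" using assms(1) by (rule rst_span_keys[rotated])
  then show "vec_s lam i (vec_s lam i (basis_vec \<tau>)) = basis_vec \<tau>"
    using assms by (intro vec_s_involution_basis RST_labelling RST_consecutive_content)
qed

lemma vec_s_comm:
  assumes "t \<in> rst_span" "1 \<le> i" "Suc i < j" "j < N"
  shows "vec_s lam i (vec_s lam j t) = vec_s lam j (vec_s lam i t)"
proof (rule vec_linear_cong[where t = t])
  show "vec_linear (\<lambda>t. vec_s lam i (vec_s lam j t))" "vec_linear (\<lambda>t. vec_s lam j (vec_s lam i t))"
    by (rule vec_linear_compose[OF vec_linear_vec_s vec_linear_vec_s])+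
  fix \<tau> assume "\<tau> \<in> keys t"
  then have "RST lam \<tau>" using assms(1) by (rule rst_span_keys[rotated])
  then show "vec_s lam i (vec_s lam j (basis_vec \<tau>)) = vec_s lam j (vec_s lam i (basis_vec \<tau>))"
    using assms by (intro vec_s_comm_basis RST_labelling RST_consecutive_content) auto
qed

lemma vec_s_braid:
  assumes "t \<in> rst_span" "1 \<le> i" "Suc i < N"
  shows "vec_s lam i (vec_s lam (Suc i) (vec_s lam i t))
    = vec_s lam (Suc i) (vec_s lam i (vec_s lam (Suc i) t))"
proof (rule vec_linear_cong[where t = t])
  show "vec_linear (\<lambda>t. vec_s lam i (vec_s lam (Suc i) (vec_s lam i t)))"
    "vec_linear (\<lambda>t. vec_s lam (Suc i) (vec_s lam i (vec_s lam (Suc i) t)))"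
    by (rule vec_linear_compose[OF vec_linear_vec_s vec_linear_compose[OF vec_linear_vec_s vec_linear_vec_s]])+
  fix \<tau> assume "\<tau> \<in> keys t"
  then have "RST lam \<tau>" using assms(1) by (rule rst_span_keys[rotated])
  then show "vec_s lam i (vec_s lam (Suc i) (vec_s lam i (basis_vec \<tau>)))
      = vec_s lam (Suc i) (vec_s lam i (vec_s lam (Suc i) (basis_vec \<tau>)))"
    using assms by (intro vec_s_braid_basis RST_labelling RST_consecutive_content RST_consecutive_content2) auto
qed

definition rst_poly :: "vpoly \<Rightarrow> bool" where
  "rst_poly P \<longleftrightarrow> (\<forall>u. cf u P \<in> rst_span)"

lemma rst_poly_add: "rst_poly P \<Longrightarrow> rst_poly Q \<Longrightarrow> rst_poly (P + Q)"
  by (simp add: rst_poly_def cf_add rst_span_add)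

lemma rst_poly_scale: "rst_poly P \<Longrightarrow> rst_poly (scale c P)"
  by (simp add: rst_poly_def cf_scale rst_span_smul)

lemma rst_poly_act: "rst_poly P \<Longrightarrow> 1 \<le> i \<Longrightarrow> i < N \<Longrightarrow> rst_poly (act lam i P)"
  by (simp add: rst_poly_def cf_act rst_span_vec_s)

lemma rst_poly_fold_act: "rst_poly P \<Longrightarrow> set w \<subseteq> {1..<N} \<Longrightarrow> rst_poly (fold (act lam) w P)"
  by (induction w arbitrary: P) (auto simp: rst_poly_act)

lemma rst_poly_X_mult: "rst_poly P \<Longrightarrow> rst_poly (pmult (X j) P)"
  by (auto simp: rst_poly_def cf_X_mult) (simp add: rst_span_def)

lemma act_act: "rst_poly P \<Longrightarrow> 1 \<le> i \<Longrightarrow> i < N \<Longrightarrow> act lam i (act lam i P) = P"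
  by (rule vpoly_eqI) (simp add: cf_act vec_s_involution rst_poly_def)

lemma act_comm:
  assumes "rst_poly P" "1 \<le> i" "Suc i < j" "j < N"
  shows "act lam i (act lam j P) = act lam j (act lam i P)"
proof (rule vpoly_eqI)
  fix u
  have "exp_s i (exp_s j u) = exp_s j (exp_s i u)"
    using assms(3) by (intro poly_mapping_eqI) (simp add: transpose_def)
  then show "cf u (act lam i (act lam j P)) = cf u (act lam j (act lam i P))"
    using assms vec_s_comm[of "cf (exp_s j (exp_s i u)) P" i j] by (simp add: cf_act rst_poly_def)
qed

lemma act_braid:
  assumes "rst_poly P" "1 \<le> i" "Suc i < N"
  shows "act lam i (act lam (Suc i) (act lam i P)) = act lam (Suc i) (act lam i (act lam (Suc i) P))"
proof (rule vpoly_eqI)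
  fix u
  have "exp_s i (exp_s (Suc i) (exp_s i u)) = exp_s (Suc i) (exp_s i (exp_s (Suc i) u))"
    by (intro poly_mapping_eqI) (simp add: transpose_def)
  then show "cf u (act lam i (act lam (Suc i) (act lam i P)))
      = cf u (act lam (Suc i) (act lam i (act lam (Suc i) P)))"
    using assms by (simp add: cf_act rst_poly_def vec_s_braid)
qed

text \<open>The locale demands its relations for all arguments, so the action is replaced by the
  identity off \<open>rst_poly\<close>, a class that the action preserves.\<close>

definition act' :: "nat \<Rightarrow> vpoly \<Rightarrow> vpoly" where
  "act' i P = (if rst_poly P then act lam i P else P)"

sublocale cox: coxeter_action act' N
  by standard (auto simp: act'_def rst_poly_act act_act act_braid intro: act_comm)

lemma fold_act': "rst_poly P \<Longrightarrow> set w \<subseteq> {1..<N} \<Longrightarrow> fold act' w P = fold (act lam) w P"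
  by (induction w arbitrary: P) (auto simp: act'_def rst_poly_act)


section \<open>Relations of the affine operator\<close>

lemma fold_act_X_mult:
  "fold (act lam) w (pmult (X j) P) = pmult (X (word_perm w j)) (fold (act lam) w P)"
  by (induction w arbitrary: j P) (simp_all add: act_X_mult word_perm_Cons)

lemma affine_op_eq: "affine_op lam P = pmult (X N) (fold (act lam) [1..<N] P)"
  by (simp add: affine_op_def diag_op_eq_fold_act)

lemma rst_poly_affine_op: "rst_poly P \<Longrightarrow> rst_poly (affine_op lam P)"
  unfolding affine_op_eq by (intro rst_poly_X_mult rst_poly_fold_act) auto

lemma fold_act_add: "fold (act lam) w (P + Q) = fold (act lam) w P + fold (act lam) w Q"
  by (induction w arbitrary: P Q) (simp_all add: act.add)

lemma fold_act_scale: "fold (act lam) w (scale c P) = scale c (fold (act lam) w P)"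
  by (induction w arbitrary: P) (simp_all add: act.scale)

lemma affine_op_add: "affine_op lam (P + Q) = affine_op lam P + affine_op lam Q"
  unfolding affine_op_eq fold_act_add
  by (rule poly_mapping_eqI) (simp add: lookup_add algebra_simps)

lemma affine_op_scale: "affine_op lam (scale c P) = scale c (affine_op lam P)"
  unfolding affine_op_eq fold_act_scale
  by (rule poly_mapping_eqI) (simp add: algebra_simps)

text \<open>For operators on the right this reads \<Psi> s_i = s_{i+1} \<Psi>: the cycle shifts the
  index, and s_i fixes x_N because i + 1 < N.\<close>

lemma act_affine_op:
  assumes "rst_poly P" "1 \<le> i" "Suc i < N"
  shows "act lam i (affine_op lam P) = affine_op lam (act lam (Suc i) P)"
proof -
  have "act' i (fold act' [1..<N] P) = fold act' [1..<N] (act' (Suc i) P)"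
    using assms by (intro cox.ascending_shift) auto
  moreover have "act' (Suc i) P = act lam (Suc i) P" "rst_poly (act lam (Suc i) P)"
    using assms by (simp_all add: act'_def rst_poly_act)
  moreover have "fold act' [1..<N] Q = fold (act lam) [1..<N] Q" "rst_poly (fold (act lam) [1..<N] Q)"
    if "rst_poly Q" for Q
    using fold_act'[OF that] rst_poly_fold_act[OF that] by auto
  ultimately have "act lam i (fold (act lam) [1..<N] P) = fold (act lam) [1..<N] (act lam (Suc i) P)"
    using assms by (simp add: act'_def)
  moreover have "transpose i (Suc i) N = N" using assms by (simp add: transpose_def)
  ultimately show ?thesis by (simp add: affine_op_eq act_X_mult)
qed

text \<open>This is \<theta> \<theta> s_{N-1} = s_1 \<theta> \<theta>. The last letter of the second
  cycle cancels against s_{N-1}, its other letters pass through the first cycle with indices raised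
  by one, and a pair s_1 s_1 inserted in front completes them to a cycle again.\<close>

lemma cycle_twice_act:
  assumes "rst_poly P" "2 \<le> N"
  shows "act lam (N - 1) (fold (act lam) [1..<N] (fold (act lam) [1..<N] P))
    = fold (act lam) [1..<N] (fold (act lam) [1..<N] (act lam 1 P))"
proof -
  have shift: "fold act' [1..<k] (fold act' [1..<N] P) = fold act' [1..<N] (fold act' [2..<Suc k] P)"
    if "1 \<le> k" "k < N" for k
    using that
  proof (induction k rule: dec_induct)
    case (step k)
    have "fold act' [1..<Suc k] (fold act' [1..<N] P) = act' k (fold act' [1..<N] (fold act' [2..<Suc k] P))"
      using step by simp
    also have "\<dots> = fold act' [1..<N] (act' (Suc k) (fold act' [2..<Suc k] P))"
      using step by (intro cox.ascending_shift) auto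
    finally show ?case using step by simp
  qed simp
  obtain n where n: "N = Suc n" "1 \<le> n" using assms(2) by (cases N) auto
  have split: "[1..<N] = [1..<n] @ [n]" "[1..<N] = 1 # [2..<N]"
    using n by (simp_all add: upt_conv_Cons numeral_2_eq_2)
  have "act' n (fold act' [1..<N] (fold act' [1..<N] P)) = fold act' [1..<n] (fold act' [1..<N] P)"
    using n cox.f_f[of n] by (subst split(1)) simp
  also have "\<dots> = fold act' [1..<N] (fold act' [2..<N] P)"
    using shift[of n] n by simp
  also have "fold act' [2..<N] P = fold act' [1..<N] (act' 1 P)"
    using n cox.f_f[of 1] by (subst split(2)) simp
  finally have *: "act' n (fold act' [1..<N] (fold act' [1..<N] P))
      = fold act' [1..<N] (fold act' [1..<N] (act' 1 P))" .
  have e: "fold act' [1..<N] Q = fold (act lam) [1..<N] Q" "rst_poly (fold (act lam) [1..<N] Q)"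
    if "rst_poly Q" for Q
    using fold_act'[OF that] rst_poly_fold_act[OF that] by auto
  have r: "rst_poly (act lam 1 P)" "act' 1 P = act lam 1 P"
    using assms by (auto simp: act'_def rst_poly_act)
  note e1 = e[OF assms(1)] and e2 = e[OF r(1)]
  note e1' = e[OF e1(2)] and e2' = e[OF e2(2)]
  have "N - 1 = n" using n by simp
  then show ?thesis using * by (simp only: r(2) e1(1) e1' e2(1) e2'(1) act'_def[of n] if_True)
qed

text \<open>Two affine steps produce the factor x_{N-1} x_N, which s_{N-1} leaves invariant. This
  closes the squares at the last position, which a single affine step does not reach.\<close>

lemma act_affine_op_affine_op:
  assumes "rst_poly P" "2 \<le> N"
  shows "act lam (N - 1) (affine_op lam (affine_op lam P)) = affine_op lam (affine_op lam (act lam 1 P))"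
proof -
  obtain n where n: "N = Suc n" "1 \<le> n" using assms(2) by (cases N) auto
  have "word_perm [1..<n] (Suc n) = Suc n"
    using word_perm_permutes[of "[1..<n]" 1 n] by (auto simp: permutes_def)
  then have w: "word_perm [1..<N] N = n"
    using n by (simp add: word_perm_append word_perm_Cons)
  have e: "affine_op lam (affine_op lam Q)
      = pmult (X N) (pmult (X n) (fold (act lam) [1..<N] (fold (act lam) [1..<N] Q)))" for Q
    by (simp only: affine_op_eq fold_act_X_mult w)
  have "pmult (X (Suc n)) (pmult (X n) Q) = pmult (X n) (pmult (X (Suc n)) Q)" for Q
    by (rule poly_mapping_eqI) (simp add: algebra_simps)
  then show ?thesis
    using cycle_twice_act[OF assms] n(1) by (simp add: e act_X_mult)
qed

section \<open>The antisymmetrizer\<close>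

lemma reduced_word:
  assumes "\<omega> permutes {1..N}"
  shows "set (reduced_word N \<omega>) \<subseteq> {1..<N}" "word_perm (reduced_word N \<omega>) = \<omega>"
proof -
  obtain w where "set w \<subseteq> {1..<N} \<and> word_perm w = \<omega>"
    using exists_word[OF assms] by blast
  from arg_min_natI[of "\<lambda>w. set w \<subseteq> {1..<N} \<and> word_perm w = \<omega>" w length, OF this]
  show "set (reduced_word N \<omega>) \<subseteq> {1..<N}" "word_perm (reduced_word N \<omega>) = \<omega>"
    by (simp_all add: reduced_word_def)
qed

lemma minus_one_power_coxeter_length:
  assumes "\<omega> permutes {1..N}"
  shows "(- 1) ^ coxeter_length N \<omega> = (of_int (sign \<omega>) :: ratfun)"
  using sign_word_perm[of "reduced_word N \<omega>"] reduced_word(2)[OF assms]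
  by (simp add: coxeter_length_def)

lemma antisymmetrizer_eq:
  "antisymmetrizer lam P
    = (\<Sum>\<omega> | \<omega> permutes {1..N}. scale (of_int (sign \<omega>)) (fold (act lam) (reduced_word N \<omega>) P))"
  unfolding antisymmetrizer_def
  by (intro sum.cong) (simp_all add: diag_op_eq_fold_act minus_one_power_coxeter_length)

lemma antisymmetrizer_add: "antisymmetrizer lam (P + Q) = antisymmetrizer lam P + antisymmetrizer lam Q"
  by (simp add: antisymmetrizer_eq fold_act_add vpoly.scale_right_distrib sum.distrib)

lemma antisymmetrizer_scale: "antisymmetrizer lam (scale c P) = scale c (antisymmetrizer lam P)"
  by (simp add: antisymmetrizer_eq fold_act_scale vpoly.scale_sum_right mult.commute)

lemma antisymmetrizer_hom: "module_hom scale scale (antisymmetrizer lam)"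
  by unfold_locales (rule antisymmetrizer_add antisymmetrizer_scale)+

text \<open>Right translation by s_i permutes the summands and flips their signs. Prefixing the
  reduced word of \<omega> by i gives a word for the translate, in general not the selected one, so
  independence of the word enters here.\<close>

lemma antisymmetrizer_act:
  assumes "rst_poly P" "1 \<le> i" "i < N"
  shows "antisymmetrizer lam (act lam i P) = - antisymmetrizer lam P"
proof -
  let ?s = "transpose i (Suc i)"
  let ?A = "\<lambda>\<omega> P. fold (act lam) (reduced_word N \<omega>) P"
  have s: "?s permutes {1..N}" using assms by (intro permutes_swap_id) auto
  have A: "?A \<omega> (act lam i P) = ?A (\<omega> \<circ> ?s) P" if w: "\<omega> permutes {1..N}" for \<omega>
  proof -
    have ws: "\<omega> \<circ> ?s permutes {1..N}" using s w by (rule permutes_compose)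
    have "?A \<omega> (act lam i P) = fold act' (i # reduced_word N \<omega>) P"
      using assms reduced_word(1)[OF w] fold_act'[of P "i # reduced_word N \<omega>"] by simp
    also have "\<dots> = fold act' (reduced_word N (\<omega> \<circ> ?s)) P"
      using assms reduced_word[OF w] reduced_word[OF ws]
      by (intro cox.fold_cong_word_perm[of _ 1]) (auto simp: word_perm_Cons)
    also have "\<dots> = ?A (\<omega> \<circ> ?s) P"
      using fold_act'[OF assms(1) reduced_word(1)[OF ws]] .
    finally show ?thesis .
  qed
  have sg: "sign (\<omega> \<circ> ?s) = - sign \<omega>" if "\<omega> permutes {1..N}" for \<omega>
    using that permutes_imp_permutation[of "{1..N}" \<omega>]
    by (subst sign_compose) (auto simp: permutation_swap_id sign_swap_id)
  have "antisymmetrizer lam (act lam i P)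
      = (\<Sum>\<omega> | \<omega> permutes {1..N}. - scale (of_int (sign (\<omega> \<circ> ?s))) (?A (\<omega> \<circ> ?s) P))"
    unfolding antisymmetrizer_eq by (intro sum.cong) (auto simp: A sg simp del: o_apply)
  also have "\<dots> = - (\<Sum>\<omega> | \<omega> permutes {1..N}. scale (of_int (sign \<omega>)) (?A \<omega> P))"
    unfolding sum_negf
    by (rule arg_cong[where f = uminus], rule sum.reindex_bij_witness[of _ "\<lambda>\<omega>. \<omega> \<circ> ?s" "\<lambda>\<omega>. \<omega> \<circ> ?s"])
       (use s in \<open>auto simp: comp_assoc simp del: o_apply intro: permutes_compose\<close>)
  finally show ?thesis by (simp add: antisymmetrizer_eq)
qed

lemma antisymmetrizer_antisymmetric:
  assumes "\<And>i. 1 \<le> i \<Longrightarrow> i < N \<Longrightarrow> act lam i P = - P"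
  shows "antisymmetrizer lam P = scale (of_nat (fact N)) P"
proof -
  have A: "fold (act lam) w P = scale (of_int ((- 1) ^ length w)) P" if "set w \<subseteq> {1..<N}" for w
    using that
  proof (induction w rule: rev_induct)
    case (snoc i w)
    then show ?case using assms[of i] by (simp add: act.scale)
  qed simp
  have "scale (of_int (sign \<omega>)) (fold (act lam) (reduced_word N \<omega>) P) = P" if "\<omega> permutes {1..N}" for \<omega>
    using A[OF reduced_word(1)[OF that]] sign_word_perm[of "reduced_word N \<omega>"] reduced_word(2)[OF that]
    by (simp flip: of_int_mult)
  then have "antisymmetrizer lam P = (\<Sum>\<omega> | \<omega> permutes {1..N}. P)"
    unfolding antisymmetrizer_eq by (intro sum.cong) auto
  also have "\<dots> = (\<Sum>\<omega> | \<omega> permutes {1..N}. scale 1 P)" by simp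
  also have "\<dots> = scale (\<Sum>\<omega> | \<omega> permutes {1..N}. 1) P"
    by (rule vpoly.scale_sum_left[symmetric])
  finally show ?thesis by (simp add: card_permutations[OF refl])
qed

section \<open>Intertwining operators\<close>

definition intertwine :: "nat \<Rightarrow> ratfun \<Rightarrow> vpoly \<Rightarrow> vpoly" where
  "intertwine i c P = act lam i P + scale c P"

lemma intertwine_comm:
  assumes "rst_poly P" "1 \<le> i" "Suc i < j" "j < N"
  shows "intertwine i c (intertwine j d P) = intertwine j d (intertwine i c P)"
  using act_comm[OF assms]
  by (simp add: intertwine_def act.add act.scale vpoly.scale_right_distrib mult.commute add_ac)

lemma intertwine_affine_op:
  assumes "rst_poly P" "1 \<le> i" "Suc i < N"
  shows "intertwine i c (affine_op lam P) = affine_op lam (intertwine (Suc i) c P)"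
  by (simp add: intertwine_def act_affine_op[OF assms] affine_op_add affine_op_scale)

lemma intertwine_affine_op_affine_op:
  assumes "rst_poly P" "2 \<le> N"
  shows "intertwine (N - 1) c (affine_op lam (affine_op lam P)) = affine_op lam (affine_op lam (intertwine 1 c P))"
  by (simp only: intertwine_def act_affine_op_affine_op[OF assms] affine_op_add affine_op_scale)

text \<open>For nonzero parameters the condition says 1/c = 1/a + 1/b: the reciprocals add up as
  differences of spectral values do.\<close>

lemma yang_baxter:
  assumes "rst_poly P" "1 \<le> i" "Suc i < N" "a * b = c * (a + b)"
  shows "intertwine i a (intertwine (Suc i) c (intertwine i b P))
    = intertwine (Suc i) b (intertwine i c (intertwine (Suc i) a P))"
proof -
  let ?s = "act lam i" and ?t = "act lam (Suc i)"
  have inv: "?s (?s P) = P" "?t (?t P) = P" using act_act[OF assms(1)] assms by auto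
  have br: "?s (?t (?s P)) = ?t (?s (?t P))" using act_braid[OF assms(1-3)] .
  have "intertwine i a (intertwine (Suc i) c (intertwine i b P))
      = ?t (?s (?t P)) + scale b (?s (?t P)) + scale a (?t (?s P)) + scale (c * b + a * c) (?s P)
        + scale (a * b) (?t P) + scale (c + a * c * b) P"
    unfolding intertwine_def
    by (simp add: act.add act.scale inv br vpoly.scale_right_distrib vpoly.scale_left_distrib
        add_ac mult_ac)
  moreover have "intertwine (Suc i) b (intertwine i c (intertwine (Suc i) a P))
      = ?t (?s (?t P)) + scale b (?s (?t P)) + scale a (?t (?s P)) + scale (a * b) (?s P)
        + scale (c * a + b * c) (?t P) + scale (c + a * c * b) P"
    unfolding intertwine_def
    by (simp add: act.add act.scale inv br vpoly.scale_right_distrib vpoly.scale_left_distrib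
        add_ac mult_ac)
  moreover have "c * b + a * c = a * b" "c * a + b * c = a * b"
    using assms(4) by (simp_all add: algebra_simps)
  ultimately show ?thesis by simp
qed

text \<open>Two intertwiners carry an eigenvector of s_i to one of the neighbouring s_j. For nonzero
  m and n the last condition says 1/m - 1/n = \<epsilon>: the spectral parameters differ by the
  eigenvalue. The braid relation is an assumption so that j may lie on either side of i.\<close>

lemma intertwine_eigenvector:
  assumes "rst_poly P" "1 \<le> i" "i < N" "1 \<le> j" "j < N"
    and "act lam i (act lam j (act lam i P)) = act lam j (act lam i (act lam j P))"
    and "act lam i P = scale \<epsilon> P" "\<epsilon> * \<epsilon> = 1" "n - m = \<epsilon> * m * n"
  shows "act lam j (intertwine i n (intertwine j m P)) = scale \<epsilon> (intertwine i n (intertwine j m P))"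
proof -
  let ?A = "act lam i" and ?B = "act lam j"
  have inv: "?B (?B P) = P" using act_act[OF assms(1)] assms by auto
  have Q: "intertwine i n (intertwine j m P)
      = ?A (?B P) + scale n (?B P) + scale (m * \<epsilon> + m * n) P"
    unfolding intertwine_def
    by (simp add: act.add act.scale assms(7) vpoly.scale_right_distrib vpoly.scale_left_distrib
        add_ac mult_ac)
  have "?B (?A (?B P)) = scale \<epsilon> (?A (?B P))"
    using assms(6,7) by (simp add: act.scale)
  then have "?B (intertwine i n (intertwine j m P))
      = scale \<epsilon> (?A (?B P)) + scale n P + scale (m * \<epsilon> + m * n) (?B P)"
    unfolding Q by (simp add: act.add act.scale inv)
  moreover have c: "m * \<epsilon> + m * n = \<epsilon> * n" and e: "\<epsilon> * (\<epsilon> * n) = n"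
    using assms(8,9) by algebra+
  ultimately show ?thesis unfolding Q
    by (simp add: vpoly.scale_right_distrib add_ac c e)
qed

end

section \<open>Spectral vectors\<close>

definition pos_less :: "nat list \<Rightarrow> nat \<Rightarrow> nat \<Rightarrow> bool" where
  "pos_less v j i \<longleftrightarrow> entry v j > entry v i \<or> entry v j = entry v i \<and> j < i"

lemma pos_less_transp: "transp (pos_less v)"
  by (auto simp: pos_less_def intro!: transpI)

lemma pos_less_irreflp: "irreflp (pos_less v)"
  by (auto simp: pos_less_def intro!: irreflpI)

lemma rank_eq:
  assumes "1 \<le> i" "i \<le> length v"
  shows "rank v i = Suc (card {j \<in> {1..length v}. pos_less v j i})"
proof -
  have 1: "{j \<in> {1..i}. entry v j = entry v i} = insert i {j \<in> {1..<i}. entry v j = entry v i}"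
    using assms by auto
  have 2: "{j \<in> {1..length v}. pos_less v j i}
      = {j \<in> {1..length v}. entry v j > entry v i} \<union> {j \<in> {1..<i}. entry v j = entry v i}"
    using assms by (auto simp: pos_less_def)
  have "card {j \<in> {1..length v}. pos_less v j i}
      = card {j \<in> {1..length v}. entry v j > entry v i} + card {j \<in> {1..<i}. entry v j = entry v i}"
    unfolding 2 by (rule card_Un_disjoint) auto
  then show ?thesis unfolding rank_def 1 by simp
qed

lemma rank_bij: "bij_betw (rank v) {1..length v} {1..length v}"
proof -
  have "bij_betw (\<lambda>i. card {j \<in> {1..length v}. pos_less v j i}) {1..length v} {0..<card {1..length v}}"
    by (rule count_below_bij[OF _ pos_less_transp pos_less_irreflp]) (auto simp: pos_less_def)
  moreover have "bij_betw Suc {0..<length v} {1..length v}"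
    by (rule bij_betwI[of _ _ _ "\<lambda>k. k - 1"]) auto
  ultimately have "bij_betw (Suc \<circ> (\<lambda>i. card {j \<in> {1..length v}. pos_less v j i})) {1..length v} {1..length v}"
    by (auto intro: bij_betw_trans)
  then show ?thesis
    by (rule bij_betw_cong[THEN iffD1, rotated]) (simp add: rank_eq)
qed

lemma rank_less:
  assumes "1 \<le> i" "i \<le> length v" "1 \<le> j" "j \<le> length v" "pos_less v i j"
  shows "rank v i < rank v j"
  using count_below_less[OF _ pos_less_transp pos_less_irreflp, of "{1..length v}" i v j] assms
  by (simp add: rank_eq)

lemma rank_range: "1 \<le> i \<Longrightarrow> i \<le> length v \<Longrightarrow> 1 \<le> rank v i \<and> rank v i \<le> length v"
  using bij_betwE[OF rank_bij[of v]] by simp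

lemma rank_eq_iff:
  "1 \<le> i \<Longrightarrow> i \<le> length v \<Longrightarrow> 1 \<le> j \<Longrightarrow> j \<le> length v \<Longrightarrow> rank v i = rank v j \<longleftrightarrow> i = j"
  using bij_betw_imp_inj_on[OF rank_bij[of v]] by (auto dest: inj_onD)

lemma rank_tie:
  assumes "1 \<le> i" "i < length v" "entry v i = entry v (i + 1)"
  shows "rank v (Suc i) = Suc (rank v i)"
proof -
  have "{j \<in> {1..length v}. pos_less v j (Suc i)} = insert i {j \<in> {1..length v}. pos_less v j i}"
    using assms by (auto simp: pos_less_def)
  then show ?thesis using assms by (simp add: rank_eq) (simp add: pos_less_def)
qed

text \<open>\<open>rank\<close> depends only on the order of the positions, so a bijection
  respecting this order carries it along; exchanges and affine shifts are the two instances.\<close>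

lemma rank_transfer:
  assumes "length v' = length v" "bij_betw \<rho> {1..length v} {1..length v}"
    and "\<And>a b. a \<in> {1..length v} \<Longrightarrow> b \<in> {1..length v} \<Longrightarrow> pos_less v' a b \<longleftrightarrow> pos_less v (\<rho> a) (\<rho> b)"
    and "1 \<le> i" "i \<le> length v"
  shows "rank v' i = rank v (\<rho> i)"
proof -
  let ?I = "{1..length v}"
  have "bij_betw \<rho> {j \<in> ?I. pos_less v' j i} {j \<in> ?I. pos_less v j (\<rho> i)}"
  proof (rule bij_betw_imageI)
    show "inj_on \<rho> {j \<in> ?I. pos_less v' j i}"
      using bij_betw_imp_inj_on[OF assms(2)] by (rule inj_on_subset) auto
    show "\<rho> ` {j \<in> ?I. pos_less v' j i} = {j \<in> ?I. pos_less v j (\<rho> i)}"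
    proof (intro set_eqI iffI)
      fix j assume j: "j \<in> {j \<in> ?I. pos_less v j (\<rho> i)}"
      then obtain k where "k \<in> ?I" "j = \<rho> k"
        using bij_betw_imp_surj_on[OF assms(2)] by blast
      then show "j \<in> \<rho> ` {j \<in> ?I. pos_less v' j i}" using j assms(3)[of k i] assms(4,5) by auto
    qed (use assms bij_betwE[OF assms(2)] in auto)
  qed
  then have "card {j \<in> ?I. pos_less v' j i} = card {j \<in> ?I. pos_less v j (\<rho> i)}"
    by (rule bij_betw_same_card)
  moreover have "\<rho> i \<in> ?I" using bij_betwE[OF assms(2)] assms(4,5) by auto
  ultimately show ?thesis using assms(1,4,5) by (simp add: rank_eq)
qed

lemma length_swap_entries [simp]: "length (swap_entries i v) = length v"
  by (simp add: swap_entries_def)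

lemma entry_swap_entries [unfolded One_nat_def]:
  assumes "1 \<le> i" "i < length v" "1 \<le> j" "j \<le> length v"
  shows "entry (swap_entries i v) j = entry v (transpose i (Suc i) j)"
  using assms by (auto simp: swap_entries_def transpose_def nth_list_update)

lemma rank_swap_entries:
  assumes "1 \<le> i" "i < length v" "entry v i \<noteq> entry v (i + 1)" "1 \<le> j" "j \<le> length v"
  shows "rank (swap_entries i v) j = rank v (transpose i (Suc i) j)"
proof (rule rank_transfer)
  show "bij_betw (transpose i (Suc i)) {1..length v} {1..length v}"
    using assms by (intro permutes_imp_bij permutes_swap_id) auto
  fix a b assume ab: "a \<in> {1..length v}" "b \<in> {1..length v}"
  have "a < b \<longleftrightarrow> transpose i (Suc i) a < transpose i (Suc i) b"
    if e: "entry v (transpose i (Suc i) a) = entry v (transpose i (Suc i) b)"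
  proof -
    have "\<not> (a = i \<and> b = Suc i)" "\<not> (a = Suc i \<and> b = i)" using e assms(3) by auto
    then show ?thesis by (auto simp: transpose_def)
  qed
  then show "pos_less (swap_entries i v) a b \<longleftrightarrow> pos_less v (transpose i (Suc i) a) (transpose i (Suc i) b)"
    using ab assms by (auto simp: pos_less_def entry_swap_entries)
qed (use assms in auto)

lemma length_affine_shift [simp]: "v \<noteq> [] \<Longrightarrow> length (affine_shift v) = length v"
  by (simp add: affine_shift_def)

lemma entry_affine_shift [unfolded One_nat_def]:
  assumes "1 \<le> j" "j \<le> length v"
  shows "entry (affine_shift v) j = (if j = length v then entry v 1 + 1 else entry v (Suc j))"
  using assms by (cases v) (auto simp: affine_shift_def nth_append nth_Cons')

text \<open>Moving the first entry to the end and adding 1 keeps the order: entries equal to it lost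
  the tie before and are smaller now, while entries larger by 1 now tie with it and win by standing
  to its left.\<close>

lemma rank_affine_shift:
  assumes "1 \<le> j" "j \<le> length v"
  shows "rank (affine_shift v) j = rank v (if j = length v then 1 else Suc j)"
proof (rule rank_transfer[where \<rho> = "\<lambda>j. if j = length v then 1 else Suc j"])
  show "bij_betw (\<lambda>j. if j = length v then 1 else Suc j) {1..length v} {1..length v}"
    by (rule bij_betwI[of _ _ _ "\<lambda>j. if j = 1 then length v else j - 1"]) (use assms in auto)
  show "length (affine_shift v) = length v" using assms by (intro length_affine_shift) auto
qed (use assms in \<open>auto simp: pos_less_def entry_affine_shift\<close>)

section \<open>The graph in terms of spectral vectors\<close>

text \<open>The pair \<open>(a, c)\<close> stands for the spectral value \<open>\<alpha> a + c\<close>.\<close>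

definition ascent :: "nat \<times> int \<Rightarrow> nat \<times> int \<Rightarrow> bool" where
  "ascent p q \<longleftrightarrow> fst p < fst q \<or> fst p = fst q \<and> snd p \<ge> snd q + 2"

lemma ascent_asym: "ascent p q \<Longrightarrow> \<not> ascent q p"
  by (auto simp: ascent_def)

lemma ascent_trans: "ascent p q \<Longrightarrow> ascent q r \<Longrightarrow> ascent p r"
  by (auto simp: ascent_def)

text \<open>These are the critical integers: 0 as a denominator in J, -1 in the factors of F, and 1
  in the factors picked up under antisymmetrization.\<close>

lemma ascent_spectral_value_diff:
  assumes "ascent p q \<or> ascent q p" "\<bar>k\<bar> \<le> 1"
  shows "spec_diff p q \<noteq> of_int k"
  using assms unfolding spectral_value_diff_eq_iff by (auto simp: ascent_def)

definition pair_sum :: "nat \<Rightarrow> ('a \<Rightarrow> 'a \<Rightarrow> nat) \<Rightarrow> (nat \<Rightarrow> 'a) \<Rightarrow> nat" where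
  "pair_sum n g z = (\<Sum>(i, j) \<in> {(i, j). 1 \<le> i \<and> i < j \<and> j \<le> n}. g (z i) (z j))"

lemma finite_pairs: "finite {(i, j). 1 \<le> i \<and> i < j \<and> j \<le> (n :: nat)}"
  by (rule finite_subset[of _ "{1..n} \<times> {1..n}"]) auto

lemma pair_sum_cong:
  "(\<And>i. 1 \<le> i \<Longrightarrow> i \<le> n \<Longrightarrow> z i = z' i) \<Longrightarrow> pair_sum n g z = pair_sum n g z'"
  unfolding pair_sum_def by (intro sum.cong) auto

text \<open>All pairs other than (k, k+1) are permuted among themselves. It measures the effect of
  an exchange both on inversions and on the length of exponents, and avoids subtraction in the
  naturals.\<close>

lemma pair_sum_swap:
  assumes "1 \<le> k" "k < n"
  shows "pair_sum n g (\<lambda>i. z (transpose k (Suc k) i)) + g (z k) (z (Suc k))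
    = pair_sum n g z + g (z (Suc k)) (z k)"
proof -
  let ?A = "{(i, j). 1 \<le> i \<and> i < j \<and> j \<le> n}"
  let ?s = "transpose k (Suc k)"
  have mem: "(k, Suc k) \<in> ?A" using assms by auto
  have split: "pair_sum n g y = g (y k) (y (Suc k)) + (\<Sum>(i, j) \<in> ?A - {(k, Suc k)}. g (y i) (y j))" for y
    unfolding pair_sum_def by (subst sum.remove[OF finite_pairs mem]) simp
  have "(\<Sum>(i, j) \<in> ?A - {(k, Suc k)}. g (z (?s i)) (z (?s j))) = (\<Sum>(i, j) \<in> ?A - {(k, Suc k)}. g (z i) (z j))"
    by (rule sum.reindex_bij_witness[of _ "\<lambda>(i, j). (?s i, ?s j)" "\<lambda>(i, j). (?s i, ?s j)"])
       (use assms in \<open>auto simp: transpose_def split: if_splits\<close>)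
  then show ?thesis
    by (simp add: split[of z] split[of "\<lambda>i. z (?s i)"])
qed

context shape
begin

section \<open>Vertices, moves and shifts\<close>

definition valid :: "vertex \<Rightarrow> bool" where
  "valid x \<longleftrightarrow> RST lam (fst x) \<and> length (snd x) = N"

definition spec :: "vertex \<Rightarrow> nat \<Rightarrow> nat \<times> int" where
  "spec x i = (entry (snd x) i, CT lam (fst x) (rank (snd x) i))"

text \<open>The direction of an edge is forgotten: the same formula goes up and down along it.
  Outside the swappable case the result need not be a vertex.\<close>

definition move :: "nat \<Rightarrow> vertex \<Rightarrow> vertex" where
  "move i x = (if entry (snd x) i = entry (snd x) (Suc i)
     then (interchange (rank (snd x) i) (fst x), snd x) else (fst x, swap_entries i (snd x)))"

definition shift :: "vertex \<Rightarrow> vertex" where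
  "shift x = (fst x, affine_shift (snd x))"

lemma zeta_eq: "zeta lam x i = spectral_value (spec x i)"
  by (simp add: zeta_def spectral_value_def spec_def split_beta)

abbreviation swappable :: "nat \<Rightarrow> vertex \<Rightarrow> bool" where
  "swappable i x \<equiv> 1 \<le> i \<and> i < N \<and>
     (ascent (spec x i) (spec x (Suc i)) \<or> ascent (spec x (Suc i)) (spec x i))"

lemma valid_move:
  assumes "valid x" "swappable i x"
  shows "valid (move i x)"
proof (cases "entry (snd x) i = entry (snd x) (Suc i)")
  case True
  let ?r = "rank (snd x) i"
  have "rank (snd x) (Suc i) = Suc ?r" "1 \<le> ?r" "Suc ?r \<le> N"
    using rank_tie[of i "snd x"] rank_range[of "Suc i" "snd x"] rank_range[of i "snd x"] True assms
    by (auto simp: valid_def)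
  then show ?thesis
    using True assms RST_interchange[of "fst x" ?r] by (auto simp: move_def valid_def spec_def ascent_def)
qed (use assms in \<open>auto simp: move_def valid_def\<close>)

text \<open>At a tie the positions i and i+1 have consecutive ranks, so interchanging these labels
  exchanges the two contents; otherwise the ranks travel with the entries.\<close>

lemma spec_move:
  assumes "valid x" "1 \<le> i" "i < N" "1 \<le> j" "j \<le> N"
  shows "spec (move i x) j = spec x (transpose i (Suc i) j)"
proof (cases "entry (snd x) i = entry (snd x) (Suc i)")
  case True
  let ?v = "snd x"
  have len: "length ?v = N" using assms by (simp add: valid_def)
  let ?r = "rank ?v i"
  have r: "rank ?v (Suc i) = Suc ?r" using rank_tie[of i ?v] True assms len by simp
  have rr: "1 \<le> ?r" "Suc ?r \<le> N"
    using r rank_range[of "Suc i" ?v] rank_range[of i ?v] assms len by auto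
  have "transpose ?r (Suc ?r) (rank ?v j) = rank ?v (transpose i (Suc i) j)"
    using rank_eq_iff[of j ?v i] rank_eq_iff[of j ?v "Suc i"] r assms len
    by (auto simp: transpose_def)
  moreover have "CT lam (interchange ?r (fst x)) (rank ?v j) = CT lam (fst x) (transpose ?r (Suc ?r) (rank ?v j))"
    using assms rr rank_range[of j ?v] len
    by (intro CT_interchange RST_labelling) (auto simp: valid_def)
  moreover have "entry ?v j = entry ?v (transpose i (Suc i) j)"
    using True by (auto simp: transpose_def)
  ultimately show ?thesis using True by (simp add: move_def spec_def)
next
  case False
  then show ?thesis using assms
    by (simp add: move_def spec_def entry_swap_entries rank_swap_entries valid_def)
qed

lemma valid_nonempty: "valid x \<Longrightarrow> snd x \<noteq> []"
  using N_pos unfolding valid_def by (metis length_0_conv less_irrefl)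

lemma valid_shift:
  assumes "valid x"
  shows "valid (shift x)"
proof -
  have "snd x \<noteq> []" using assms by (rule valid_nonempty)
  then show ?thesis using assms by (simp add: valid_def shift_def)
qed

lemma spec_shift:
  assumes "valid x" "1 \<le> j" "j \<le> N"
  shows "spec (shift x) j = (if j = N then (fst (spec x 1) + 1, snd (spec x 1)) else spec x (Suc j))"
  using assms by (simp add: spec_def shift_def valid_def entry_affine_shift rank_affine_shift)

text \<open>The first components give v and hence its ranks. These exhaust all labels, so the second
  components give the content of every label, which determines the tableau.\<close>

lemma spec_inj:
  assumes "valid x" "valid y" "\<And>i. 1 \<le> i \<Longrightarrow> i \<le> N \<Longrightarrow> spec x i = spec y i"
  shows "x = y"
proof -
  have len: "length (snd x) = N" "length (snd y) = N" using assms by (auto simp: valid_def)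
  have v: "snd x = snd y"
  proof (rule nth_equalityI)
    fix i assume "i < length (snd x)"
    then show "snd x ! i = snd y ! i" using assms(3)[of "Suc i"] len by (simp add: spec_def)
  qed (simp add: len)
  have "fst x = fst y"
  proof (rule RST_eq_if_content_eq)
    fix k assume k: "1 \<le> k" "k \<le> N"
    then obtain i where i: "i \<in> {1..N}" "rank (snd x) i = k"
      using bij_betw_imp_surj_on[OF rank_bij[of "snd x"]] len by (metis atLeastAtMost_iff imageE)
    then show "CT lam (fst x) k = CT lam (fst y) k"
      using assms(3)[of i] v by (auto simp: spec_def)
  qed (use assms in \<open>auto simp: valid_def\<close>)
  with v show ?thesis by (simp add: prod_eq_iff)
qed

lemma move_move:
  assumes "valid x" "swappable i x"
  shows "move i (move i x) = x"
proof (rule spec_inj)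
  have "swappable i (move i x)" using assms by (auto simp: spec_move)
  then show "valid (move i (move i x))" using valid_move assms by blast
  fix j assume "1 \<le> j" "j \<le> N"
  moreover from this have "1 \<le> transpose i (Suc i) j" "transpose i (Suc i) j \<le> N"
    using assms by (auto simp: transpose_def)
  ultimately show "spec (move i (move i x)) j = spec x j"
    using assms valid_move[OF assms] by (simp add: spec_move)
qed fact

lemma G_edge_Simple_iff:
  assumes "valid x"
  shows "G_edge lam x (Simple i) (Some y) \<longleftrightarrow>
    1 \<le> i \<and> i < N \<and> ascent (spec x i) (spec x (Suc i)) \<and> y = move i x" (is "?L \<longleftrightarrow> ?R")
proof
  obtain \<tau> v where x: "x = (\<tau>, v)" by (cases x)
  have len: "length v = N" using assms by (simp add: valid_def x)
  have tie: "rank v (Suc i) = Suc (rank v i)" if "1 \<le> i" "i < N" "entry v i = entry v (i + 1)"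
    using rank_tie[of i v] that len by simp
  show ?R if ?L
    using that unfolding x
    by (cases rule: G_edge.cases) (use tie in \<open>auto simp: move_def spec_def ascent_def\<close>)
  show ?L if ?R
  proof (cases "entry v i = entry v (i + 1)")
    case True
    then show ?thesis
      using that G_edge.tableau_step[of i lam v \<tau>] tie
      by (auto simp: x move_def spec_def ascent_def)
  next
    case False
    then show ?thesis
      using that G_edge.step[of i lam v \<tau>] by (auto simp: x move_def spec_def ascent_def)
  qed
qed

lemma G_edge_Affine_iff: "G_edge lam x Affine (Some y) \<longleftrightarrow> y = shift x"
  by (cases x) (auto simp: shift_def elim: G_edge.cases intro: G_edge.affine)

definition inversions :: "vertex \<Rightarrow> nat" where
  "inversions x = pair_sum N (\<lambda>p q. of_bool (ascent q p)) (spec x)"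

text \<open>The order for the inductions along the graph: an affine edge raises the sum of v, an s_i
  edge keeps it and adds one inversion of the spectral vector.\<close>

definition below :: "(vertex \<times> vertex) set" where
  "below = inv_image (less_than <*lex*> less_than) (\<lambda>x. (sum_list (snd x), inversions x))"

lemma wf_below: "wf below"
  by (auto simp: below_def)

lemma inversions_move:
  assumes "valid x" "1 \<le> i" "i < N" "ascent (spec x i) (spec x (Suc i))"
  shows "inversions (move i x) = Suc (inversions x)"
proof -
  have "inversions (move i x) = pair_sum N (\<lambda>p q. of_bool (ascent q p)) (\<lambda>j. spec x (transpose i (Suc i) j))"
    unfolding inversions_def using assms by (intro pair_sum_cong) (simp add: spec_move)
  then show ?thesis
    using pair_sum_swap[OF assms(2,3), of "\<lambda>p q. of_bool (ascent q p)" "spec x"] assms(4) ascent_asym[OF assms(4)]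
    by (simp add: inversions_def)
qed

lemma sum_list_swap_entries:
  assumes "1 \<le> i" "i < length v"
  shows "sum_list (swap_entries i v) = sum_list v"
proof -
  have "swap_entries i v = v[i - 1 := v ! i, i := v ! (i - 1)]" by (simp add: swap_entries_def)
  then show ?thesis
    using mset_swap[of i v "i - 1"] assms by (metis less_imp_diff_less sum_mset_sum_list)
qed

lemma below_move:
  assumes "valid x" "1 \<le> i" "i < N" "ascent (spec x i) (spec x (Suc i))"
  shows "(x, move i x) \<in> below"
  using assms inversions_move[OF assms] sum_list_swap_entries[of i "snd x"]
  by (auto simp: below_def move_def valid_def)

lemma below_shift:
  assumes "valid x"
  shows "(x, shift x) \<in> below"
proof -
  have "snd x \<noteq> []" using assms by (rule valid_nonempty)
  then show ?thesis by (cases "snd x") (auto simp: below_def shift_def affine_shift_def)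
qed

end

section \<open>Path independence\<close>

context shape
begin

lemma transpose_simps:
  "transpose i (Suc i) i = Suc i" "transpose i (Suc i) (Suc i) = i"
  "j \<noteq> i \<Longrightarrow> j \<noteq> Suc i \<Longrightarrow> transpose i (Suc i) j = j"
  by (simp_all add: transpose_def)

lemma move_comm:
  assumes "valid x" "swappable i x" "swappable j x" "Suc i < j"
  shows "move i (move j x) = move j (move i x)"
proof (rule spec_inj)
  have si: "swappable i (move j x)" and sj: "swappable j (move i x)"
    using assms by (auto simp: spec_move transpose_simps)
  show "valid (move i (move j x))" "valid (move j (move i x))"
    using valid_move[OF valid_move[OF assms(1,3)] si] valid_move[OF valid_move[OF assms(1,2)] sj] .
  fix k assume k: "1 \<le> k" "k \<le> N"
  have "1 \<le> transpose i (Suc i) k" "transpose i (Suc i) k \<le> N"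
    "1 \<le> transpose j (Suc j) k" "transpose j (Suc j) k \<le> N"
    using assms k by (auto simp: transpose_def)
  moreover have "transpose i (Suc i) (transpose j (Suc j) k) = transpose j (Suc j) (transpose i (Suc i) k)"
    using assms(4) by (simp add: transpose_def)
  ultimately show "spec (move i (move j x)) k = spec (move j (move i x)) k"
    using assms k valid_move[OF assms(1,2)] valid_move[OF assms(1,3)] by (simp add: spec_move)
qed

text \<open>The values \<open>R\<close> and the edge weights \<open>W\<close> are abstract because the polynomials \<open>J\<close> and the
  coefficients \<open>F\<close> are both instances.\<close>

lemma diamond:
  fixes R :: "vertex \<Rightarrow> 'm \<Rightarrow> bool" and W :: "nat \<Rightarrow> ratfun \<Rightarrow> 'm \<Rightarrow> 'm"
  assumes S: "\<And>y. y \<in> S \<Longrightarrow> valid y" "\<And>y i. y \<in> S \<Longrightarrow> swappable i y \<Longrightarrow> move i y \<in> S"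
    and step: "\<And>y i m. y \<in> S \<Longrightarrow> R y m \<Longrightarrow> 1 \<le> i \<Longrightarrow> i < N \<Longrightarrow> ascent (spec y i) (spec y (Suc i)) \<Longrightarrow>
      R (move i y) (W i (spec_diff (spec y (Suc i)) (spec y i)) m)"
    and ex: "\<And>y. y \<in> S \<Longrightarrow> \<exists>m. R y m"
    and uniq: "\<And>y m m'. y \<in> S \<Longrightarrow> (y, x) \<in> below \<Longrightarrow> R y m \<Longrightarrow> R y m' \<Longrightarrow> m = m'"
    and comm: "\<And>y m i j c d. R y m \<Longrightarrow> 1 \<le> i \<Longrightarrow> Suc i < j \<Longrightarrow> j < N \<Longrightarrow> W i c (W j d m) = W j d (W i c m)"
    and braid: "\<And>y m i c d. R y m \<Longrightarrow> 1 \<le> i \<Longrightarrow> Suc i < N \<Longrightarrow> c \<noteq> 0 \<Longrightarrow> d \<noteq> 0 \<Longrightarrow> c + d \<noteq> 0 \<Longrightarrow>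
      W i c (W (Suc i) (c + d) (W i d m)) = W (Suc i) d (W i (c + d) (W (Suc i) c m))"
    and x: "x \<in> S"
    and i: "1 \<le> i" "i < N" "ascent (spec x (Suc i)) (spec x i)" "R (move i x) m"
    and j: "1 \<le> j" "j < N" "ascent (spec x (Suc j)) (spec x j)" "R (move j x) m'"
  shows "W i (spec_diff (spec x i) (spec x (Suc i))) m
    = W j (spec_diff (spec x j) (spec x (Suc j))) m'"
proof -
  let ?v = "\<lambda>k. spectral_value (spec x k)"
  have vx: "valid x" using S(1)[OF x] .
  have lower: "(move k x, x) \<in> below" if k: "1 \<le> k" "k < N" "ascent (spec x (Suc k)) (spec x k)" for k
    using below_move[of "move k x" k] valid_move[OF vx] move_move[OF vx] k vx
    by (auto simp: spec_move transpose_simps)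
  have edge: "R y (W k (spec_diff (spec y k) (spec y (Suc k))) n)"
    if "y \<in> S" "1 \<le> k" "k < N" "ascent (spec y (Suc k)) (spec y k)" "R (move k y) n" for y k n
  proof -
    have "move k (move k y) = y" "move k y \<in> S" using that S move_move by auto
    moreover have "spec (move k y) k = spec y (Suc k)" "spec (move k y) (Suc k) = spec y k"
      using that S(1)[OF that(1)] by (simp_all add: spec_move transpose_simps)
    ultimately show ?thesis using step[of "move k y" n k] that by simp
  qed
  have *: "W i (?v i - ?v (Suc i)) m = W j (?v j - ?v (Suc j)) m'"
    if i: "1 \<le> i" "i < N" "ascent (spec x (Suc i)) (spec x i)" "R (move i x) m"
      and j: "1 \<le> j" "j < N" "ascent (spec x (Suc j)) (spec x j)" "R (move j x) m'" and "i < j"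
    for i j m m'
  proof (cases "Suc i < j")
    case True
    define y1 y2 w where "y1 = move i x" and "y2 = move j x" and "w = move j y1"
    have sx: "swappable i x" "swappable j x" using i j by auto
    have yS: "y1 \<in> S" "y2 \<in> S" using S(2)[OF x] sx by (auto simp: y1_def y2_def)
    have sp1: "spec y1 j = spec x j" "spec y1 (Suc j) = spec x (Suc j)"
      and sp2: "spec y2 i = spec x i" "spec y2 (Suc i) = spec x (Suc i)"
      using vx i j True by (simp_all add: y1_def y2_def spec_move transpose_simps)
    have wS: "w \<in> S" using S(2)[OF yS(1), of j] j sp1 by (simp add: w_def)
    have w2: "w = move i y2" using move_comm[OF vx sx True] by (simp add: w_def y1_def y2_def)
    \<comment> \<open>Both m and m' are computed from the value at the common predecessor w of the
      two neighbours.\<close>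
    obtain m0 where m0: "R w m0" using ex[OF wS] by blast
    have "R y1 (W j (?v j - ?v (Suc j)) m0)" "R y2 (W i (?v i - ?v (Suc i)) m0)"
      using edge[OF yS(1), of j m0] edge[OF yS(2), of i m0] m0 i j sp1 sp2 w2 w_def by auto
    then have "m = W j (?v j - ?v (Suc j)) m0" "m' = W i (?v i - ?v (Suc i)) m0"
      using uniq[OF yS(1)] uniq[OF yS(2)] lower i j by (auto simp: y1_def y2_def)
    then show ?thesis using comm[OF m0] i j True by simp
  next
    case False
    then have j': "j = Suc i" "Suc i < N" using \<open>i < j\<close> j(2) by auto
    \<comment> \<open>Here x reads p q r at i, i+1, i+2; the sides of the hexagon run through q p r,
      q r p and through p r q, r p q, and meet at r q p.\<close>
    define p q r where "p = spec x i" and "q = spec x (Suc i)" and "r = spec x (Suc (Suc i))"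
    have a: "ascent q p" "ascent r q" "ascent r p"
      using i(3) j(3) ascent_trans by (auto simp: p_def q_def r_def j')
    note sp = spec_move transpose_simps
    define y1 y2 y3 where "y1 = move i x" and "y2 = move (Suc i) y1" and "y3 = move i y2"
    define z1 z2 z3 where "z1 = move (Suc i) x" and "z2 = move i z1" and "z3 = move (Suc i) z2"
    have y1: "y1 \<in> S" "spec y1 i = q" "spec y1 (Suc i) = p" "spec y1 (Suc (Suc i)) = r"
      using S(2)[OF x, of i] vx i(1) j' a by (auto simp: y1_def sp p_def q_def r_def)
    have y2: "y2 \<in> S" "spec y2 i = q" "spec y2 (Suc i) = r" "spec y2 (Suc (Suc i)) = p"
      using S(2)[OF y1(1), of "Suc i"] S(1)[OF y1(1)] i(1) j' a y1 by (auto simp: y2_def sp)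
    have y3: "y3 \<in> S"
      using S(2)[OF y2(1), of i] i(1) j' a y2 by (auto simp: y3_def)
    have z1: "z1 \<in> S" "spec z1 i = p" "spec z1 (Suc i) = r" "spec z1 (Suc (Suc i)) = q"
      using S(2)[OF x, of "Suc i"] vx i(1) j' a by (auto simp: z1_def sp p_def q_def r_def)
    have z2: "z2 \<in> S" "spec z2 i = r" "spec z2 (Suc i) = p" "spec z2 (Suc (Suc i)) = q"
      using S(2)[OF z1(1), of i] S(1)[OF z1(1)] i(1) j' a z1 by (auto simp: z2_def sp)
    have z3: "z3 \<in> S"
      using S(2)[OF z2(1), of "Suc i"] i(1) j' a z2 by (auto simp: z3_def)
    have "y3 = z3"
    proof (rule spec_inj)
      fix k assume k: "1 \<le> k" "k \<le> N"
      let ?s = "transpose i (Suc i)" and ?t = "transpose (Suc i) (Suc (Suc i))"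
      have b: "1 \<le> ?s l \<and> ?s l \<le> N" "1 \<le> ?t l \<and> ?t l \<le> N" if "1 \<le> l" "l \<le> N" for l
        using that i(1) j' by (auto simp: transpose_def)
      have "spec y3 k = spec x (?s (?t (?s k)))"
        using k b S(1)[OF y1(1)] S(1)[OF y2(1)] vx i(1) j' by (simp add: y3_def y2_def y1_def spec_move)
      moreover have "spec z3 k = spec x (?t (?s (?t k)))"
        using k b S(1)[OF z1(1)] S(1)[OF z2(1)] vx i(1) j' by (simp add: z3_def z2_def z1_def spec_move)
      moreover have "?s (?t (?s k)) = ?t (?s (?t k))" by (simp add: transpose_def)
      ultimately show "spec y3 k = spec z3 k" by simp
    qed (use S(1) y3 z3 in auto)
    obtain m0 where m0: "R y3 m0" using ex[OF y3] by blast
    let ?a = "spec_diff p q" and ?b = "spec_diff q r"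
      and ?c = "spec_diff p r"
    have "R y2 (W i ?b m0)" using edge[OF y2(1), of i m0] m0 i(1) j' a y2 by (simp add: y3_def)
    then have "R y1 (W (Suc i) ?c (W i ?b m0))"
      using edge[OF y1(1), of "Suc i"] i(1) j' a y1 by (simp add: y2_def)
    then have m: "m = W (Suc i) ?c (W i ?b m0)"
      using uniq[OF y1(1)] lower[OF i(1-3)] i(4) by (simp add: y1_def)
    have "R z2 (W (Suc i) ?a m0)"
      using edge[OF z2(1), of "Suc i" m0] m0 i(1) j' a z2 \<open>y3 = z3\<close> by (simp add: z3_def)
    then have "R z1 (W i ?c (W (Suc i) ?a m0))"
      using edge[OF z1(1), of i] i(1) j' a z1 by (simp add: z2_def)
    then have m': "m' = W i ?c (W (Suc i) ?a m0)"
      using uniq[OF z1(1)] lower[OF j(1-3)] j(4) by (simp add: z1_def j')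
    have "?a \<noteq> 0" "?b \<noteq> 0" "?a + ?b \<noteq> 0"
      using a ascent_spectral_value_diff[of _ _ 0] by auto
    then have "W i ?a (W (Suc i) (?a + ?b) (W i ?b m0)) = W (Suc i) ?b (W i (?a + ?b) (W (Suc i) ?a m0))"
      by (rule braid[OF m0 i(1) j'(2)])
    then show ?thesis unfolding m m' by (simp add: j' p_def q_def r_def)
  qed
  consider "i < j" | "j < i" | "i = j" by linarith
  then show ?thesis
  proof cases
    case 3
    then have "m = m'" using uniq[OF S(2)[OF x], of i m m'] lower i j by auto
    then show ?thesis using 3 by simp
  qed (use *[OF i j] *[OF j i] in auto)
qed

section \<open>Affine edges and the root\<close>

lemma shift_inj:
  assumes "valid x" "valid y" "shift x = shift y"
  shows "x = y"
proof -
  have "snd x \<noteq> []" "snd y \<noteq> []" using assms by (simp_all add: valid_nonempty)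
  then show ?thesis using assms(3)
    by (auto simp: shift_def affine_shift_def prod_eq_iff intro: list.expand)
qed

lemma exists_unshift:
  assumes "valid x" "entry (snd x) N \<noteq> 0"
  obtains y where "valid y" "x = shift y"
proof -
  let ?v = "snd x"
  have len: "length ?v = N" using assms by (simp add: valid_def)
  have ne: "?v \<noteq> []" using assms(1) by (rule valid_nonempty)
  then have "last ?v \<noteq> 0" using assms(2) len by (simp add: last_conv_nth)
  then have "affine_shift ((last ?v - 1) # butlast ?v) = ?v"
    using ne by (simp add: affine_shift_def)
  moreover have "length ((last ?v - 1) # butlast ?v) = N"
    using len ne by (cases ?v rule: rev_cases) simp_all
  ultimately show thesis using that[of "(fst x, (last ?v - 1) # butlast ?v)"] assms(1)
    by (simp add: valid_def shift_def prod_eq_iff)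
qed

lemma exists_entry_descent:
  assumes "length v = N" "v \<noteq> replicate N 0" "entry v N = 0"
  obtains i where "1 \<le> i" "i < N" "entry v (Suc i) < entry v i"
proof -
  have "\<exists>k<N. v ! k \<noteq> 0"
  proof (rule ccontr)
    assume "\<not> (\<exists>k<N. v ! k \<noteq> 0)"
    then have "v = replicate N 0" by (intro nth_equalityI) (use assms(1) in auto)
    then show False using assms(2) by simp
  qed
  then obtain k where k: "k < N" "v ! k \<noteq> 0" by blast
  \<comment> \<open>The last nonzero entry, counted from 0; as a position it is
    \<open>Suc i\<close>.\<close>
  define i where "i = Max {k. k < N \<and> v ! k \<noteq> 0}"
  have "i \<in> {k. k < N \<and> v ! k \<noteq> 0}" unfolding i_def by (rule Max_in) (use k in auto)
  then have i: "i < N" "v ! i \<noteq> 0" by auto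
  have "Suc i \<noteq> N"
  proof
    assume "Suc i = N"
    then have "N - 1 = i" by (metis diff_Suc_1)
    then show False using assms(3) i by simp
  qed
  moreover have "v ! Suc i = 0" if "Suc i < N"
  proof (rule ccontr)
    assume "v ! Suc i \<noteq> 0"
    then have "Suc i \<le> Max {k. k < N \<and> v ! k \<noteq> 0}" using that by (intro Max_ge) auto
    then show False by (simp only: i_def[symmetric])
  qed
  ultimately show thesis using i that[of "Suc i"] by auto
qed

text \<open>A nonzero last entry makes the vertex the target of an affine edge; if it is zero and v
  is not, some entry is followed by a smaller one. Inductions along these cases leave the tableau
  untouched.\<close>

lemma entry_cases [consumes 1, case_names zero shift descent]:
  assumes "valid x" "snd x = replicate N 0 \<Longrightarrow> thesis"
    and "\<And>y. valid y \<Longrightarrow> x = shift y \<Longrightarrow> thesis"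
    and "\<And>i. 1 \<le> i \<Longrightarrow> i < N \<Longrightarrow> entry (snd x) (Suc i) < entry (snd x) i \<Longrightarrow> thesis"
  shows thesis
  using assms exists_unshift[of x] exists_entry_descent[of "snd x"] unfolding valid_def by metis

lemma rank_replicate:
  assumes "1 \<le> i" "i \<le> N"
  shows "rank (replicate N 0) i = i"
proof -
  have "{j \<in> {1..length (replicate N (0::nat))}. pos_less (replicate N 0) j i} = {1..<i}"
    using assms by (auto simp: pos_less_def)
  then show ?thesis using assms by (simp add: rank_eq)
qed

lemma spec_zero: "1 \<le> i \<Longrightarrow> i \<le> N \<Longrightarrow> spec (\<tau>, replicate N 0) i = (0, CT lam \<tau> i)"
  by (simp add: spec_def rank_replicate)

lemma valid_root: "valid (G_root lam)"
  by (simp add: valid_def G_root_def RST_root_tableau)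

text \<open>Away from v = 0 the vector already provides an edge; at v = 0 a tableau other than the
  root has a content difference of at most -2.\<close>

lemma incoming_edge:
  assumes "valid x" "x \<noteq> G_root lam"
  obtains y where "valid y" "x = shift y" | i where "1 \<le> i" "i < N" "ascent (spec x (Suc i)) (spec x i)"
  using assms(1)
proof (cases rule: entry_cases)
  case zero
  have "fst x \<noteq> root_tableau lam" using zero assms(2) by (auto simp: G_root_def prod_eq_iff)
  then obtain i where i: "1 \<le> i" "i < N" "CT lam (fst x) i - CT lam (fst x) (Suc i) \<le> - 2"
    using RST_no_descent_eq_root[of "fst x"] assms(1) by (auto simp: valid_def)
  have x: "x = (fst x, replicate N 0)" using zero by (simp add: prod_eq_iff)
  have "ascent (spec x (Suc i)) (spec x i)"
    using i by (subst (1 2) x) (simp add: spec_zero ascent_def)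
  then show thesis using that i by blast
next
  case (shift y)
  then show thesis using that by blast
next
  case (descent i)
  then show thesis using that(2)[of i] by (auto simp: spec_def ascent_def)
qed

lemma root_no_incoming: "1 \<le> i \<Longrightarrow> i < N \<Longrightarrow> \<not> ascent (spec (G_root lam) (Suc i)) (spec (G_root lam) i)"
  using root_tableau_no_descent[of i] by (auto simp: G_root_def spec_zero ascent_def)

lemma root_not_shift: "shift x \<noteq> G_root lam"
proof
  assume "shift x = G_root lam"
  then have "affine_shift (snd x) = replicate N 0" by (simp add: shift_def G_root_def)
  moreover have "N \<noteq> 0" using N_pos by (rule less_imp_neq[symmetric])
  ultimately have "last (affine_shift (snd x)) = 0" by (metis last_replicate)
  then show False by (simp add: affine_shift_def)
qed

section \<open>Path independence of J\<close>

definition J_weight :: "nat \<Rightarrow> ratfun \<Rightarrow> vpoly \<Rightarrow> vpoly" where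
  "J_weight i d P = intertwine i (1 / d) P"

lemma jack_rel_move:
  assumes "valid x" "jack_rel lam x P" "1 \<le> i" "i < N" "ascent (spec x i) (spec x (Suc i))"
  shows "jack_rel lam (move i x) (J_weight i (spec_diff (spec x (Suc i)) (spec x i)) P)"
  using jack_rel.simple[OF assms(2), of i "move i x"] assms
  by (simp add: G_edge_Simple_iff J_weight_def intertwine_def zeta_eq act_def)

lemma jack_rel_shift: "jack_rel lam x P \<Longrightarrow> jack_rel lam (shift x) (affine_op lam P)"
  using jack_rel.affine by (simp add: G_edge_Affine_iff)

lemma rst_poly_root: "rst_poly (single (root_tableau lam) 1)"
proof -
  have "cf u (single (root_tableau lam) 1) = smul (lookup 1 u) (basis_vec (root_tableau lam))" for u
    by (rule poly_mapping_eqI) (simp add: lookup_single when_def)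
  then show ?thesis
    by (simp add: rst_poly_def rst_span_smul rst_span_basis_vec RST_root_tableau)
qed

lemma jack_rel_valid:
  "jack_rel lam x P \<Longrightarrow> valid x \<and> rst_poly P \<and> x \<in> H_vertices lam"
proof (induction rule: jack_rel.induct)
  case root
  then show ?case using valid_root rst_poly_root G_vertices.root by (simp add: H_vertices_def)
next
  case (simple x P i y)
  then have "1 \<le> i" "i < N" "ascent (spec x i) (spec x (Suc i))" "y = move i x"
    using G_edge_Simple_iff[of x i y] by auto
  then show ?case
    using simple valid_move[of x i] G_vertices.edge[of x lam "Simple i" "Some y"]
    by (auto simp: rst_poly_add rst_poly_scale rst_poly_act act_def[symmetric] H_vertices_def)
next
  case (affine x P y)
  then show ?case
    using valid_shift[of x] G_vertices.edge[of x lam Affine "Some y"]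
    by (auto simp: G_edge_Affine_iff rst_poly_affine_op H_vertices_def)
qed

lemma jack_rel_exists: "valid x \<Longrightarrow> \<exists>P. jack_rel lam x P"
proof (induction x rule: wf_induct_rule[OF wf_below])
  case (1 x)
  show ?case
  proof (cases "x = G_root lam")
    case True
    then show ?thesis using jack_rel.root by blast
  next
    case False
    with \<open>valid x\<close> show ?thesis
    proof (cases rule: incoming_edge)
      case (1 y)
      then show ?thesis using "1.IH"[of y] below_shift jack_rel_shift by blast
    next
      case (2 i)
      then have s: "swappable i x" by simp
      have y: "valid (move i x)" "move i (move i x) = x"
        using valid_move[OF \<open>valid x\<close> s] move_move[OF \<open>valid x\<close> s] .
      have a: "ascent (spec (move i x) i) (spec (move i x) (Suc i))"
        using 2 \<open>valid x\<close> by (simp add: spec_move transpose_simps)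
      obtain P where "jack_rel lam (move i x) P"
        using "1.IH"[of "move i x"] below_move[OF y(1) 2(1,2) a] y by auto
      then show ?thesis using jack_rel_move[OF y(1) _ 2(1,2) a] y(2) by auto
    qed
  qed
qed

text \<open>Going back along incoming edges terminates and can only end at the root, so reachability
  reduces to the directly checkable \<open>valid\<close>.\<close>

lemma H_vertices_eq: "x \<in> H_vertices lam \<longleftrightarrow> valid x"
proof
  have "case z of Some x \<Rightarrow> valid x | None \<Rightarrow> True" if "z \<in> G_vertices lam" for z
    using that
  proof induction
    case (edge x l y)
    then show ?case
      using G_edge_Simple_iff[of x] G_edge_Affine_iff[of x] valid_shift[of x] valid_move[of x]
      by (cases l; cases y) auto
  qed (auto simp: valid_root)
  then show "valid x" if "x \<in> H_vertices lam" using that by (force simp: H_vertices_def)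
  show "x \<in> H_vertices lam" if "valid x" using jack_rel_exists[OF that] jack_rel_valid by blast
qed

lemma jack_rel_cases:
  assumes "jack_rel lam x P"
  obtains (root) "x = G_root lam" "P = single (root_tableau lam) 1"
  | (move) i Q where "1 \<le> i" "i < N" "ascent (spec x (Suc i)) (spec x i)" "jack_rel lam (move i x) Q"
      "P = J_weight i (spec_diff (spec x i) (spec x (Suc i))) Q"
  | (shift) y Q where "valid y" "x = shift y" "jack_rel lam y Q" "P = affine_op lam Q"
  using assms
proof cases
  case root
  then show ?thesis using that(1) by simp
next
  case (simple y Q i)
  have y: "valid y" using jack_rel_valid simple by blast
  then have e: "1 \<le> i" "i < N" "ascent (spec y i) (spec y (Suc i))" "x = move i y"
    using G_edge_Simple_iff simple by auto
  then have sp: "spec x i = spec y (Suc i)" "spec x (Suc i) = spec y i" and b: "move i x = y"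
    using y move_move[OF y] by (simp_all add: spec_move transpose_simps)
  show ?thesis
    using that(2)[of i Q] e sp b simple by (simp add: J_weight_def intertwine_def zeta_eq act_def)
next
  case (affine y Q)
  then show ?thesis using that(3)[of y Q] jack_rel_valid by (auto simp: G_edge_Affine_iff)
qed

text \<open>An affine and a simple edge meet at \<open>shift y\<close>. For i + 1 < N one square
  suffices, with s_{i+1} on the other side. For i = N - 1 the edge s_i forces the last entry of y to
  exceed the first, so y is an affine target itself and the comparison takes place two affine steps
  below, with s_1.\<close>

lemma jack_rel_move_shift:
  assumes y: "valid y" "jack_rel lam y P"
    and i: "1 \<le> i" "i < N" "ascent (spec (shift y) (Suc i)) (spec (shift y) i)" "jack_rel lam (move i (shift y)) Q"
    and uniq: "\<And>z R R'. (z, shift y) \<in> below \<Longrightarrow> jack_rel lam z R \<Longrightarrow> jack_rel lam z R' \<Longrightarrow> R = R'"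
  shows "affine_op lam P
    = J_weight i (spec_diff (spec (shift y) i) (spec (shift y) (Suc i))) Q"
proof -
  let ?x = "shift y"
  have vx: "valid ?x" using valid_shift[OF y(1)] .
  have s: "swappable i ?x" using i by simp
  have vm: "valid (move i ?x)" using valid_move[OF vx s] .
  have "ascent (spec (move i ?x) i) (spec (move i ?x) (Suc i))"
    using i vx by (simp add: spec_move transpose_simps)
  then have lower: "(move i ?x, ?x) \<in> below"
    using below_move[OF vm i(1,2)] move_move[OF vx s] by simp
  show ?thesis
  proof (cases "Suc i < N")
    case True
    have sp: "spec ?x i = spec y (Suc i)" "spec ?x (Suc i) = spec y (Suc (Suc i))"
      using spec_shift[OF y(1)] i True by simp_all
    have sy: "swappable (Suc i) y" using i True sp by simp
    define w where "w = move (Suc i) y"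
    have w: "valid w" "move (Suc i) w = y"
      using valid_move[OF y(1) sy] move_move[OF y(1) sy] by (simp_all add: w_def)
    have spw: "spec w (Suc i) = spec y (Suc (Suc i))" "spec w (Suc (Suc i)) = spec y (Suc i)"
      using y(1) i True by (simp_all add: w_def spec_move transpose_simps)
    have sw: "shift w = move i ?x"
    proof (rule spec_inj[OF valid_shift[OF w(1)] vm])
      fix k assume "1 \<le> k" "k \<le> N"
      then show "spec (shift w) k = spec (move i ?x) k"
        using y(1) vx w(1) i True
        by (simp add: spec_shift spec_move w_def) (auto simp: transpose_def spec_shift)
    qed
    obtain R where R: "jack_rel lam w R" using jack_rel_exists[OF w(1)] by blast
    let ?d = "spec_diff (spec ?x i) (spec ?x (Suc i))"
    have "jack_rel lam y (J_weight (Suc i) ?d R)"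
      using jack_rel_move[OF w(1) R, of "Suc i"] True w(2) spw sp i by simp
    then have P: "P = J_weight (Suc i) ?d R" using uniq y below_shift[OF y(1)] by blast
    have Q: "Q = affine_op lam R" using uniq[OF lower i(4)] jack_rel_shift[OF R] sw by simp
    show ?thesis
      using jack_rel_valid[OF R] i True by (simp add: P Q J_weight_def intertwine_affine_op)
  next
    case False
    then have N: "N = Suc i" using i by simp
    have sp: "spec ?x i = spec y (Suc i)" "spec ?x (Suc i) = (fst (spec y 1) + 1, snd (spec y 1))"
      using spec_shift[OF y(1)] i N by simp_all
    then have "fst (spec y N) \<noteq> 0" using i(3) N by (auto simp: ascent_def)
    then obtain z where z: "valid z" "y = shift z"
      using exists_unshift[OF y(1)] by (auto simp: spec_def)
    have spz: "spec y (Suc i) = (fst (spec z 1) + 1, snd (spec z 1))" "spec y 1 = spec z 2"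
      using spec_shift[OF z(1)] N i z(2) by (simp_all add: numeral_2_eq_2)
    have a: "ascent (spec z 2) (spec z 1)"
      using i(3) unfolding sp spz by (simp add: ascent_def)
    have sz: "swappable 1 z" using a i N by (simp add: numeral_2_eq_2)
    define w where "w = move 1 z"
    have w: "valid w" "move 1 w = z"
      using valid_move[OF z(1) sz] move_move[OF z(1) sz] by (simp_all add: w_def)
    have spw: "spec w 1 = spec z 2" "spec w 2 = spec z 1"
      using z(1) i N transpose_simps[of 1] by (simp_all add: w_def spec_move numeral_2_eq_2)
    have sw: "shift (shift w) = move i ?x"
    proof (rule spec_inj[OF valid_shift[OF valid_shift[OF w(1)]] vm])
      fix k assume k: "1 \<le> k" "k \<le> N"
      have vz: "valid (shift z)" using valid_shift[OF z(1)] .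
      consider "k = N" | "Suc k = N" | "Suc (Suc k) \<le> N" using k by linarith
      then show "spec (shift (shift w)) k = spec (move i ?x) k"
      proof cases
        case 1
        then show ?thesis
          using k i N vx y(1) w(1) z spw sp spz valid_shift[OF w(1)]
          by (simp add: spec_shift spec_move transpose_simps numeral_2_eq_2)
      next
        case 2
        then have "k = i" using N by simp
        then show ?thesis
          using k i N vx y(1) w(1) z spw sp spz valid_shift[OF w(1)]
          by (simp add: spec_shift spec_move transpose_simps numeral_2_eq_2)
      next
        case 3
        have "spec w (Suc (Suc k)) = spec z (Suc (Suc k))"
          using 3 z(1) i N k transpose_simps(3)[of "Suc (Suc k)" 1] by (simp add: w_def spec_move)
        then show ?thesis
          using 3 k i N vx y(1) w(1) z valid_shift[OF w(1)]
          by (simp add: spec_shift spec_move transpose_simps)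
      qed
    qed
    obtain R where R: "jack_rel lam w R" using jack_rel_exists[OF w(1)] by blast
    let ?d = "spec_diff (spec ?x i) (spec ?x (Suc i))"
    \<comment> \<open>Two affine steps add \<alpha> to both values and leave the difference
      unchanged.\<close>
    have d: "?d = spec_diff (spec z 1) (spec z 2)"
      unfolding sp spz by (simp add: spectral_value_def algebra_simps)
    have "jack_rel lam z (J_weight 1 ?d R)"
      using jack_rel_move[OF w(1) R, of 1] w(2) spw d i N a by (simp add: numeral_2_eq_2)
    then have "jack_rel lam y (affine_op lam (J_weight 1 ?d R))"
      using jack_rel_shift z(2) by blast
    then have P: "P = affine_op lam (J_weight 1 ?d R)" using uniq y below_shift[OF y(1)] by blast
    have Q: "Q = affine_op lam (affine_op lam R)"
      using uniq[OF lower i(4)] jack_rel_shift[OF jack_rel_shift[OF R]] sw by simp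
    have i': "i = N - 1" "2 \<le> N" using N i by auto
    have "J_weight i ?d Q = affine_op lam P"
      unfolding P Q J_weight_def i'(1)
      by (rule intertwine_affine_op_affine_op) (use jack_rel_valid[OF R] i' in auto)
    then show ?thesis by simp
  qed
qed

lemma jack_rel_unique: "jack_rel lam x P \<Longrightarrow> jack_rel lam x Q \<Longrightarrow> P = Q"
proof (induction x arbitrary: P Q rule: wf_induct_rule[OF wf_below])
  case (1 x)
  note IH = "1.IH"
  have vx: "valid x" using jack_rel_valid 1 by blast
  have MM: "J_weight i (spec_diff (spec x i) (spec x (Suc i))) P
      = J_weight j (spec_diff (spec x j) (spec x (Suc j))) Q"
    if "1 \<le> i" "i < N" "ascent (spec x (Suc i)) (spec x i)" "jack_rel lam (move i x) P"
      "1 \<le> j" "j < N" "ascent (spec x (Suc j)) (spec x j)" "jack_rel lam (move j x) Q" for i j P Q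
  proof (rule diamond[where R = "jack_rel lam" and S = "Collect valid" and W = J_weight and x = x])
    fix y m k c d
    assume *: "jack_rel lam y m" "1 \<le> k" "Suc k < N" "c \<noteq> 0" "d \<noteq> 0" "c + d \<noteq> (0 :: ratfun)"
    \<comment> \<open>The hypothesis of the Yang-Baxter relation for reciprocals of additive
      parameters.\<close>
    then have "1 / c * (1 / d) = 1 / (c + d) * (1 / c + 1 / d)" by (simp add: field_simps)
    then show "J_weight k c (J_weight (Suc k) (c + d) (J_weight k d m))
        = J_weight (Suc k) d (J_weight k (c + d) (J_weight (Suc k) c m))"
      unfolding J_weight_def using * jack_rel_valid by (intro yang_baxter) auto
  qed (use that vx IH in \<open>auto simp: valid_move jack_rel_exists J_weight_def
         intro: jack_rel_move[unfolded J_weight_def] intertwine_comm dest: jack_rel_valid\<close>)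
  from 1(2) show ?case
  proof (cases rule: jack_rel_cases)
    case root
    from 1(3) show ?thesis
      by (cases rule: jack_rel_cases) (use root root_no_incoming root_not_shift in auto)
  next
    case (move i P')
    note m = move
    from 1(3) show ?thesis
    proof (cases rule: jack_rel_cases)
      case root
      then show ?thesis using m root_no_incoming by auto
    next
      case (move j Q')
      then show ?thesis using MM[OF m(1-4) move(1-4)] m(5) by simp
    next
      case (shift y Q')
      then show ?thesis using jack_rel_move_shift[of y Q' i P'] m IH by auto
    qed
  next
    case (shift y P')
    note s = shift
    from 1(3) show ?thesis
    proof (cases rule: jack_rel_cases)
      case root
      then show ?thesis using s root_not_shift by auto
    next
      case (move j Q')
      then show ?thesis using jack_rel_move_shift[of y P' j Q'] s IH by auto
    next
      case (shift z Q')
      then have "z = y" using s shift_inj by auto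
      then have "P' = Q'" using IH[of y P' Q'] s shift below_shift by auto
      then show ?thesis using s shift by simp
    qed
  qed
qed

lemma jack_rel_jack: "valid x \<Longrightarrow> jack_rel lam x (jack lam x)"
  unfolding jack_def using jack_rel_exists jack_rel_unique by (metis theI)

lemma jack_eq: "jack_rel lam x P \<Longrightarrow> jack lam x = P"
  using jack_rel_jack jack_rel_unique jack_rel_valid by blast

lemma rst_poly_jack: "valid x \<Longrightarrow> rst_poly (jack lam x)"
  using jack_rel_jack jack_rel_valid by blast

lemma jack_root: "jack lam (G_root lam) = single (root_tableau lam) 1"
  by (rule jack_eq) (rule jack_rel.root)

lemma jack_move:
  assumes "valid x" "1 \<le> i" "i < N" "ascent (spec x i) (spec x (Suc i))"
  shows "jack lam (move i x)
    = intertwine i (1 / (spec_diff (spec x (Suc i)) (spec x i))) (jack lam x)"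
  using jack_eq[OF jack_rel_move[OF assms(1) jack_rel_jack[OF assms(1)] assms(2-4)]]
  by (simp add: J_weight_def)

lemma jack_shift: "valid x \<Longrightarrow> jack lam (shift x) = affine_op lam (jack lam x)"
  by (rule jack_eq) (intro jack_rel_shift jack_rel_jack)

end

section \<open>Edges into the sink\<close>

context shape
begin

lemma trans_below: "trans below"
  unfolding below_def by (intro trans_inv_image trans_lex_prod trans_less_than)

lemma incoming_move:
  assumes "valid x" "1 \<le> i" "i < N" "ascent (spec x (Suc i)) (spec x i)"
  shows "valid (move i x)" "(move i x, x) \<in> below"
    "jack lam x = intertwine i (1 / (spec_diff (spec x i) (spec x (Suc i)))) (jack lam (move i x))"
proof -
  have s: "swappable i x" using assms by simp
  show v: "valid (move i x)" using valid_move[OF assms(1) s] .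
  have sp: "spec (move i x) i = spec x (Suc i)" "spec (move i x) (Suc i) = spec x i"
    using assms by (simp_all add: spec_move transpose_simps)
  then have a: "ascent (spec (move i x) i) (spec (move i x) (Suc i))" using assms by simp
  show "(move i x, x) \<in> below"
    using below_move[OF v assms(2,3) a] move_move[OF assms(1) s] by simp
  show "jack lam x = intertwine i (1 / (spec_diff (spec x i) (spec x (Suc i)))) (jack lam (move i x))"
    using jack_move[OF v assms(2,3) a] move_move[OF assms(1) s] sp by simp
qed

abbreviation unit_vpoly :: "tableau \<Rightarrow> vpoly" where
  "unit_vpoly \<tau> \<equiv> single \<tau> 1"

lemma cf_unit_vpoly: "cf u (unit_vpoly \<tau>) = (if u = 0 then basis_vec \<tau> else 0)"
  by (rule poly_mapping_eqI) (auto simp: lookup_single lookup_one when_def)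

lemma act_unit_vpoly:
  assumes "CT lam \<tau> i = a" "CT lam \<tau> (Suc i) = b" "a \<noteq> b"
  shows "act lam i (unit_vpoly \<tau>)
    = scale (on_diag (a - b)) (unit_vpoly \<tau>) + scale (off_diag (a - b)) (unit_vpoly (interchange i \<tau>))"
proof (rule vpoly_eqI)
  fix u
  have "exp_s i 0 = 0" by (rule poly_mapping_eqI) simp
  then have "exp_s i u = 0 \<longleftrightarrow> u = 0" by (metis exp_s_exp_s)
  then show "cf u (act lam i (unit_vpoly \<tau>)) = cf u (scale (on_diag (a - b)) (unit_vpoly \<tau>)
      + scale (off_diag (a - b)) (unit_vpoly (interchange i \<tau>)))"
    using vec_s_basis_vec_eq[OF assms]
    by (simp add: cf_act cf_unit_vpoly cf_add cf_scale module_hom.zero[OF vec_linear_vec_s])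
qed

text \<open>The constant of the intertwiner cancels the diagonal coefficient of s_i, and in the
  direction of the edges the off-diagonal coefficient is 1. The normalization of the action on
  tableaux thus makes each J at v = 0 a bare basis vector.\<close>

lemma jack_zero: "RST lam \<tau> \<Longrightarrow> jack lam (\<tau>, replicate N 0) = unit_vpoly \<tau>"
proof (induction "(\<tau>, replicate N (0 :: nat))" arbitrary: \<tau> rule: wf_induct_rule[OF wf_below])
  case 1
  let ?x = "(\<tau>, replicate N (0 :: nat))"
  have vx: "valid ?x" using 1(2) by (simp add: valid_def)
  show ?case
  proof (cases "\<tau> = root_tableau lam")
    case True
    then show ?thesis using jack_root by (simp add: G_root_def)
  next
    case False
    then obtain i where i: "1 \<le> i" "i < N" "CT lam \<tau> i - CT lam \<tau> (Suc i) \<le> - 2"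
      using RST_no_descent_eq_root[OF 1(2)] by blast
    define a b where "a = CT lam \<tau> i" and "b = CT lam \<tau> (Suc i)"
    have sp: "spec ?x i = (0, a)" "spec ?x (Suc i) = (0, b)"
      using i by (simp_all add: spec_zero a_def b_def)
    have asc: "ascent (spec ?x (Suc i)) (spec ?x i)" using i by (simp add: sp ascent_def a_def b_def)
    have m: "move i ?x = (interchange i \<tau>, replicate N 0)"
      using i by (simp add: move_def rank_replicate)
    note y = incoming_move[OF vx i(1,2) asc, unfolded m]
    have R: "RST lam (interchange i \<tau>)" using y(1) by (simp add: valid_def)
    have J: "jack lam (interchange i \<tau>, replicate N 0) = unit_vpoly (interchange i \<tau>)"
      using 1(1)[OF y(2) R] .
    have l: "labelling \<tau>" using RST_labelling[OF 1(2)] .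
    have "CT lam (interchange i \<tau>) i = b" "CT lam (interchange i \<tau>) (Suc i) = a" "b \<noteq> a"
      using i by (auto simp: CT_interchange[OF l] transpose_simps a_def b_def)
    note act = act_unit_vpoly[OF this]
    have "off_diag (b - a) = 1" using i by (simp add: off_diag_def a_def b_def)
    moreover have "1 / (spec_diff (0, a) (0, b)) = - on_diag (b - a)"
      using on_diag_minus[of "b - a"] by (simp add: spectral_value_def on_diag_def)
    ultimately show ?thesis
      unfolding y(3) J sp intertwine_def act by simp
  qed
qed

text \<open>The induction only follows affine edges and edges changing the vector \<open>v\<close>, because an incoming
  tableau edge need not be compatible with the tie.\<close>

lemma act_jack_tie:
  assumes "valid x" "1 \<le> i" "i < N" "fst (spec x i) = fst (spec x (Suc i))"
    "snd (spec x i) - snd (spec x (Suc i)) = \<epsilon>" "\<epsilon> = 1 \<or> \<epsilon> = - 1"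
  shows "act lam i (jack lam x) = scale (of_int \<epsilon>) (jack lam x)"
  using assms(1-5)
proof (induction x arbitrary: i rule: wf_induct_rule[OF wf_below])
  case (1 x)
  note IH = "1.IH" and vx = "1.prems"(1) and i = "1.prems"(2,3) and tie = "1.prems"(4,5)
  have e2: "of_int \<epsilon> * of_int \<epsilon> = (1 :: ratfun)" using assms(6) by auto
  have de: "spec_diff (spec x i) (spec x (Suc i)) = of_int \<epsilon>"
    using tie by (simp add: spectral_value_diff_eq_iff)
  from vx show ?case
  proof (cases rule: entry_cases)
    case zero
    then have x: "x = (fst x, replicate N 0)" by (simp add: prod_eq_iff)
    define \<tau> where "\<tau> = fst x"
    have R: "RST lam \<tau>" using vx by (simp add: valid_def \<tau>_def)
    have d: "CT lam \<tau> i - CT lam \<tau> (Suc i) = \<epsilon>"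
      using tie(2) i by (subst (asm) (1 2) x) (simp add: spec_zero \<tau>_def)
    then have ne: "CT lam \<tau> i \<noteq> CT lam \<tau> (Suc i)" using assms(6) by auto
    have "on_diag \<epsilon> = of_int \<epsilon>" "off_diag \<epsilon> = 0" using assms(6) by (auto simp: on_diag_def)
    then have "act lam i (unit_vpoly \<tau>) = scale (of_int \<epsilon>) (unit_vpoly \<tau>)"
      using act_unit_vpoly[OF refl refl ne] d by simp
    then show ?thesis using jack_zero[OF R] x by (simp add: \<tau>_def)
  next
    case (shift y)
    note y = shift
    have rs: "rst_poly (jack lam y)" using rst_poly_jack[OF y(1)] .
    show ?thesis
    proof (cases "Suc i < N")
      case True
      have "spec x i = spec y (Suc i)" "spec x (Suc i) = spec y (Suc (Suc i))"
        using y i True by (simp_all add: spec_shift)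
      then have "act lam (Suc i) (jack lam y) = scale (of_int \<epsilon>) (jack lam y)"
        using IH[of y "Suc i"] y below_shift[OF y(1)] True tie by simp
      then show ?thesis
        using y jack_shift[OF y(1)] act_affine_op[OF rs i(1) True] by (simp add: affine_op_scale)
    next
      case False
      then have N: "N = Suc i" using i by simp
      have sp: "spec x i = spec y (Suc i)" "spec x (Suc i) = (fst (spec y 1) + 1, snd (spec y 1))"
        using spec_shift[OF y(1)] i N y(2) by simp_all
      \<comment> \<open>By the tie the last entry of y is its first entry plus 1, so y is itself an
        affine target, and the tied pair sits at positions 1 and 2 of its source.\<close>
      then have "entry (snd y) N \<noteq> 0" using tie(1) N by (auto simp: spec_def)
      then obtain z where z: "valid z" "y = shift z" using exists_unshift[OF y(1)] by blast
      have spz: "spec y (Suc i) = (fst (spec z 1) + 1, snd (spec z 1))" "spec y 1 = spec z 2"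
        using spec_shift[OF z(1)] N i z(2) by (simp_all add: numeral_2_eq_2)
      have "(z, x) \<in> below"
        using below_shift[OF z(1)] below_shift[OF y(1)] y(2) z(2) transD[OF trans_below] by blast
      then have "act lam 1 (jack lam z) = scale (of_int \<epsilon>) (jack lam z)"
        using IH[of z 1] z(1) tie i N unfolding sp spz by (simp add: numeral_2_eq_2)
      moreover have "act lam (N - 1) (affine_op lam (affine_op lam (jack lam z)))
          = affine_op lam (affine_op lam (act lam 1 (jack lam z)))"
        using act_affine_op_affine_op[OF rst_poly_jack[OF z(1)]] i N by simp
      moreover have "N - 1 = i" using N by simp
      ultimately show ?thesis
        using jack_shift[OF y(1)] jack_shift[OF z(1)] y(2) z(2) by (simp add: affine_op_scale)
    qed
  next
    case (descent j)
    have a: "ascent (spec x (Suc j)) (spec x j)" using descent by (simp add: ascent_def spec_def)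
    note y = incoming_move[OF vx descent(1,2) a]
    define y where "y = move j x"
    note y = y[folded y_def]
    have ji: "j \<noteq> i" using descent tie by (auto simp: spec_def)
    consider "Suc i < j \<or> Suc j < i" | "j = Suc i" | "i = Suc j" using ji by linarith
    then show ?thesis
    proof cases
      case 1
      have "spec y i = spec x i" "spec y (Suc i) = spec x (Suc i)"
        using vx i descent 1 by (auto simp: y_def spec_move transpose_simps)
      then have "act lam i (jack lam y) = scale (of_int \<epsilon>) (jack lam y)"
        using IH[OF y(2,1) i] tie by simp
      moreover have "act lam i (act lam j (jack lam y)) = act lam j (act lam i (jack lam y))"
        using act_comm[OF rst_poly_jack[OF y(1)]] 1 i descent(1,2) by metis
      ultimately show ?thesis unfolding y(3) intertwine_def
        by (simp add: act.add act.scale vpoly.scale_right_distrib mult.commute)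
    next
      case 2
      \<comment> \<open>The tied pair p, p' is followed by the smaller q. Moving q left past both
        gives w with the pair at i+1, i+2; the eigenvalue equation known there is carried back over
        the two intertwiners.\<close>
      define p p' q where "p = spec x i" and "p' = spec x (Suc i)" and "q = spec x (Suc (Suc i))"
      have asc: "ascent q p" "ascent q p'" using descent 2 tie
        by (auto simp: ascent_def spec_def p_def q_def p'_def)
      have spy: "spec y i = p" "spec y (Suc i) = q" "spec y (Suc (Suc i)) = p'"
        using vx i descent 2 by (simp_all add: y_def spec_move transpose_simps p_def p'_def q_def)
      note w = incoming_move[OF y(1) i, unfolded spy, OF asc(1)]
      define w where "w = move i y"
      note w = w[folded w_def]
      have spw: "spec w (Suc i) = p" "spec w (Suc (Suc i)) = p'"
        using y(1) i descent 2 spy by (simp_all add: w_def spec_move transpose_simps)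
      have "(w, x) \<in> below" using w(2) y(2) transD[OF trans_below] by blast
      then have W: "act lam (Suc i) (jack lam w) = scale (of_int \<epsilon>) (jack lam w)"
        using IH[of w "Suc i"] w(1) tie descent 2 spw by (simp add: p_def p'_def)
      let ?m = "1 / (spec_diff p q)" and ?n = "1 / (spec_diff p' q)"
      have nz: "spec_diff p q \<noteq> 0" "spec_diff p' q \<noteq> 0"
        using asc ascent_spectral_value_diff[of _ _ 0] by auto
      have "?n - ?m
          = (spec_diff p p') / ((spec_diff p q) * (spec_diff p' q))"
        using nz by (simp add: diff_frac_eq mult.commute)
      \<comment> \<open>The tie enters here: the spectral values of p and p' differ by
        \<epsilon>.\<close>
      then have nm: "?n - ?m
          = of_int \<epsilon> * ?m * ?n"
        using de by (simp add: p_def p'_def)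
      have "act lam i (intertwine (Suc i) ?n
            (intertwine i ?m (jack lam w)))
          = scale (of_int \<epsilon>) (intertwine (Suc i) ?n
            (intertwine i ?m (jack lam w)))"
        by (rule intertwine_eigenvector[OF rst_poly_jack[OF w(1)] _ _ i _ W e2 nm])
           (use descent 2 act_braid[OF rst_poly_jack[OF w(1)] i(1)] in auto)
      then show ?thesis using y(3) w(3) 2 by (simp add: p'_def q_def)
    next
      case 3
      \<comment> \<open>The mirror situation: the larger q precedes the pair and is moved right past
        both.\<close>
      define q p p' where "q = spec x j" and "p = spec x (Suc j)" and "p' = spec x (Suc (Suc j))"
      have asc: "ascent p q" "ascent p' q" using descent 3 tie
        by (auto simp: ascent_def spec_def p_def q_def p'_def)
      have spy: "spec y j = p" "spec y i = q" "spec y (Suc i) = p'"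
        using vx i descent 3 by (simp_all add: y_def spec_move transpose_simps p_def p'_def q_def)
      note w = incoming_move[OF y(1) i, unfolded spy, OF asc(2)]
      define w where "w = move i y"
      note w = w[folded w_def]
      have spw: "spec w j = p" "spec w (Suc j) = p'"
        using y(1) i descent 3 spy by (simp_all add: w_def spec_move transpose_simps)
      have "(w, x) \<in> below" using w(2) y(2) transD[OF trans_below] by blast
      then have W: "act lam j (jack lam w) = scale (of_int \<epsilon>) (jack lam w)"
        using IH[of w j] w(1) tie descent 3 spw by (simp add: p_def p'_def)
      let ?m = "1 / (spec_diff q p')" and ?n = "1 / (spec_diff q p)"
      have nz: "spec_diff q p \<noteq> 0" "spec_diff q p' \<noteq> 0"
        using asc ascent_spectral_value_diff[of _ _ 0] by auto
      have "?n - ?m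
          = (spec_diff p p') / ((spec_diff q p') * (spec_diff q p))"
        using nz by (simp add: diff_frac_eq mult.commute)
      then have nm: "?n - ?m
          = of_int \<epsilon> * ?m * ?n"
        using de 3 by (simp add: p_def p'_def)
      have "act lam i (intertwine j ?n
            (intertwine i ?m (jack lam w)))
          = scale (of_int \<epsilon>) (intertwine j ?n
            (intertwine i ?m (jack lam w)))"
        by (rule intertwine_eigenvector[OF rst_poly_jack[OF w(1)] descent(1,2) i _ W e2 nm])
           (use i 3 act_braid[OF rst_poly_jack[OF w(1)] descent(1)] in auto)
      then show ?thesis using y(3) w(3) by (simp add: p_def q_def)
    qed
  qed
qed

end

section \<open>Leading terms\<close>

text \<open>\<open>exp_length\<close> counts the simple transpositions in a shortest path from \<open>0\<close> to a vector, affine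
  steps being free.\<close>

definition pair_length :: "nat \<Rightarrow> nat \<Rightarrow> nat" where
  "pair_length a b = (if a < b then b - a - 1 else a - b)"

definition exp_length :: "nat \<Rightarrow> (nat \<Rightarrow> nat) \<Rightarrow> nat" where
  "exp_length n u = pair_sum n pair_length u"

lemma exp_length_cong: "(\<And>i. 1 \<le> i \<Longrightarrow> i \<le> n \<Longrightarrow> u i = u' i) \<Longrightarrow> exp_length n u = exp_length n u'"
  unfolding exp_length_def by (rule pair_sum_cong)

lemma exp_length_swap_le:
  assumes "1 \<le> k" "k < n"
  shows "exp_length n (\<lambda>i. u (transpose k (Suc k) i)) \<le> Suc (exp_length n u)"
  using pair_sum_swap[OF assms, of pair_length u]
  by (auto simp: exp_length_def pair_length_def split: if_splits)

lemma exp_length_swap: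
  assumes "1 \<le> k" "k < n" "u k < u (Suc k)"
  shows "exp_length n (\<lambda>i. u (transpose k (Suc k) i)) = Suc (exp_length n u)"
  using pair_sum_swap[OF assms(1,2), of pair_length u] assms(3)
  by (auto simp: exp_length_def pair_length_def split: if_splits)

text \<open>The reason for the -1 in \<open>pair_length\<close>: it gives (a, b) the same length as
  (b, a + 1), so each pair containing the first position keeps its length when that entry moves to
  the end and grows by 1.\<close>

lemma exp_length_rotate:
  assumes "\<And>j. 1 \<le> j \<Longrightarrow> j \<le> n \<Longrightarrow> u' j = (if j = n then u 1 + 1 else u (Suc j))"
  shows "exp_length n u' = exp_length n u"
  unfolding exp_length_def pair_sum_def
  by (rule sum.reindex_bij_witness[of _
        "\<lambda>(i, j). if i = 1 then (j - 1, n) else (i - 1, j - 1)"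
        "\<lambda>(i, j). if j = n then (1, Suc i) else (Suc i, Suc j)"])
     (auto simp: assms pair_length_def split: if_splits)

context shape
begin

definition expo :: "nat list \<Rightarrow> (nat \<Rightarrow>\<^sub>0 nat)" where
  "expo v = (\<Sum>i = 1..N. single i (entry v i))"

lemma lookup_expo: "lookup (expo v) i = (if 1 \<le> i \<and> i \<le> N then entry v i else 0)"
  by (auto simp: expo_def lookup_sum lookup_single when_def)

lemma exp_length_expo: "exp_length N (lookup (expo v)) = exp_length N (entry v)"
  by (rule exp_length_cong) (simp add: lookup_expo)

lemma exp_s_expo:
  assumes "length v = N" "1 \<le> i" "i < N"
  shows "exp_s i (expo v) = expo (swap_entries i v)"
proof (rule poly_mapping_eqI)
  fix k
  have "1 \<le> transpose i (Suc i) k \<and> transpose i (Suc i) k \<le> N \<longleftrightarrow> 1 \<le> k \<and> k \<le> N"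
    using assms by (auto simp: transpose_def)
  then show "lookup (exp_s i (expo v)) k = lookup (expo (swap_entries i v)) k"
    using assms by (simp add: lookup_expo entry_swap_entries)
qed

lemma word_perm_cycle: "word_perm [1..<N] j = (if j = 1 then N else if 1 < j \<and> j \<le> N then j - 1 else j)"
proof -
  have *: "word_perm [1..<Suc k] j = (if j = 1 then Suc k else if 1 < j \<and> j \<le> Suc k then j - 1 else j)" for k
  proof (induction k)
    case (Suc k)
    have "[1..<Suc (Suc k)] = [1..<Suc k] @ [Suc k]" by simp
    then have "word_perm [1..<Suc (Suc k)] j = transpose (Suc k) (Suc (Suc k)) (word_perm [1..<Suc k] j)"
      by (simp only: word_perm_append word_perm_Cons word_perm_Nil o_apply id_apply)
    then show ?case unfolding Suc by (auto simp: transpose_def)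
  qed simp
  obtain n where "N = Suc n" using N_pos gr0_implies_Suc by blast
  then show ?thesis using *[of n] by simp
qed

lemma lookup_fold_exp_s:
  "lookup (fold exp_s (rev w) u) j = lookup u (word_perm w j)"
  by (induction w arbitrary: j) (simp_all add: word_perm_Cons)

text \<open>The inverse of an affine step on exponents: x_N is divided out and the cycle undone.
  Truncated subtraction makes it meaningful only if the exponent of x_N is positive.\<close>

definition exp_unshift :: "(nat \<Rightarrow>\<^sub>0 nat) \<Rightarrow> (nat \<Rightarrow>\<^sub>0 nat)" where
  "exp_unshift u = fold exp_s (rev [1..<N]) (u - single N 1)"

lemma cf_affine_op:
  "cf u (affine_op lam P) = (if lookup u N = 0 then 0
     else fold (vec_s lam) [1..<N] (cf (exp_unshift u) P))"
  by (simp add: affine_op_def cf_X_mult cf_diag_op exp_unshift_def)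

lemma lookup_exp_unshift:
  "lookup (exp_unshift u) j
    = (if j = 1 then lookup u N - 1 else if 1 < j \<and> j \<le> N then lookup u (j - 1)
       else lookup u j)"
  unfolding exp_unshift_def lookup_fold_exp_s word_perm_cycle using N_pos
  by (auto simp: lookup_minus lookup_single when_def)

lemma exp_length_exp_unshift:
  assumes "lookup u N \<noteq> 0"
  shows "exp_length N (lookup u) = exp_length N (lookup (exp_unshift u))"
  by (rule exp_length_rotate) (use assms in \<open>auto simp: lookup_exp_unshift\<close>)

lemma expo_affine_shift:
  assumes "length v = N"
  shows "exp_unshift u = expo v \<and> lookup u N \<noteq> 0 \<longleftrightarrow> u = expo (affine_shift v)"
proof
  assume *: "exp_unshift u = expo v \<and> lookup u N \<noteq> 0"
  show "u = expo (affine_shift v)"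
  proof (rule poly_mapping_eqI)
    fix j
    have e: "lookup (exp_unshift u) k = lookup (expo v) k" for k using * by simp
    consider "j = N" | "1 \<le> j" "j < N" | "j = 0" | "N < j" by linarith
    then show "lookup u j = lookup (expo (affine_shift v)) j"
    proof cases
      case 1
      have "lookup u N - 1 = entry v 1"
        using e[of 1] N_pos unfolding lookup_exp_unshift lookup_expo by (simp add: Suc_le_eq)
      then have "lookup u N = Suc (entry v 1)" using * by linarith
      then show ?thesis using 1 N_pos assms by (simp add: lookup_expo entry_affine_shift)
    next
      case 2
      then show ?thesis using e[of "Suc j"] assms
        by (simp add: lookup_exp_unshift lookup_expo entry_affine_shift)
    next
      case 3
      then show ?thesis using e[of 0] by (simp add: lookup_exp_unshift lookup_expo)
    next
      case 4
      then show ?thesis using e[of j] N_pos by (auto simp: lookup_exp_unshift lookup_expo)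
    qed
  qed
next
  assume u: "u = expo (affine_shift v)"
  have "lookup (exp_unshift u) j = lookup (expo v) j" for j
    using assms N_pos entry_affine_shift[of "j - 1" v]
    by (auto simp: u lookup_exp_unshift lookup_expo entry_affine_shift)
  moreover have "lookup u N \<noteq> 0"
    using assms N_pos by (simp add: u lookup_expo entry_affine_shift)
  ultimately show "exp_unshift u = expo v \<and> lookup u N \<noteq> 0"
    by (auto intro: poly_mapping_eqI)
qed

lemma move_descent: "entry (snd x) (Suc i) < entry (snd x) i \<Longrightarrow> move i x = (fst x, swap_entries i (snd x))"
  by (simp add: move_def)

lemma exp_length_descent:
  assumes "length v = N" "1 \<le> i" "i < N" "entry v (Suc i) < entry v i"
  shows "exp_length N (entry v) = Suc (exp_length N (entry (swap_entries i v)))"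
proof -
  have "exp_length N (entry v) = exp_length N (\<lambda>k. entry (swap_entries i v) (transpose i (Suc i) k))"
  proof (rule exp_length_cong)
    fix k assume "1 \<le> k" "k \<le> N"
    moreover from this have "1 \<le> transpose i (Suc i) k" "transpose i (Suc i) k \<le> N"
      using assms by (auto simp: transpose_def)
    ultimately show "entry v k = entry (swap_entries i v) (transpose i (Suc i) k)"
      using assms by (simp add: entry_swap_entries)
  qed
  also have "\<dots> = Suc (exp_length N (entry (swap_entries i v)))"
    using assms entry_swap_entries[of i v i] entry_swap_entries[of i v "Suc i"]
    by (intro exp_length_swap) (simp_all add: transpose_simps)
  finally show ?thesis .
qed

text \<open>Affine steps preserve all lengths. An s_i step raises the length of v by exactly one,
  while exchanging two exponents in a term gains at most one; so no other term can catch up with the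
  leading one.\<close>

lemma jack_support:
  assumes "valid x" "cf u (jack lam x) \<noteq> 0"
  shows "u = expo (snd x) \<or> exp_length N (lookup u) < exp_length N (entry (snd x))"
  using assms
proof (induction x arbitrary: u rule: wf_induct_rule[OF wf_below])
  case (1 x)
  note IH = "1.IH" and vx = "1.prems"(1) and nz = "1.prems"(2)
  have len: "length (snd x) = N" using vx by (simp add: valid_def)
  from vx show ?case
  proof (cases rule: entry_cases)
    case zero
    then have x: "x = (fst x, replicate N 0)" by (simp add: prod_eq_iff)
    have "jack lam x = unit_vpoly (fst x)"
      using jack_zero[of "fst x"] vx x by (simp add: valid_def)
    then have "u = 0" using nz by (simp add: cf_unit_vpoly split: if_splits)
    moreover have "expo (snd x) = 0"
      by (rule poly_mapping_eqI) (auto simp: lookup_expo zero)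
    ultimately show ?thesis by simp
  next
    case (shift y)
    have ly: "length (snd y) = N" using shift by (simp add: valid_def)
    have *: "lookup u N \<noteq> 0" "cf (exp_unshift u) (jack lam y) \<noteq> 0"
      using nz jack_shift[OF shift(1)] shift(2) module_hom.zero[OF vec_linear_fold_vec_s]
      by (auto simp: cf_affine_op split: if_splits)
    have v: "snd x = affine_shift (snd y)" using shift by (simp add: shift_def)
    have "exp_length N (entry (snd x)) = exp_length N (entry (snd y))"
      by (rule exp_length_rotate) (use ly in \<open>simp add: v entry_affine_shift\<close>)
    then show ?thesis
      using IH[OF _ shift(1) *(2)] below_shift[OF shift(1)] shift(2) *(1)
        exp_length_exp_unshift[OF *(1)] expo_affine_shift[OF ly, of u] v by auto
  next
    case (descent i)
    have a: "ascent (spec x (Suc i)) (spec x i)" using descent by (simp add: ascent_def spec_def)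
    note y = incoming_move[OF vx descent(1,2) a]
    define v' where "v' = swap_entries i (snd x)"
    have sy: "snd (move i x) = v'" using move_descent[OF descent(3)] by (simp add: v'_def)
    have ev: "exp_s i (expo v') = expo (snd x)"
      using exp_s_expo[OF len descent(1,2)] by (metis exp_s_exp_s v'_def)
    have l: "exp_length N (entry (snd x)) = Suc (exp_length N (entry v'))"
      using exp_length_descent[OF len descent] by (simp add: v'_def)
    have "cf (exp_s i u) (jack lam (move i x)) \<noteq> 0 \<or> cf u (jack lam (move i x)) \<noteq> 0"
      using nz unfolding y(3) intertwine_def
      by (auto simp: cf_add cf_scale cf_act module_hom.zero[OF vec_linear_vec_s])
    then show ?thesis
    proof
      assume "cf (exp_s i u) (jack lam (move i x)) \<noteq> 0"
      then have "exp_s i u = expo v' \<or> exp_length N (lookup (exp_s i u)) < exp_length N (entry v')"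
        using IH[OF y(2,1)] sy by simp
      then show ?thesis
      proof
        assume "exp_s i u = expo v'"
        then show ?thesis using ev by (metis exp_s_exp_s)
      next
        assume "exp_length N (lookup (exp_s i u)) < exp_length N (entry v')"
        moreover have "exp_length N (\<lambda>k. lookup (exp_s i u) (transpose i (Suc i) k))
            \<le> Suc (exp_length N (lookup (exp_s i u)))"
          using exp_length_swap_le[OF descent(1,2)] .
        ultimately show ?thesis using l by simp
      qed
    next
      assume "cf u (jack lam (move i x)) \<noteq> 0"
      then have "u = expo v' \<or> exp_length N (lookup u) < exp_length N (entry v')"
        using IH[OF y(2,1)] sy by simp
      then show ?thesis using l exp_length_expo[of v'] by auto
    qed
  qed
qed

text \<open>The path to v through affine and vector edges depends on v alone, and along it the
  leading coefficient is only hit by the group elements s_i and \<theta>. One word therefore serves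
  all tableaux.\<close>

lemma jack_leading_coefficient:
  assumes "length v = N"
  shows "\<exists>w. set w \<subseteq> {1..<N} \<and>
    (\<forall>\<tau>. RST lam \<tau> \<longrightarrow> cf (expo v) (jack lam (\<tau>, v)) = fold (vec_s lam) w (basis_vec \<tau>))"
  using assms
\<comment> \<open>The well-founded order compares vertices, so the root tableau is attached to v as
  a fixed companion, while the claim covers every tableau.\<close>
proof (induction "(root_tableau lam, v)" arbitrary: v rule: wf_induct_rule[OF wf_below])
  case (1 v)
  have val: "valid (\<tau>, v)" if "RST lam \<tau>" for \<tau> using that 1(2) by (simp add: valid_def)
  let ?x = "(root_tableau lam, v)"
  from val[OF RST_root_tableau] show ?case
  proof (cases rule: entry_cases)
    case zero
    then have v: "v = replicate N 0" by simp
    have "expo v = 0" by (rule poly_mapping_eqI) (auto simp: lookup_expo v)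
    then show ?thesis
      by (intro exI[of _ "[]"]) (auto simp: v jack_zero cf_unit_vpoly)
  next
    case (shift y)
    define v' where "v' = snd y"
    have y: "y = (root_tableau lam, v')" "v = affine_shift v'" "length v' = N"
      using shift by (auto simp: shift_def v'_def valid_def prod_eq_iff)
    obtain w where w: "set w \<subseteq> {1..<N}"
        "\<And>\<tau>. RST lam \<tau> \<Longrightarrow> cf (expo v') (jack lam (\<tau>, v')) = fold (vec_s lam) w (basis_vec \<tau>)"
      using 1(1)[OF _ y(3)] below_shift[OF shift(1)] shift(2) y(1) by auto
    have "cf (expo v) (jack lam (\<tau>, v)) = fold (vec_s lam) (w @ [1..<N]) (basis_vec \<tau>)"
      if R: "RST lam \<tau>" for \<tau>
    proof -
      have vy: "valid (\<tau>, v')" using R y(3) by (simp add: valid_def)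
      have "(\<tau>, v) = shift (\<tau>, v')" by (simp add: shift_def y)
      then show ?thesis
        using jack_shift[OF vy] expo_affine_shift[OF y(3), of "expo v"] y(2) w(2)[OF R]
        by (simp add: cf_affine_op)
    qed
    then show ?thesis using w(1) by (intro exI[of _ "w @ [1..<N]"]) auto
  next
    case (descent i)
    define v' where "v' = swap_entries i v"
    have d: "entry v (Suc i) < entry v i" using descent by simp
    have m: "move i (\<tau>, v) = (\<tau>, v')" for \<tau> using move_descent[of "(\<tau>, v)"] d by (simp add: v'_def)
    have asc: "ascent (spec (\<tau>, v) (Suc i)) (spec (\<tau>, v) i)" for \<tau> using d by (simp add: ascent_def spec_def)
    note inc = incoming_move[OF val descent(1,2) asc, unfolded m]
    have l': "length v' = N" using 1(2) by (simp add: v'_def)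
    obtain w where w: "set w \<subseteq> {1..<N}"
        "\<And>\<tau>. RST lam \<tau> \<Longrightarrow> cf (expo v') (jack lam (\<tau>, v')) = fold (vec_s lam) w (basis_vec \<tau>)"
      using 1(1)[OF inc(2)[OF RST_root_tableau] l'] by auto
    have ev: "exp_s i (expo v) = expo v'"
      using exp_s_expo[OF 1(2) descent(1,2)] by (simp add: v'_def)
    have len: "exp_length N (entry v) = Suc (exp_length N (entry v'))"
      using exp_length_descent[OF 1(2) descent(1,2) d] by (simp add: v'_def)
    have "cf (expo v) (jack lam (\<tau>, v)) = fold (vec_s lam) (w @ [i]) (basis_vec \<tau>)"
      if R: "RST lam \<tau>" for \<tau>
    proof -
      \<comment> \<open>The scalar part of the intertwiner contributes nothing: v is longer than v',
        so its exponent does not occur in the previous J.\<close>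
      have "cf (expo v) (jack lam (\<tau>, v')) = 0"
      proof (rule ccontr)
        assume "cf (expo v) (jack lam (\<tau>, v')) \<noteq> 0"
        then have "expo v = expo v' \<or> exp_length N (entry v) < exp_length N (entry v')"
          using jack_support[OF inc(1)[OF R], of "expo v"] unfolding exp_length_expo snd_conv by blast
        then show False using len exp_length_expo[of v] exp_length_expo[of v'] by auto
      qed
      then show ?thesis
        unfolding inc(3)[OF R] intertwine_def
        by (simp add: cf_add cf_scale cf_act ev w(2)[OF R])
    qed
    then show ?thesis using w(1) descent(1,2) by (intro exI[of _ "w @ [i]"]) auto
  qed
qed

lemma fold_vec_s_inverse:
  assumes "set w \<subseteq> {1..<N}" "t \<in> rst_span"
  shows "fold (vec_s lam) (rev w) (fold (vec_s lam) w t) = t"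
  using assms by (induction w arbitrary: t) (auto simp: rst_span_vec_s vec_s_involution)

end

section \<open>Components\<close>

text \<open>A descending list is determined by its multiset, so it equals the list of the values of
  f in the order of the labels. The two uses are \<open>decreasing v\<close> labelled by
  \<open>rank\<close>, and \<open>lambda_T\<close> labelled by \<open>std\<close>.\<close>

lemma sorted_desc_entry:
  assumes "bij_betw p A {1..n}" "length L = n" "sorted_wrt (\<ge>) L" "mset L = image_mset f (mset_set A)"
    and "\<And>x y. x \<in> A \<Longrightarrow> y \<in> A \<Longrightarrow> p x < p y \<Longrightarrow> f x \<ge> f y" "x \<in> A"
  shows "entry L (p x) = f x"
proof -
  define q where "q = inv_into A p"
  have q: "bij_betw q {1..n} A" unfolding q_def by (rule bij_betw_inv_into[OF assms(1)])
  have pq: "p (q k) = k" if "k \<in> {1..n}" for k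
    using that assms(1) by (simp add: q_def bij_betw_inv_into_right)
  define L' where "L' = map (\<lambda>k. f (q k)) [1..<Suc n]"
  have "sorted_wrt (\<ge>) L'"
    unfolding L'_def sorted_wrt_map
  proof (rule sorted_wrt_mono_rel[OF _ sorted_wrt_upt])
    fix k l assume *: "k \<in> set [1..<Suc n]" "l \<in> set [1..<Suc n]" "k < l"
    then show "f (q k) \<ge> f (q l)"
      using assms(5)[of "q k" "q l"] pq[of k] pq[of l] bij_betwE[OF q] by auto
  qed
  moreover have "mset L' = mset L"
  proof -
    have "mset L' = image_mset f (image_mset q (mset_set {1..n}))"
      by (simp add: L'_def multiset.map_comp o_def atLeastLessThanSuc_atLeastAtMost del: upt_Suc)
    also have "image_mset q (mset_set {1..n}) = mset_set A"
      using q by (simp add: image_mset_mset_set bij_betw_def)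
    finally show ?thesis using assms(4) by simp
  qed
  ultimately have "L = L'"
    using assms(3) properties_for_sort[of "rev L" "rev L'"] properties_for_sort[of "rev L'" "rev L'"]
    by (simp add: sorted_wrt_rev)
  moreover have px: "p x \<in> {1..n}" using bij_betwE[OF assms(1)] assms(6) by blast
  moreover have "q (p x) = x" using assms(1,6) by (simp add: q_def bij_betw_inv_into_left)
  ultimately show ?thesis by (auto simp: L'_def nth_append simp del: upt_Suc)
qed

lemma mset_eq_entries: "mset v = image_mset (entry v) (mset_set {1..length v})"
proof -
  have "mset v = mset (map (entry v) [1..<Suc (length v)])"
    by (rule arg_cong[where f = mset]) (auto intro!: nth_equalityI simp del: upt_Suc)
  then show ?thesis by (simp add: atLeastLessThanSuc_atLeastAtMost del: upt_Suc)
qed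

lemma sorted_decreasing: "sorted_wrt (\<ge>) (decreasing v)"
  by (simp add: decreasing_def sorted_wrt_rev)

lemma decreasing_rank:
  assumes "1 \<le> i" "i \<le> length v"
  shows "entry (decreasing v) (rank v i) = entry v i"
proof (rule sorted_desc_entry[OF rank_bij])
  fix i j assume ij: "i \<in> {1..length v}" "j \<in> {1..length v}" "rank v i < rank v j"
  show "entry v i \<ge> entry v j"
  proof (rule ccontr)
    assume "\<not> entry v i \<ge> entry v j"
    then have "rank v j < rank v i" using ij by (intro rank_less) (auto simp: pos_less_def)
    then show False using ij by simp
  qed
qed (use assms mset_eq_entries[of v] in \<open>auto simp: decreasing_def sorted_wrt_rev\<close>)

lemma rank_sorted:
  assumes "sorted_wrt (\<ge>) v" "1 \<le> i" "i \<le> length v"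
  shows "rank v i = i"
proof -
  have mono: "entry v j \<ge> entry v k" if "1 \<le> j" "j \<le> k" "k \<le> length v" for j k
    using sorted_wrt_nth_less[OF assms(1), of "j - 1" "k - 1"] that by (cases "j = k") auto
  have "pos_less v j i \<longleftrightarrow> j < i" if "1 \<le> j" "j \<le> length v" for j
    using mono[of j i] mono[of i j] assms that by (cases "j < i") (auto simp: pos_less_def)
  then have "{j \<in> {1..length v}. pos_less v j i} = {1..<i}" using assms by auto
  then show ?thesis using assms by (simp add: rank_eq)
qed

lemma scale_eq_0_iff: "scale c P = 0 \<longleftrightarrow> c = 0 \<or> P = 0"
proof
  assume *: "scale c P = 0"
  show "c = 0 \<or> P = 0"
  proof (cases "c = 0")
    case False
    then have "P = scale (1 / c) (scale c P)" by simp
    then show ?thesis using * by simp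
  qed simp
qed auto

locale component = shape +
  fixes T :: tableau
  assumes component: "H_comp lam T \<in> H_components lam"
begin

abbreviation C :: "vertex set" where "C \<equiv> H_comp lam T"

definition edge :: "vertex \<Rightarrow> vertex \<Rightarrow> bool" where
  "edge x y \<longleftrightarrow> (\<exists>i. H_edge lam x i y)"

lemma H_edge_iff:
  "H_edge lam x i y \<longleftrightarrow> valid x \<and> 1 \<le> i \<and> i < N \<and> ascent (spec x i) (spec x (Suc i)) \<and> y = move i x"
  using G_edge_Simple_iff[of x i y] by (auto simp: H_edge_def H_vertices_eq)

lemma C_class:
  obtains x where "valid x" "C = {y. valid y \<and> equivclp edge x y}"
proof -
  obtain x where x: "x \<in> H_vertices lam"
    "C = {(x, y). x \<in> H_vertices lam \<and> y \<in> H_vertices lam \<and> equivclp (\<lambda>x y. \<exists>i. H_edge lam x i y) x y} `` {x}"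
    using component unfolding H_components_def by (rule quotientE)
  moreover have "(\<lambda>x y. \<exists>i. H_edge lam x i y) = edge" by (simp add: edge_def fun_eq_iff)
  ultimately show thesis using that[of x] by (auto simp: H_vertices_eq)
qed

lemma C_nonempty: "C \<noteq> {}"
  using C_class equivclp_refl by (metis (mono_tags, lifting) empty_Collect_eq)

lemma C_valid: "x \<in> C \<Longrightarrow> valid x"
  by (simp add: H_comp_def H_vertices_eq)

lemma C_filling: "x \<in> C \<Longrightarrow> filling lam x = T"
  by (simp add: H_comp_def)

lemma C_connected: "x \<in> C \<Longrightarrow> y \<in> C \<Longrightarrow> equivclp edge x y"
  using C_class by (metis (no_types, lifting) equivclp_sym equivclp_trans mem_Collect_eq)

lemma C_move:
  assumes "x \<in> C" "swappable i x"
  shows "move i x \<in> C"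
proof -
  have vx: "valid x" using C_valid assms by blast
  have vm: "valid (move i x)" using valid_move[OF vx assms(2)] .
  have "edge x (move i x) \<or> edge (move i x) x"
  proof (cases "ascent (spec x i) (spec x (Suc i))")
    case True
    then show ?thesis using assms vx by (auto simp: edge_def H_edge_iff)
  next
    case False
    then have "H_edge lam (move i x) i x"
      using assms vx vm move_move[OF vx assms(2)] by (simp add: H_edge_iff spec_move transpose_simps)
    then show ?thesis by (auto simp: edge_def)
  qed
  then have "equivclp edge x (move i x)"
    by (metis equivclp_sym r_into_equivclp)
  moreover obtain a where "C = {y. valid y \<and> equivclp edge a y}" using C_class by blast
  ultimately show ?thesis using assms(1) vm equivclp_trans by fastforce
qed

text \<open>The link between cells and positions: the cell labelled \<sigma>_v[i] holds v[i],
  because the decreasing rearrangement has v[i] at that rank.\<close>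

lemma T_label:
  assumes "x \<in> C" "1 \<le> i" "i \<le> N" "(r, c) \<in> D" "fst x (r, c) = rank (snd x) i"
  shows "T (r, c) = entry (snd x) i"
proof -
  have "T (r, c) = entry (decreasing (snd x)) (rank (snd x) i)"
    using C_filling[OF assms(1), symmetric] assms(4,5) by (simp add: filling_def split_beta)
  also have "\<dots> = entry (snd x) i"
    using C_valid[OF assms(1)] assms by (intro decreasing_rank) (auto simp: valid_def)
  finally show ?thesis .
qed

lemma T_outside:
  assumes "x \<notin> D"
  shows "T x = 0"
proof -
  obtain y where "y \<in> C" using C_nonempty by blast
  from C_filling[OF this, symmetric] show ?thesis using assms by (simp add: filling_def split_beta)
qed

lemma T_mono:
  assumes "(r, c) \<in> D" "(r', c') \<in> D" "r \<le> r'" "c \<le> c'"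
  shows "T (r, c) \<le> T (r', c')"
proof (cases "(r, c) = (r', c')")
  case False
  obtain x where x: "x \<in> C" using C_nonempty by blast
  have R: "RST lam (fst x)" and len: "length (decreasing (snd x)) = N"
    using C_valid[OF x] by (auto simp: valid_def decreasing_def)
  have "fst x (r', c') < fst x (r, c)" using RST_less[OF R assms False] .
  moreover have "1 \<le> fst x (r', c')" "fst x (r, c) \<le> N"
    using labelling_range[OF RST_labelling[OF R]] assms by auto
  ultimately have "decreasing (snd x) ! (fst x (r, c) - 1) \<le> decreasing (snd x) ! (fst x (r', c') - 1)"
    using sorted_wrt_nth_less[OF sorted_decreasing[of "snd x"], of "fst x (r', c') - 1" "fst x (r, c) - 1"] len
    by simp
  then show ?thesis
    using C_filling[OF x, symmetric] assms by (simp add: filling_def split_beta)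
qed simp

lemma finite_C: "finite C"
proof (rule finite_subset)
  show "C \<subseteq> {\<tau>. RST lam \<tau>} \<times> {v. set v \<subseteq> T ` D \<and> length v = N}"
  proof
    fix x assume x: "x \<in> C"
    have v: "RST lam (fst x)" "length (snd x) = N" using C_valid[OF x] by (auto simp: valid_def)
    \<comment> \<open>Through its cell every entry of v is a value of T; this bounds the vectors of
      the component.\<close>
    have "snd x ! k \<in> T ` D" if k: "k < N" for k
    proof -
      have "1 \<le> rank (snd x) (Suc k)" "rank (snd x) (Suc k) \<le> N"
        using rank_range[of "Suc k" "snd x"] v(2) k by auto
      then obtain r c where "(r, c) \<in> D" "fst x (r, c) = rank (snd x) (Suc k)"
        using labelling_cell[OF RST_labelling[OF v(1)]] by blast
      then show ?thesis using T_label[OF x, of "Suc k" r c] k by force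
    qed
    then have "set (snd x) \<subseteq> T ` D" using v(2) by (auto simp: in_set_conv_nth)
    then show "x \<in> {\<tau>. RST lam \<tau>} \<times> {v. set v \<subseteq> T ` D \<and> length v = N}"
      using v by (auto simp: mem_Times_iff)
  qed
  show "finite ({\<tau>. RST lam \<tau>} \<times> {v. set v \<subseteq> T ` D \<and> length v = N})"
    using finite_RST finite_lists_length_eq[of "T ` D" N] finite_diagram by simp
qed

section \<open>The standardization of T\<close>

definition row_less :: "cell \<Rightarrow> cell \<Rightarrow> bool" where
  "row_less y x \<longleftrightarrow> T y < T x \<or> T y = T x \<and> (fst y < fst x \<or> fst y = fst x \<and> snd y < snd x)"

lemma row_less_transp: "transp row_less"
  by (auto simp: row_less_def intro!: transpI)

lemma row_less_irreflp: "irreflp row_less"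
  by (auto simp: row_less_def intro!: irreflpI)

text \<open>The sum in \<open>std\<close> counts the cells with a smaller entry, the last term the
  earlier cells with the same entry; together these are the predecessors in
  \<open>row_less\<close>.\<close>

lemma std_eq: "std lam T = (\<lambda>x. if x \<in> D then N - card {y \<in> D. row_less y x} else 0)"
proof
  fix x :: cell
  obtain r c where x: "x = (r, c)" by (cases x)
  have "(\<Sum>j<T x. card {y \<in> D. T y = j}) = card (\<Union>j<T x. {y \<in> D. T y = j})"
    by (rule card_UN_disjoint[symmetric]) (auto simp: finite_diagram)
  also have "(\<Union>j<T x. {y \<in> D. T y = j}) = {y \<in> D. T y < T x}" by auto
  finally have 1: "(\<Sum>j<T x. card {y \<in> D. T y = j}) = card {y \<in> D. T y < T x}" .
  have 2: "{(r', c'). (r', c') \<in> D \<and> T (r', c') = T (r, c) \<and> (r' < r \<or> r' = r \<and> c' < c)}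
      = {y \<in> D. T y = T x \<and> (fst y < r \<or> fst y = r \<and> snd y < c)}"
    by (auto simp: x)
  have "{y \<in> D. row_less y x} = {y \<in> D. T y < T x} \<union> {y \<in> D. T y = T x \<and> (fst y < r \<or> fst y = r \<and> snd y < c)}"
    by (auto simp: row_less_def x)
  then have "card {y \<in> D. row_less y x}
      = card {y \<in> D. T y < T x} + card {y \<in> D. T y = T x \<and> (fst y < r \<or> fst y = r \<and> snd y < c)}"
    by (simp only:) (rule card_Un_disjoint, auto simp: finite_diagram)
  then show "std lam T x = (if x \<in> D then N - card {y \<in> D. row_less y x} else 0)"
    using 1 2 by (simp add: std_def x)
qed

lemma RST_std: "RST lam (std lam T)"
  unfolding std_eq
proof (rule RST_count_below[OF row_less_transp row_less_irreflp])
  fix r c r' c' assume "(r, c) \<in> D" "(r', c') \<in> D" "r \<le> r'" "c \<le> c'" "(r, c) \<noteq> (r', c')"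
  then show "row_less (r, c) (r', c')" using T_mono[of r c r' c'] by (auto simp: row_less_def)
qed (auto simp: row_less_def prod_eq_iff)

lemma std_less:
  assumes "x \<in> D" "y \<in> D" "std lam T x < std lam T y"
  shows "row_less y x"
proof (rule ccontr)
  assume "\<not> row_less y x"
  then have "row_less x y \<or> x = y" by (auto simp: row_less_def prod_eq_iff)
  then have "card {z \<in> D. row_less z x} \<le> card {z \<in> D. row_less z y}"
    using count_below_less[OF finite_diagram row_less_transp row_less_irreflp assms(1), of y] by auto
  then show False using assms by (simp add: std_eq)
qed

definition top :: vertex where
  "top = (std lam T, lambda_T lam T)"

lemma lambda_T_props:
  "length (lambda_T lam T) = N" "sorted_wrt (\<ge>) (lambda_T lam T)"
  "mset (lambda_T lam T) = image_mset T (mset_set D)"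
proof -
  show m: "mset (lambda_T lam T) = image_mset T (mset_set D)" by (simp add: lambda_T_def)
  have "length (lambda_T lam T) = size (mset (lambda_T lam T))" by simp
  then show "length (lambda_T lam T) = N" unfolding m by (simp add: card_diagram)
  show "sorted_wrt (\<ge>) (lambda_T lam T)" by (simp add: lambda_T_def sorted_wrt_rev)
qed

lemma entry_lambda_T: "x \<in> D \<Longrightarrow> entry (lambda_T lam T) (std lam T x) = T x"
proof (rule sorted_desc_entry[OF RST_labelling[OF RST_std, unfolded labelling_def] lambda_T_props])
  fix x y assume "x \<in> D" "y \<in> D" "std lam T x < std lam T y"
  then have "row_less y x" by (rule std_less)
  then show "T y \<le> T x" by (auto simp: row_less_def)
qed

lemma valid_top: "valid top"
  by (simp add: valid_def top_def RST_std lambda_T_props)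

lemma top_in_C: "top \<in> C"
proof -
  have "decreasing (lambda_T lam T) = lambda_T lam T"
    using properties_for_sort[of "rev (lambda_T lam T)" "lambda_T lam T"] lambda_T_props(2)
    by (simp add: decreasing_def sorted_wrt_rev)
  then have "filling lam top x = T x" for x
    using entry_lambda_T[of x] by (simp add: filling_def top_def T_outside)
  then show ?thesis using valid_top by (auto simp: H_comp_def H_vertices_eq)
qed

section \<open>Antisymmetrization along a component\<close>

text \<open>The factor is -1 + 1/d, from s_i and from the constant of the intertwiner; it vanishes
  only for d = 1, which an ascent excludes.\<close>

lemma antisymmetrizer_move:
  assumes "valid x" "1 \<le> i" "i < N" "ascent (spec x i) (spec x (Suc i))"
  shows "\<exists>a. a \<noteq> 0 \<and> antisymmetrizer lam (jack lam (move i x)) = scale a (antisymmetrizer lam (jack lam x))"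
proof -
  let ?d = "spec_diff (spec x (Suc i)) (spec x i)"
  have "antisymmetrizer lam (jack lam (move i x)) = scale (- 1 + 1 / ?d) (antisymmetrizer lam (jack lam x))"
    using antisymmetrizer_act[OF rst_poly_jack[OF assms(1)] assms(2,3)]
    by (simp add: jack_move[OF assms] intertwine_def antisymmetrizer_add antisymmetrizer_scale
        vpoly.scale_left_diff_distrib)
  moreover have "?d \<noteq> 0" "?d \<noteq> 1"
    using ascent_spectral_value_diff[of _ _ 0] ascent_spectral_value_diff[of _ _ 1] assms(4) by auto
  then have "- 1 + 1 / ?d \<noteq> 0" by (simp add: field_simps)
  ultimately show ?thesis by blast
qed

lemma antisymmetrizer_proportional:
  assumes "x \<in> C" "y \<in> C"
  shows "\<exists>a. a \<noteq> 0 \<and> antisymmetrizer lam (jack lam y) = scale a (antisymmetrizer lam (jack lam x))"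
  using C_connected[OF assms]
proof (induction rule: equivclp_induct)
  case base
  then show ?case by (intro exI[of _ 1]) simp
next
  case (step y z)
  then obtain a where a: "a \<noteq> 0" "antisymmetrizer lam (jack lam y) = scale a (antisymmetrizer lam (jack lam x))"
    by blast
  have "\<exists>b. b \<noteq> 0 \<and> antisymmetrizer lam (jack lam z) = scale b (antisymmetrizer lam (jack lam y))"
    using step(2)
  proof
    assume "edge y z"
    then show ?thesis using antisymmetrizer_move[of y] by (auto simp: edge_def H_edge_iff)
  next
    assume "edge z y"
    then obtain b where "b \<noteq> 0" "antisymmetrizer lam (jack lam y) = scale b (antisymmetrizer lam (jack lam z))"
      using antisymmetrizer_move[of z] by (auto simp: edge_def H_edge_iff)
    then show ?thesis by (intro exI[of _ "1 / b"]) simp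
  qed
  then obtain b where "b \<noteq> 0" "antisymmetrizer lam (jack lam z) = scale b (antisymmetrizer lam (jack lam y))"
    by blast
  with a show ?case by (intro exI[of _ "b * a"]) simp
qed

lemma antisymmetrizer_eq_0:
  assumes "\<not> minus_one_compatible lam T"
  shows "antisymmetrizer lam (jack lam top) = 0"
proof -
  obtain r c c' where cc: "(r, c) \<in> D" "(r, c') \<in> D" "c < c'" "\<not> T (r, c) < T (r, c')"
    using assms by (auto simp: minus_one_compatible_def)
  have x: "(r, c) \<in> D" "(r, Suc c) \<in> D"
    using cc diagram_down[OF cc(2), of r "Suc c"] diagram_pos[OF cc(1)] by auto
  have eq: "T (r, c) = T (r, Suc c)"
    using T_mono[OF x] T_mono[OF x(2) cc(2)] cc(3,4) by simp
  define m where "m = std lam T (r, Suc c)"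
  have l: "labelling (std lam T)" using RST_labelling[OF RST_std] .
  \<comment> \<open>In the reading order no cell comes between row neighbours with equal entries, so
    their labels are consecutive.\<close>
  have "{y \<in> D. row_less y (r, Suc c)} = insert (r, c) {y \<in> D. row_less y (r, c)}"
    using x eq by (auto simp: row_less_def)
  moreover have "\<not> row_less (r, c) (r, c)" by (simp add: row_less_def)
  ultimately have "card {y \<in> D. row_less y (r, Suc c)} = Suc (card {y \<in> D. row_less y (r, c)})"
    using finite_diagram by simp
  then have m1: "std lam T (r, c) = Suc m"
    using x labelling_range[OF l x(2)] by (simp add: m_def std_eq)
  have m: "1 \<le> m" "m < N"
    using labelling_range[OF l x(2)] labelling_range[OF l x(1)] m1 m_def by auto
  have rk: "rank (snd top) k = k" if "1 \<le> k" "k \<le> N" for k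
    using rank_sorted[OF lambda_T_props(2)] that lambda_T_props(1) by (simp add: top_def)
  have sp: "spec top m = (T (r, Suc c), int (Suc c) - int r)" "spec top (Suc m) = (T (r, c), int c - int r)"
    using m rk[of m] rk[of "Suc m"] entry_lambda_T[OF x(1)] entry_lambda_T[OF x(2)] m1
      CT_label[OF l x(1)] CT_label[OF l x(2)]
    by (simp_all add: spec_def m_def[symmetric]) (simp_all add: top_def)
  have "act lam m (jack lam top) = scale (of_int 1) (jack lam top)"
    by (rule act_jack_tie[OF valid_top m]) (simp_all add: sp eq)
  then have "antisymmetrizer lam (jack lam top) = - antisymmetrizer lam (jack lam top)"
    using antisymmetrizer_act[OF rst_poly_jack[OF valid_top] m] by simp
  then have "scale (1 + 1) (antisymmetrizer lam (jack lam top)) = 0"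
    unfolding vpoly.scale_left_distrib by (simp add: eq_neg_iff_add_eq_0)
  then show ?thesis unfolding scale_eq_0_iff by simp
qed

section \<open>The antisymmetric combination\<close>

definition F_weight :: "nat \<Rightarrow> ratfun \<Rightarrow> ratfun \<Rightarrow> ratfun" where
  "F_weight i d a = - (d / (d + 1)) * a"

lemma F_rel_in_C: "F_rel lam T x a \<Longrightarrow> x \<in> C"
  by (induction rule: F_rel.induct) auto

lemma F_rel_move:
  assumes "x \<in> C" "F_rel lam T x a" "1 \<le> i" "i < N" "ascent (spec x i) (spec x (Suc i))"
  shows "F_rel lam T (move i x) (F_weight i (spec_diff (spec x (Suc i)) (spec x i)) a)"
proof -
  have vx: "valid x" using C_valid[OF assms(1)] .
  have "H_edge lam x i (move i x)" "move i x \<in> C"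
    using assms vx C_move[OF assms(1)] by (auto simp: H_edge_iff)
  from F_rel.edge[OF assms(1) this(2,1) assms(2) refl]
  show ?thesis using assms vx by (simp add: F_weight_def zeta_eq spec_move transpose_simps)
qed

lemma F_rel_cases:
  assumes "F_rel lam T x a"
  obtains (root) "\<And>i. 1 \<le> i \<Longrightarrow> i < N \<Longrightarrow> \<not> ascent (spec x (Suc i)) (spec x i)" "a = 1"
  | (move) i b where "1 \<le> i" "i < N" "ascent (spec x (Suc i)) (spec x i)" "F_rel lam T (move i x) b"
      "a = F_weight i (spec_diff (spec x i) (spec x (Suc i))) b"
  using assms
proof cases
  case root
  have vx: "valid x" using C_valid root by blast
  have "\<not> ascent (spec x (Suc i)) (spec x i)" if i: "1 \<le> i" "i < N" for i
  proof
    assume a: "ascent (spec x (Suc i)) (spec x i)"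
    then have s: "swappable i x" using i by simp
    have "H_edge lam (move i x) i x"
      using i a vx valid_move[OF vx s] move_move[OF vx s] by (simp add: H_edge_iff spec_move transpose_simps)
    then show False using root C_move[OF _ s] by blast
  qed
  then show ?thesis using that(1) root by blast
next
  case (edge y i b d)
  have vy: "valid y" using C_valid edge by blast
  have e: "1 \<le> i" "i < N" "ascent (spec y i) (spec y (Suc i))" "x = move i y"
    using edge by (auto simp: H_edge_iff)
  then have sp: "spec x i = spec y (Suc i)" "spec x (Suc i) = spec y i" and b: "move i x = y"
    using vy move_move[OF vy] by (simp_all add: spec_move transpose_simps)
  show ?thesis
    using that(2)[of i b] e sp b edge by (simp add: F_weight_def zeta_eq)
qed

lemma F_rel_exists: "x \<in> C \<Longrightarrow> \<exists>a. F_rel lam T x a"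
proof (induction x rule: wf_induct_rule[OF wf_below])
  case (1 x)
  have vx: "valid x" using C_valid 1(2) by blast
  show ?case
  proof (cases "\<exists>i. 1 \<le> i \<and> i < N \<and> ascent (spec x (Suc i)) (spec x i)")
    case True
    then obtain i where i: "1 \<le> i" "i < N" "ascent (spec x (Suc i)) (spec x i)" by blast
    then have s: "swappable i x" by simp
    have y: "move i x \<in> C" "valid (move i x)" "move i (move i x) = x"
      using C_move[OF 1(2) s] valid_move[OF vx s] move_move[OF vx s] .
    have a: "ascent (spec (move i x) i) (spec (move i x) (Suc i))"
      using i vx by (simp add: spec_move transpose_simps)
    obtain b where "F_rel lam T (move i x) b"
      using 1(1)[OF incoming_move(2)[OF vx i] y(1)] by blast
    then show ?thesis using F_rel_move[OF y(1) _ i(1,2) a] y(3) by auto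
  next
    case False
    then have "\<not> (\<exists>y\<in>C. \<exists>i. H_edge lam y i x)"
      using C_valid by (auto simp: H_edge_iff spec_move transpose_simps)
    then show ?thesis using F_rel.root[OF 1(2)] by blast
  qed
qed

lemma F_rel_unique: "F_rel lam T x a \<Longrightarrow> F_rel lam T x b \<Longrightarrow> a = b"
proof (induction x arbitrary: a b rule: wf_induct_rule[OF wf_below])
  case (1 x)
  have xC: "x \<in> C" using F_rel_in_C 1(2) by blast
  have MM: "F_weight i (spec_diff (spec x i) (spec x (Suc i))) a
      = F_weight j (spec_diff (spec x j) (spec x (Suc j))) b"
    if "1 \<le> i" "i < N" "ascent (spec x (Suc i)) (spec x i)" "F_rel lam T (move i x) a"
      "1 \<le> j" "j < N" "ascent (spec x (Suc j)) (spec x j)" "F_rel lam T (move j x) b" for i j a b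
  proof (rule diamond[where R = "F_rel lam T" and S = C and W = F_weight and x = x,
        OF C_valid C_move F_rel_move F_rel_exists _ _ _ xC that])
    fix y m m' assume "(y, x) \<in> below" "F_rel lam T y m" "F_rel lam T y m'"
    then show "m = m'" using 1(1) by blast
  \<comment> \<open>The weights of F are scalars, so the commutation and braid conditions merely
    reorder factors.\<close>
  qed (simp_all add: F_weight_def mult_ac)
  from 1(2) show ?case
  proof (cases rule: F_rel_cases)
    case root
    note r = root
    from 1(3) show ?thesis
      by (cases rule: F_rel_cases) (use r in auto)
  next
    case (move i a')
    note m = move
    from 1(3) show ?thesis
    proof (cases rule: F_rel_cases)
      case root
      then show ?thesis using m by blast
    next
      case (move j b')
      then show ?thesis using MM[OF m(1-4) move(1-4)] m(5) by simp
    qed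
  qed
qed

text \<open>The factor d/(d+1) could degenerate only for d = 0 or d = -1, and neither occurs along
  an edge.\<close>

lemma F_rel_nonzero: "F_rel lam T x a \<Longrightarrow> a \<noteq> 0"
proof (induction x arbitrary: a rule: wf_induct_rule[OF wf_below])
  case (1 x)
  have vx: "valid x" using F_rel_in_C C_valid 1(2) by blast
  from 1(2) show ?case
  proof (cases rule: F_rel_cases)
    case (move i b)
    let ?d = "spec_diff (spec x i) (spec x (Suc i))"
    have "?d \<noteq> 0" "?d \<noteq> - 1"
      using move(3) ascent_spectral_value_diff[of _ _ 0] ascent_spectral_value_diff[of _ _ "- 1"] by auto
    then have "?d / (?d + 1) \<noteq> 0" by (simp add: add_eq_0_iff)
    moreover have "b \<noteq> 0" using 1(1)[OF incoming_move(2)[OF vx move(1-3)] move(4)] .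
    ultimately show ?thesis using move(5) by (simp add: F_weight_def)
  qed simp
qed

lemma F_rel_F_coeff: "x \<in> C \<Longrightarrow> F_rel lam T x (F_coeff lam T x)"
  unfolding F_coeff_def using F_rel_exists F_rel_unique by (metis theI)

lemma F_coeff_move:
  assumes "x \<in> C" "1 \<le> i" "i < N" "ascent (spec x i) (spec x (Suc i))"
  shows "F_coeff lam T (move i x)
    = F_weight i (spec_diff (spec x (Suc i)) (spec x i)) (F_coeff lam T x)"
  using F_rel_move[OF assms(1) F_rel_F_coeff[OF assms(1)] assms(2-4)] F_rel_F_coeff F_rel_in_C F_rel_unique
  by blast

text \<open>The origin of the factor in F: k = -(d/(d+1)) F solves k/d = -k - F, and this turns the
  contribution of the two vertices into k (s_i J - J), which s_i negates.\<close>

lemma act_pair: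
  assumes "x \<in> C" "1 \<le> i" "i < N" "ascent (spec x i) (spec x (Suc i))"
  defines "Q \<equiv> scale (F_coeff lam T x) (jack lam x) + scale (F_coeff lam T (move i x)) (jack lam (move i x))"
  shows "act lam i Q = - Q"
proof -
  have vx: "valid x" using C_valid[OF assms(1)] .
  define d where "d = spec_diff (spec x (Suc i)) (spec x i)"
  define F where "F = F_coeff lam T x"
  have nz: "d \<noteq> 0" "d + 1 \<noteq> 0"
    using assms(4) ascent_spectral_value_diff[of _ _ 0] ascent_spectral_value_diff[of _ _ "- 1"]
    by (auto simp: d_def add_eq_0_iff2)
  define k where "k = - (d / (d + 1)) * F"
  have k: "k * (1 / d) = - k - F"
    using nz by (simp add: k_def divide_simps) (simp add: algebra_simps)
  have "Q = scale F (jack lam x) + scale k (act lam i (jack lam x) + scale (1 / d) (jack lam x))"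
    unfolding Q_def F_coeff_move[OF assms(1-4)] jack_move[OF vx assms(2-4)] d_def[symmetric]
    by (simp add: F_weight_def intertwine_def k_def F_def)
  also have "\<dots> = scale F (jack lam x) + scale k (act lam i (jack lam x)) + scale (- k - F) (jack lam x)"
    unfolding k[symmetric] by (simp add: vpoly.scale_right_distrib)
  also have "\<dots> = scale k (act lam i (jack lam x)) - scale k (jack lam x)"
    by (simp add: vpoly.scale_left_diff_distrib)
  finally have "Q = scale k (act lam i (jack lam x)) - scale k (jack lam x)" .
  then show ?thesis
    using act_act[OF rst_poly_jack[OF vx] assms(2,3)] by (simp add: act.diff act.scale)
qed

text \<open>The two entries of v are equal and the contents differ by at most 1. Difference 0 is
  impossible in a tableau, and 1 would give row neighbours with equal entries of T, against
  strictness. There remains -1, the case of eigenvalue -1.\<close>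

lemma act_jack_not_swappable:
  assumes "minus_one_compatible lam T" "x \<in> C" "1 \<le> i" "i < N" "\<not> swappable i x"
  shows "act lam i (jack lam x) = - jack lam x"
proof -
  have vx: "valid x" using C_valid[OF assms(2)] .
  let ?v = "snd x"
  have len: "length ?v = N" and R: "RST lam (fst x)" using vx by (auto simp: valid_def)
  have tie: "entry ?v i = entry ?v (Suc i)"
    using assms(3-5) by (auto simp: ascent_def spec_def)
  define r where "r = rank ?v i"
  have r: "rank ?v (Suc i) = Suc r" using rank_tie[of i ?v] tie assms(3,4) len by (simp add: r_def)
  have rr: "1 \<le> r" "r < N"
    using rank_range[of i ?v] rank_range[of "Suc i" ?v] assms(3,4) len r by (auto simp: r_def)
  have sp: "spec x i = (entry ?v i, CT lam (fst x) r)" "spec x (Suc i) = (entry ?v i, CT lam (fst x) (Suc r))"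
    using tie r by (simp_all add: spec_def r_def)
  have "CT lam (fst x) r - CT lam (fst x) (Suc r) \<noteq> 1"
  proof
    assume "CT lam (fst x) r - CT lam (fst x) (Suc r) = 1"
    then obtain a c where ac: "(a, c) \<in> D" "(a, Suc c) \<in> D" "fst x (a, c) = Suc r" "fst x (a, Suc c) = r"
      by (rule RST_content_diff_one[OF R rr])
    have "T (a, c) = entry ?v (Suc i)" "T (a, Suc c) = entry ?v i"
      using T_label[OF assms(2), of "Suc i" a c] T_label[OF assms(2), of i a "Suc c"] ac assms(3,4) r
      by (simp_all add: r_def)
    moreover have "T (a, c) < T (a, Suc c)"
      using assms(1) ac(1,2) unfolding minus_one_compatible_def by blast
    ultimately show False using tie by simp
  qed
  moreover have "CT lam (fst x) r - CT lam (fst x) (Suc r) \<noteq> 0"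
    using RST_consecutive_content[OF R rr] by simp
  moreover have "\<bar>CT lam (fst x) r - CT lam (fst x) (Suc r)\<bar> \<le> 1"
    using assms(3-5) unfolding sp by (auto simp: ascent_def)
  ultimately have "CT lam (fst x) r - CT lam (fst x) (Suc r) = - 1" by linarith
  then have "act lam i (jack lam x) = scale (of_int (- 1)) (jack lam x)"
    using act_jack_tie[OF vx assms(3,4), of "- 1"] by (simp add: sp)
  then show ?thesis by simp
qed

lemma act_J_antisym:
  assumes "minus_one_compatible lam T" "1 \<le> i" "i < N"
  shows "act lam i (J_antisym lam T) = - J_antisym lam T"
proof -
  let ?t = "\<lambda>x. scale (F_coeff lam T x) (jack lam x)"
  define A where "A = {x \<in> C. ascent (spec x i) (spec x (Suc i))}"
  define B where "B = {x \<in> C. ascent (spec x (Suc i)) (spec x i)}"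
  define Z where "Z = {x \<in> C. \<not> swappable i x}"
  have fin: "finite A" "finite B" "finite Z" using finite_C by (auto simp: A_def B_def Z_def)
  have "C = A \<union> B \<union> Z" using assms by (auto simp: A_def B_def Z_def)
  moreover have "A \<inter> B = {}" unfolding A_def B_def using ascent_asym by blast
  moreover have "(A \<union> B) \<inter> Z = {}" using assms by (auto simp: A_def B_def Z_def)
  ultimately have "J_antisym lam T = (\<Sum>x\<in>A. ?t x) + (\<Sum>x\<in>B. ?t x) + (\<Sum>x\<in>Z. ?t x)"
    using fin by (simp add: J_antisym_def sum.union_disjoint)
  \<comment> \<open>Each edge labelled i has its source in A and its target in B.\<close>
  moreover have "(\<Sum>x\<in>B. ?t x) = (\<Sum>x\<in>A. ?t (move i x))"
    by (rule sum.reindex_bij_witness[of _ "move i" "move i"])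
       (use C_valid C_move move_move assms in \<open>auto simp: A_def B_def spec_move transpose_simps\<close>)
  ultimately have J: "J_antisym lam T = (\<Sum>x\<in>A. ?t x + ?t (move i x)) + (\<Sum>x\<in>Z. ?t x)"
    by (simp add: sum.distrib)
  have "act lam i (?t x + ?t (move i x)) = - (?t x + ?t (move i x))" if "x \<in> A" for x
    using act_pair[of x i] that assms by (simp add: A_def)
  moreover have "act lam i (?t x) = - ?t x" if "x \<in> Z" for x
    using act_jack_not_swappable[OF assms(1) _ assms(2,3)] that by (simp add: Z_def act.scale)
  ultimately show ?thesis unfolding J
    by (simp only: act.add act.sum sum_negf[symmetric] minus_add_distrib cong: sum.cong)
qed

lemma expo_inj: "length v = N \<Longrightarrow> length v' = N \<Longrightarrow> expo v = expo v' \<Longrightarrow> v = v'"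
proof (rule nth_equalityI)
  fix k assume *: "length v = N" "expo v = expo v'" "k < length v"
  then have "lookup (expo v) (Suc k) = lookup (expo v') (Suc k)" by simp
  then show "v ! k = v' ! k" using * unfolding lookup_expo by simp
qed simp

text \<open>For z with a longest exponent, the coefficient at this exponent comes only from the
  vertices with the same v. Up to an invertible word it is the sum of F times the basis vectors of
  their tableaux, in which that of z has the nonzero coefficient F.\<close>

lemma J_antisym_nonzero: "J_antisym lam T \<noteq> 0"
proof
  assume 0: "J_antisym lam T = 0"
  let ?l = "\<lambda>x. exp_length N (entry (snd x))"
  obtain z where z: "z \<in> C" "\<And>x. x \<in> C \<Longrightarrow> ?l x \<le> ?l z"
  proof -
    have "Max (?l ` C) \<in> ?l ` C" using finite_C C_nonempty by (intro Max_in) auto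
    then obtain z where "z \<in> C" "?l z = Max (?l ` C)" by auto
    then show thesis using that[of z] finite_C by simp
  qed
  define v where "v = snd z"
  have lv: "length v = N" using C_valid[OF z(1)] by (simp add: v_def valid_def)
  obtain w where w: "set w \<subseteq> {1..<N}"
      "\<And>\<tau>. RST lam \<tau> \<Longrightarrow> cf (expo v) (jack lam (\<tau>, v)) = fold (vec_s lam) w (basis_vec \<tau>)"
    using jack_leading_coefficient[OF lv] by blast
  let ?C = "{x \<in> C. snd x = v}"
  define t where "t = (\<Sum>x\<in>?C. smul (F_coeff lam T x) (basis_vec (fst x)))"
  have vanish: "cf (expo v) (jack lam x) = 0" if x: "x \<in> C" "snd x \<noteq> v" for x
  proof (rule ccontr)
    assume "cf (expo v) (jack lam x) \<noteq> 0"
    from jack_support[OF C_valid[OF x(1)] this]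
    have "expo v = expo (snd x) \<or> ?l z < ?l x" unfolding exp_length_expo v_def .
    moreover have "length (snd x) = N" using C_valid[OF x(1)] by (simp add: valid_def)
    ultimately show False using expo_inj[OF lv] x z(2)[OF x(1)] by auto
  qed
  have lead: "cf (expo v) (jack lam x) = fold (vec_s lam) w (basis_vec (fst x))" if "x \<in> ?C" for x
  proof -
    have "RST lam (fst x)" "x = (fst x, v)" using that C_valid by (auto simp: valid_def)
    then show ?thesis using w(2)[of "fst x"] by simp
  qed
  have "0 = cf (expo v) (J_antisym lam T)" using 0 by (simp add: cf_0)
  also have "\<dots> = (\<Sum>x\<in>C. smul (F_coeff lam T x) (cf (expo v) (jack lam x)))"
    by (simp add: J_antisym_def cf_sum cf_scale)
  also have "\<dots> = (\<Sum>x\<in>?C. smul (F_coeff lam T x) (cf (expo v) (jack lam x)))"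
    using finite_C vanish by (intro sum.mono_neutral_right) auto
  also have "\<dots> = (\<Sum>x\<in>?C. smul (F_coeff lam T x) (fold (vec_s lam) w (basis_vec (fst x))))"
    by (rule sum.cong) (simp_all only: lead)
  also have "\<dots> = fold (vec_s lam) w t"
    unfolding t_def module_hom.sum[OF vec_linear_fold_vec_s] module_hom.scale[OF vec_linear_fold_vec_s] ..
  \<comment> \<open>Reversing the word undoes it on the span, since every letter is an involution
    there.\<close>
  finally have "fold (vec_s lam) (rev w) (fold (vec_s lam) w t) = 0"
    using module_hom.zero[OF vec_linear_fold_vec_s, of lam "rev w"] by simp
  moreover have "t \<in> rst_span"
    unfolding t_def using C_valid
    by (intro rst_span_sum rst_span_smul rst_span_basis_vec) (auto simp: valid_def)
  ultimately have "t = 0" using fold_vec_s_inverse[OF w(1)] by simp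
  moreover have "lookup t (fst z) = (\<Sum>x\<in>?C. if x = z then F_coeff lam T x else 0)"
    unfolding t_def lookup_sum
    by (rule sum.cong) (auto simp: lookup_single when_def v_def prod_eq_iff)
  moreover have "\<dots> = F_coeff lam T z"
    using finite_C z(1) by (simp add: v_def)
  ultimately show False using F_rel_nonzero[OF F_rel_F_coeff[OF z(1)]] by simp
qed

lemma antisymmetrizer_nonzero:
  assumes "minus_one_compatible lam T"
  shows "antisymmetrizer lam (jack lam top) \<noteq> 0"
proof
  assume 0: "antisymmetrizer lam (jack lam top) = 0"
  then have z: "antisymmetrizer lam (jack lam x) = 0" if "x \<in> C" for x
    using antisymmetrizer_proportional[OF top_in_C that] by auto
  interpret anti: module_hom scale scale "antisymmetrizer lam" by (rule antisymmetrizer_hom)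
  have "antisymmetrizer lam (J_antisym lam T) = 0"
    by (simp add: J_antisym_def anti.sum anti.scale z)
  moreover have "antisymmetrizer lam (J_antisym lam T) = scale (of_nat (fact N)) (J_antisym lam T)"
    using act_J_antisym[OF assms] by (rule antisymmetrizer_antisymmetric)
  ultimately show False
    using J_antisym_nonzero by (simp add: scale_eq_0_iff)
qed

end

theorem theorem5p12:
  fixes lam :: "nat list" and N :: nat and T :: tableau
  assumes "0 < N"
    and "partition_of lam N"
    and "H_comp lam T \<in> H_components lam"
  shows "(\<forall>(\<tau>, v) \<in> H_comp lam T. \<exists>a :: ratfun.
            antisymmetrizer lam (jack lam (\<tau>, v)) =
              scale a (antisymmetrizer lam (jack lam (std lam T, lambda_T lam T))))
       \<and> (antisymmetrizer lam (jack lam (std lam T, lambda_T lam T)) \<noteq> 0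
            \<longleftrightarrow> minus_one_compatible lam T)
       \<and> (minus_one_compatible lam T \<longrightarrow>
            (\<forall>i. 1 \<le> i \<and> i < N \<longrightarrow> diag_op lam [i] (J_antisym lam T) = - J_antisym lam T))"
proof -
  have N: "N = sum_list lam" using assms(2) by (simp add: partition_of_def)
  interpret component lam T
    by standard (use assms in \<open>auto simp: partition_of_def\<close>)
  show ?thesis unfolding top_def[symmetric] act_def[symmetric] N
    using antisymmetrizer_proportional[OF top_in_C] antisymmetrizer_eq_0 antisymmetrizer_nonzero act_J_antisym
    by (intro conjI) fast+
qed

end
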